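(* Define the following power series in $q$ (with $(a;q)_\infty=\prod_{j\ge0}(1-aq^j)$ and $(a_1,\dots,a_k;q)_\infty=(a_1;q)_\infty\cdots(a_k;q)_\infty$): \begin{align*} \sum_{n\ge1}\mathrm{spt}_{G1}(n)q^n&=\sum_{n=1}^\infty \frac{q^n (q^{4n+2};q^2)_\infty}{(q^{2n};q^2)_\infty^2\,(q^{2n+1},q^{2n+2};q^2)_\infty},\\ \sum_{n\ge1}\mathrm{spt}_{G2}(n)q^n&=\sum_{n=1}^\infty \frac{q^n (q^{2n+1};q)_\infty}{(q^{n};q)_\infty^2\,(-q^{2n+1};q^2)_\infty},\\ \sum_{n\ge1}\mathrm{spt}_{F1}(n)q^n&=\sum_{n=1}^\infty \frac{q^{n(n-1)/2} (q^{2n+1};q)_\infty}{(q^{n};q)_\infty^2\,(-q^{n+1};q)_\infty},\\ \sum_{n\ge1}\mathrm{spt}_{G3}(n)q^n&=\sum_{n=1}^\infty \frac{(-1)^nq^{n(n+1)/2} (q^{2n+1};q)_\infty}{(q^{n};q)_\infty^2\,(q^{n+1};q)_\infty},\\ \sum_{n\ge1}\mathrm{spt}_{L7}(n)q^n&=\sum_{n=1}^\infty \frac{q^{2n} (-q^{2n+1};q)_\infty}{(q^{2n};q^2)_\infty^2},\\ \sum_{n\ge1}\mathrm{spt}_{L9}(n)q^n&=\sum_{n=1}^\infty \frac{q^{n} (q^{2n+1};q^2)_\infty}{(q^{n};q)_\infty^2},\\ \sum_{n\ge1}\mathrm{spt}_{L12}(n)q^n&=\sum_{n=1}^\infty \frac{q^{2n}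 (-q^{2n+1},-q^{2n+3};q^2)_\infty}{(q^{2n};q^2)_\infty^2}. \end{align*} Then for all integers $n\ge0$: $\mathrm{spt}_{G1}(3n)\equiv0\pmod 3$, $\mathrm{spt}_{G2}(3n)\equiv0\pmod 3$, $\mathrm{spt}_{G2}(3n+2)\equiv0\pmod 3$, $\mathrm{spt}_{L7}(3n+1)\equiv0\pmod 3$, $\mathrm{spt}_{L9}(3n+2)\equiv0\pmod 3$, $\mathrm{spt}_{L12}(3n)\equiv0\pmod 3$, $\mathrm{spt}_{F1}(10n+9)\equiv0\pmod 5$, and $\mathrm{spt}_{G3}(5n+3)\equiv0\pmod 5$ (where coefficients of $q^0$ are taken to be $0$).
   Context: Standard $q$-Pochhammer notation: $(a;q)_n=\prod_{j=0}^{n-1}(1-aq^j)$, $(a;q)_\infty=\prod_{j=0}^{\infty}(1-aq^j)$, and $(a_1,\dots,a_k;q)_n=(a_1;q)_n\cdots(a_k;q)_n$. All series are formal power series in $q$ with integer coefficients. *)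

theory Defs
  imports "HOL-Analysis.Analysis" "HOL-Number_Theory.Cong"
begin

text \<open>
  All series live in the ring of formal power series over the integers, with \<^term>\<open>fps_X\<close>
  playing the role of $q$. Infinite products and sums are the library's \<^const>\<open>prodinf\<close> and
  \<^const>\<open>suminf\<close> with respect to the usual ($q$-adic) topology of formal power series.
\<close>

abbreviation q :: "int fps" where "q \<equiv> fps_X"

definition qpoch_inf :: "int fps \<Rightarrow> int fps \<Rightarrow> int fps" where
  "qpoch_inf a b = (\<Prod>j. 1 - a * b ^ j)"

text \<open>
  The integers are no instance of class \<^class>\<open>inverse\<close>, so the library division on formal power
  series is unavailable. The following is the quotient in the ring of integral power series for
  denominators with constant term 1 (the only ones that occur).
\<close>

definition fps_quot :: "int fps \<Rightarrow> int fps \<Rightarrow> int fps" where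
  "fps_quot f g = f * fps_right_inverse g 1"

definition term_G1 :: "nat \<Rightarrow> int fps" where
  "term_G1 n = fps_quot (q ^ n * qpoch_inf (q ^ (4*n+2)) (q\<^sup>2))
     ((qpoch_inf (q ^ (2*n)) (q\<^sup>2))\<^sup>2 *
      (qpoch_inf (q ^ (2*n+1)) (q\<^sup>2) * qpoch_inf (q ^ (2*n+2)) (q\<^sup>2)))"

definition term_G2 :: "nat \<Rightarrow> int fps" where
  "term_G2 n = fps_quot (q ^ n * qpoch_inf (q ^ (2*n+1)) q)
     ((qpoch_inf (q ^ n) q)\<^sup>2 * qpoch_inf (- (q ^ (2*n+1))) (q\<^sup>2))"

definition term_F1 :: "nat \<Rightarrow> int fps" where
  "term_F1 n = fps_quot (q ^ (n*(n-1) div 2) * qpoch_inf (q ^ (2*n+1)) q)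
     ((qpoch_inf (q ^ n) q)\<^sup>2 * qpoch_inf (- (q ^ (n+1))) q)"

definition term_G3 :: "nat \<Rightarrow> int fps" where
  "term_G3 n = fps_quot ((-1) ^ n * q ^ (n*(n+1) div 2) * qpoch_inf (q ^ (2*n+1)) q)
     ((qpoch_inf (q ^ n) q)\<^sup>2 * qpoch_inf (q ^ (n+1)) q)"

definition term_L7 :: "nat \<Rightarrow> int fps" where
  "term_L7 n = fps_quot (q ^ (2*n) * qpoch_inf (- (q ^ (2*n+1))) q)
     ((qpoch_inf (q ^ (2*n)) (q\<^sup>2))\<^sup>2)"

definition term_L9 :: "nat \<Rightarrow> int fps" where
  "term_L9 n = fps_quot (q ^ n * qpoch_inf (q ^ (2*n+1)) (q\<^sup>2)) ((qpoch_inf (q ^ n) q)\<^sup>2)"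

definition term_L12 :: "nat \<Rightarrow> int fps" where
  "term_L12 n = fps_quot
     (q ^ (2*n) * (qpoch_inf (- (q ^ (2*n+1))) (q\<^sup>2) * qpoch_inf (- (q ^ (2*n+3))) (q\<^sup>2)))
     ((qpoch_inf (q ^ (2*n)) (q\<^sup>2))\<^sup>2)"

text \<open>
  The coefficients of $\sum_{n \ge 1} t(n)$ at positive exponents. The value at 0 is 0 by
  convention; this matters only for \<open>term_F1\<close>, whose series has constant term 1.
\<close>

definition spt_coeff :: "(nat \<Rightarrow> int fps) \<Rightarrow> nat \<Rightarrow> int" where
  "spt_coeff t m = (if m = 0 then 0 else fps_nth (\<Sum>k. t (Suc k)) m)"

definition spt_G1 :: "nat \<Rightarrow> int" where "spt_G1 = spt_coeff term_G1"
definition spt_G2 :: "nat \<Rightarrow> int" where "spt_G2 = spt_coeff term_G2"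
definition spt_F1 :: "nat \<Rightarrow> int" where "spt_F1 = spt_coeff term_F1"
definition spt_G3 :: "nat \<Rightarrow> int" where "spt_G3 = spt_coeff term_G3"
definition spt_L7 :: "nat \<Rightarrow> int" where "spt_L7 = spt_coeff term_L7"
definition spt_L9 :: "nat \<Rightarrow> int" where "spt_L9 = spt_coeff term_L9"
definition spt_L12 :: "nat \<Rightarrow> int" where "spt_L12 = spt_coeff term_L12"

text \<open>
  The products, quotients and sums above are genuine: none of the underlying operators is applied
  outside its domain of convergence.
\<close>

lemma qpoch_inf_has_prod:
  assumes a: "fps_nth a 0 = 0" and b: "fps_nth b 0 = 0"
  shows "(\<lambda>j. 1 - a * b ^ j) has_prod qpoch_inf a b" and "fps_nth (qpoch_inf a b) 0 = 1"
proof -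
  let ?f = "\<lambda>j. 1 - a * b ^ j"
  have f0: "fps_nth (?f j) 0 = 1" for j using a by simp
  have nz: "?f j \<noteq> 0" for j using f0[of j] by (metis fps_zero_nth zero_neq_one)
  have low: "fps_nth (a * b ^ k) m = 0" if "m \<le> k" for k m
  proof -
    have "fps_nth (b ^ k) i = 0" if "i < k" for i
      using startsby_zero_power_prefix[OF b] that by auto
    thus ?thesis using that a
      by (auto simp: fps_mult_nth intro!: sum.neutral) (metis a diff_less le_less_trans
        less_le_trans not_gr_zero not_less diff_is_0_eq diff_zero le_neq_implies_less)
  qed
  define P where "P = Abs_fps (\<lambda>n. fps_nth (\<Prod>k\<le>n. ?f k) n)"
  have lim: "(\<lambda>n. \<Prod>k\<le>n. ?f k) \<longlonglongrightarrow> P"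
  proof (rule tendsto_fpsI)
    fix n
    have "fps_nth (\<Prod>k\<le>N. ?f k) n = fps_nth P n" if "N \<ge> n" for N
      using that
    proof (induction N rule: dec_induct)
      case base
      show ?case by (simp add: P_def)
    next
      case (step N)
      have "fps_nth ((\<Prod>k\<le>N. ?f k) * (a * b ^ Suc N)) n = 0"
        unfolding fps_mult_nth[of "\<Prod>k\<le>N. ?f k"]
        by (intro sum.neutral ballI) (use low step in \<open>auto simp del: power_Suc\<close>)
      thus ?case using step by (simp add: right_diff_distrib)
    qed
    thus "eventually (\<lambda>N. fps_nth (\<Prod>k\<le>N. ?f k) n = fps_nth P n) at_top"
      using eventually_at_top_linorder by blast
  qed
  have P0: "fps_nth P 0 = 1" using a by (simp add: P_def)
  hence "P \<noteq> 0" by auto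
  with lim have "?f has_prod P" by (simp add: has_prod_def raw_has_prod_def)
  moreover from this have "qpoch_inf a b = P"
    unfolding qpoch_inf_def by (rule has_prod_unique[symmetric])
  ultimately show "?f has_prod qpoch_inf a b" "fps_nth (qpoch_inf a b) 0 = 1"
    using P0 by simp_all
qed

lemma fps_quot_mult:
  assumes "fps_nth g 0 = 1"
  shows "fps_quot f g * g = f"
  using fps_right_inverse[of g 1] assms by (simp add: fps_quot_def mult.assoc mult.commute[of _ g])

lemma sums_fpsI:
  fixes t :: "nat \<Rightarrow> int fps"
  assumes "\<And>j k. j < k \<Longrightarrow> fps_nth (t k) j = 0"
  shows "t sums Abs_fps (\<lambda>j. \<Sum>k\<le>j. fps_nth (t k) j)"
  unfolding sums_def
proof (rule tendsto_fpsI)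
  fix n
  have "fps_nth (\<Sum>k<N. t k) n = (\<Sum>k\<le>n. fps_nth (t k) n)" if "N \<ge> Suc n" for N
  proof -
    have "(\<Sum>k\<le>n. fps_nth (t k) n) = (\<Sum>k<N. fps_nth (t k) n)"
      by (intro sum.mono_neutral_left) (use that assms in auto)
    thus ?thesis by (simp add: fps_sum_nth)
  qed
  thus "eventually (\<lambda>N. fps_nth (\<Sum>k<N. t k) n
      = fps_nth (Abs_fps (\<lambda>j. \<Sum>k\<le>j. fps_nth (t k) j)) n) at_top"
    unfolding eventually_at_top_linorder by (intro exI[of _ "Suc n"]) simp
qed

lemma fps_quot_X_power_nth:
  assumes "j < e"
  shows "fps_nth (fps_quot (q ^ e * f) g) j = 0"
  using assms by (simp add: fps_quot_def mult.assoc fps_X_power_mult_nth)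

lemma summable_terms:
  "summable (\<lambda>k. term_G1 (Suc k))" "summable (\<lambda>k. term_G2 (Suc k))"
  "summable (\<lambda>k. term_F1 (Suc k))" "summable (\<lambda>k. term_G3 (Suc k))"
  "summable (\<lambda>k. term_L7 (Suc k))" "summable (\<lambda>k. term_L9 (Suc k))"
  "summable (\<lambda>k. term_L12 (Suc k))"
proof -
  have tri: "k \<le> Suc k * k div 2" for k :: nat by (cases k) auto
  have tri': "k \<le> Suc k * (Suc k + 1) div 2" for k :: nat by simp
  have *: "summable t" if "\<And>j k. j < k \<Longrightarrow> fps_nth (t k) j = 0" for t :: "nat \<Rightarrow> int fps"
    using sums_fpsI[of t] that sums_summable by blast
  show "summable (\<lambda>k. term_G1 (Suc k))" "summable (\<lambda>k. term_G2 (Suc k))"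
    "summable (\<lambda>k. term_L7 (Suc k))" "summable (\<lambda>k. term_L9 (Suc k))"
    "summable (\<lambda>k. term_L12 (Suc k))"
    unfolding term_G1_def term_G2_def term_L7_def term_L9_def term_L12_def
    by (intro * fps_quot_X_power_nth; simp)+
  show "summable (\<lambda>k. term_F1 (Suc k))"
    unfolding term_F1_def
    by (intro * fps_quot_X_power_nth) (use tri less_le_trans in force)
  show "summable (\<lambda>k. term_G3 (Suc k))"
    unfolding term_G3_def mult.assoc mult.left_commute[of "(-1) ^ _"]
    by (intro * fps_quot_X_power_nth) (use tri' less_le_trans in \<open>force simp: mult.assoc\<close>)
qed

end

theory Submission
  imports Defs
begin

text \<open>
  Write $x$ for the base ($q$ or $q^2$). Each term of the series is a constant product times
  $\Delta_m (x;x)_m^2 / (x;x)_{2m+1}$, and the limit $z \to 1$ of the finite Jacobi triple product says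
  \[ \frac{(x;x)_m^2}{(x;x)_{2m+1}} = \sum_{i=0}^m \frac{(-1)^i (2i+1) x^{i(i+1)/2}}{(x;x)_{m-i} (x;x)_{m+i+1}}. \]
  Exchanging the sums gives $\sum_i (-1)^i (2i+1) \Gamma_i$. First or second differences of $\Gamma_i$
  (summation by parts), or a recurrence for $\Gamma_i$, are evaluated in closed form, either by the
  q-Gauss sum or by a creative telescoping in $m$; the result is a theta-like series whose exponents
  avoid the required residue class wherever the weight is nonzero modulo 3. The remaining infinite
  product is a cube, hence a series in $q^3$ modulo 3. For spt_G3 this yields
  $-(q;q)_\infty^{-2} \sum_{j \ge 1} j q^{j^2}$ and for spt_F1
  $(q;q)_\infty^{-2} \bigl((q^2;q^2)_\infty^3 - \sum_{j \ge 1} (-1)^j j^2 q^{j^2}\bigr)$; modulo 5 one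
  multiplies by $(q;q)_\infty^5$ and uses Jacobi's series for $(q;q)_\infty^3$, except that the last
  sum needs the odd part of its product with $\sum_j q^{j^2}$, which is $q (q^4;q^4)_\infty^6$.
\<close>

text \<open>The summation by parts is dictated by the terms. Extracting
  \<open>(x;x)_m^2 / (x;x)_(2m+1)\<close> often leaves \<open>1/(1 + x^(m+1))\<close> or
  \<open>1/(1 - x^(2m+2))\<close> in the factor \<open>D m\<close>, and this denominator blocks the
  q-Gauss sum. The first difference of the kernel multiplies \<open>D m\<close> by
  \<open>1 + x^(m+1)\<close>, the second by \<open>1 - x^(2m+2)\<close>, so each cancels its own
  denominator. The same partial summation turns the weight \<open>2*i+1\<close> into
  \<open>i+1\<close> or \<open>tri (i+1)\<close>, whose residues modulo 3 decide which
  \<open>i\<close> survive. The constant in front is not always a usable power. With E the Euler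
  product and psi, phi the theta series over triangular numbers and over squares, it is completed by
  \<open>1/(E(q) E(q^2)) = psi(q) / E(q^2)^3\<close> for spt_G1 and by
  \<open>1/E(q)^2 = phi(q) E(q^4)^2 / E(q^2)^5\<close> for the square part of spt_F1. Over the
  integers there is no division of series: limits are congruences modulo \<open>q^N\<close>, and
  quotients are products with \<open>iv\<close> or cancellations in an integral domain.\<close>

section \<open>Inverses and $q$-adic approximation\<close>

text \<open>Used only for constant term 1.\<close>

definition iv :: "int fps \<Rightarrow> int fps" where "iv f = fps_right_inverse f 1"

lemma iv_mult_self: "fps_nth f 0 = 1 \<Longrightarrow> f * iv f = 1"
  unfolding iv_def using fps_right_inverse[of f 1] by simp

lemma iv_unique: assumes "f * g = 1" "fps_nth f 0 = 1" shows "iv f = g"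
proof -
  have "iv f = iv f * (f * g)" using assms by simp
  also have "\<dots> = f * iv f * g" by (simp only: mult_ac)
  finally show ?thesis using iv_mult_self[OF assms(2)] by simp
qed

lemma iv_nth_0 [simp]: "fps_nth (iv f) 0 = 1"
  by (simp add: iv_def)

lemma fps_quot_eq_iv: "fps_quot f g = f * iv g"
  by (simp add: fps_quot_def iv_def)

lemma iv_mult: assumes "fps_nth f 0 = 1" "fps_nth g 0 = 1" shows "iv (f * g) = iv f * iv g"
proof (rule iv_unique)
  have "f * g * (iv f * iv g) = (f * iv f) * (g * iv g)" by (simp only: mult_ac)
  then show "f * g * (iv f * iv g) = 1" using assms by (simp add: iv_mult_self)
qed (use assms in simp)

lemma iv_power: "fps_nth f 0 = 1 \<Longrightarrow> iv (f ^ n) = iv f ^ n"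
proof (induction n)
  case 0
  then show ?case by (intro iv_unique) simp_all
next
  case (Suc n)
  then show ?case by (simp add: iv_mult fps_power_zeroth)
qed

lemma iv_swap:
  assumes "a * b = d * c" "fps_nth b 0 = 1" "fps_nth c 0 = 1" shows "a * iv c = d * iv b"
proof -
  have "a * iv c = a * iv c * (b * iv b)" using assms by (simp add: iv_mult_self)
  also have "\<dots> = (a * b) * (iv c * iv b)" by (simp only: mult_ac)
  also have "\<dots> = d * (c * iv c) * iv b" unfolding assms(1) by (simp only: mult_ac)
  finally show ?thesis using assms by (simp add: iv_mult_self)
qed

lemma eq_mult_ivI: assumes "a * b = d" "fps_nth b 0 = 1" shows "a = d * iv b"
  using iv_swap[of a b d 1] assms iv_unique[of 1 1] by simp

lemma iv_mult_cancel: "fps_nth u 0 = 1 \<Longrightarrow> a * iv u * u = a"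
  using iv_mult_self[of u] by (simp add: mult.assoc mult.commute[of "iv u"])

lemma X_power_dvd_iff: "q ^ N dvd f \<longleftrightarrow> (\<forall>j<N. fps_nth f j = 0)"
proof
  assume "q ^ N dvd f"
  then show "\<forall>j<N. fps_nth f j = 0"
    by (auto simp: dvd_def fps_X_power_mult_nth)
next
  assume "\<forall>j<N. fps_nth f j = 0"
  then have "f = q ^ N * fps_shift N f"
    by (intro fps_ext) (auto simp: fps_X_power_mult_nth)
  then show "q ^ N dvd f" by (metis dvd_triv_left)
qed

lemma X_dvd_iff: "q dvd f \<longleftrightarrow> fps_nth f 0 = 0"
  using X_power_dvd_iff[of 1 f] by simp

text \<open>Limits without topology: identities between infinite sums and products are proved by
  comparing truncations modulo every power of \<open>q\<close>. The lemmas on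
  \<open>d dvd a - b\<close> that follow make such congruences compatible with sums, products,
  powers and inverses.\<close>

lemma X_adic_eqI: assumes "\<And>N. q ^ N dvd f - g" shows "f = g"
proof (rule fps_ext)
  fix n
  show "fps_nth f n = fps_nth g n" using assms[of "Suc n"] unfolding X_power_dvd_iff by simp
qed

lemma dvd_diff_trans: "(d :: int fps) dvd a - b \<Longrightarrow> d dvd b - c \<Longrightarrow> d dvd a - c"
  using dvd_add[of d "a - b" "b - c"] by simp

lemma dvd_diff_sym: "(d :: int fps) dvd a - b \<longleftrightarrow> d dvd b - a"
  using dvd_minus_iff[of d "a - b"] by simp

lemma dvd_diff_mult: 
  assumes "(d :: int fps) dvd a - b" "d dvd a' - b'" shows "d dvd a * a' - b * b'"
proof -
  have "a * a' - b * b' = (a - b) * a' + b * (a' - b')" by (simp add: algebra_simps)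
  then show ?thesis using assms by simp
qed

lemma dvd_diff_sum:
  assumes "\<And>i. i \<in> A \<Longrightarrow> (d :: int fps) dvd f i - g i" shows "d dvd sum f A - sum g A"
  unfolding sum_subtractf[symmetric] using assms by (intro dvd_sum)

lemma dvd_diff_power: "(d :: int fps) dvd a - b \<Longrightarrow> d dvd a ^ n - b ^ n"
  by (induction n) (auto intro: dvd_diff_mult)

lemma dvd_diff_iv:
  assumes "(d :: int fps) dvd a - b" "fps_nth a 0 = 1" "fps_nth b 0 = 1" shows "d dvd iv a - iv b"
proof -
  have "iv a - iv b = iv a * (b * iv b) - (a * iv a) * iv b" using assms by (simp add: iv_mult_self)
  also have "\<dots> = (b - a) * (iv a * iv b)" by (simp add: algebra_simps)
  finally show ?thesis using assms(1) by (simp add: dvd_diff_sym[of d a b])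
qed

lemma dvd_power_mono: "q dvd x \<Longrightarrow> k \<le> n \<Longrightarrow> q ^ k dvd x ^ n"
  by (meson dvd_power_le dvd_trans le_imp_power_dvd dvd_power_same)

section \<open>q-adically convergent sums\<close>

text \<open>Coefficient \<open>j\<close> reads only the summands \<open>0..j\<close>, so this is the
  q-adic sum when \<open>q ^ k dvd t k\<close>; that condition therefore recurs as a
  hypothesis.\<close>

definition fsum :: "(nat \<Rightarrow> int fps) \<Rightarrow> int fps" where
  "fsum t = Abs_fps (\<lambda>j. \<Sum>k\<le>j. fps_nth (t k) j)"

lemma suminf_eq_fsum:
  assumes "\<And>k. q ^ k dvd t k" shows "(\<Sum>k. t k) = fsum t"
  unfolding fsum_def using assms
  by (intro sums_unique[symmetric] sums_fpsI) (auto simp: X_power_dvd_iff)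

lemma fsum_approx:
  assumes "\<And>k. q ^ k dvd t k" "N \<le> M" shows "q ^ N dvd fsum t - (\<Sum>k<M. t k)"
  unfolding X_power_dvd_iff
proof (intro allI impI)
  fix j assume j: "j < N"
  have "(\<Sum>k\<le>j. fps_nth (t k) j) = (\<Sum>k<M. fps_nth (t k) j)"
    by (intro sum.mono_neutral_left) (use j assms in \<open>auto simp: X_power_dvd_iff\<close>)
  then show "fps_nth (fsum t - (\<Sum>k<M. t k)) j = 0"
    by (simp add: fsum_def fps_sum_nth)
qed

lemma fsum_eqI:
  assumes t: "\<And>k. q ^ k dvd t k" and "\<And>N. \<exists>M\<ge>N. q ^ N dvd F - (\<Sum>k<M. t k)"
  shows "fsum t = F"
proof (rule X_adic_eqI)
  fix N
  obtain M where "M \<ge> N" "q ^ N dvd F - (\<Sum>k<M. t k)" using assms by blast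
  then show "q ^ N dvd fsum t - F"
    using fsum_approx[OF t, of N M] by (metis dvd_diff_sym dvd_diff_trans)
qed

lemma fsum_dvd: assumes "\<And>k. q ^ k dvd t k" "\<And>k. q ^ N dvd t k" shows "q ^ N dvd fsum t"
proof -
  have "q ^ N dvd fsum t - (\<Sum>k<N. t k)" by (rule fsum_approx[OF assms(1) order_refl])
  moreover have "q ^ N dvd (\<Sum>k<N. t k)" by (intro dvd_sum assms)
  ultimately show ?thesis using dvd_diff_right_iff dvd_diffD by (metis diff_add_cancel dvd_add)
qed

lemma fsum_mult_left:
  assumes "\<And>k. q ^ k dvd t k" shows "fsum (\<lambda>k. c * t k) = c * fsum t"
proof (rule fsum_eqI)
  fix N
  have "q ^ N dvd c * (fsum t - (\<Sum>k<N. t k))" using fsum_approx[OF assms order_refl] by simp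
  then show "\<exists>M\<ge>N. q ^ N dvd c * fsum t - (\<Sum>k<M. c * t k)"
    by (intro exI[of _ N]) (simp add: sum_distrib_left right_diff_distrib)
qed (use assms in simp)

lemma fsum_add:
  assumes "\<And>k. q ^ k dvd t k" "\<And>k. q ^ k dvd u k" shows "fsum (\<lambda>k. t k + u k) = fsum t + fsum u"
  by (intro fps_ext) (simp add: fsum_def sum.distrib)

lemma fsum_cong: "(\<And>k. t k = u k) \<Longrightarrow> fsum t = fsum u" by (simp add: fsum_def)

text \<open>Reordering by \<open>m = i + s\<close>. A summand with \<open>m\<close> at least
  \<open>N\<close> is divisible by \<open>q ^ N\<close>, so modulo \<open>q ^ N\<close> both
  iterated sums reduce to the finite triangle \<open>i + s < N\<close>.\<close>

lemma fsum_exchange: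
  assumes u: "\<And>m i. i \<le> m \<Longrightarrow> q ^ m dvd u m i"
  shows "fsum (\<lambda>m. \<Sum>i\<le>m. u m i) = fsum (\<lambda>i. fsum (\<lambda>s. u (i + s) i))"
proof (rule fsum_eqI)
  fix m show "q ^ m dvd (\<Sum>i\<le>m. u m i)" using u by (intro dvd_sum) auto
next
  fix N
  have us: "q ^ s dvd u (i + s) i" for i s
    using u[of i "i + s"] by (meson dvd_trans le_add1 le_add2 le_imp_power_dvd)
  have ui: "q ^ i dvd u (i + s) i" for i s
    using u[of i "i + s"] by (meson dvd_trans le_add1 le_add2 le_imp_power_dvd)
  have 1: "q ^ N dvd fsum (\<lambda>i. fsum (\<lambda>s. u (i + s) i)) - (\<Sum>i<N. fsum (\<lambda>s. u (i + s) i))"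
    by (intro fsum_approx fsum_dvd us ui order_refl)
  have "q ^ N dvd fsum (\<lambda>s. u (i + s) i) - (\<Sum>s<N-i. u (i + s) i)" if "i < N" for i
  proof -
    have "(\<Sum>s<N. u (i + s) i) = (\<Sum>s<N-i. u (i + s) i) + (\<Sum>s=N-i..<N. u (i + s) i)"
      by (subst sum.union_disjoint[symmetric]) (auto intro!: sum.cong)
    moreover have "q ^ N dvd (\<Sum>s=N-i..<N. u (i + s) i)"
    proof (intro dvd_sum)
      fix s assume "s \<in> {N-i..<N}"
      then have "N \<le> i + s" by auto
      then show "q ^ N dvd u (i + s) i" using u[of i "i+s"]
        by (meson dvd_trans le_add1 le_imp_power_dvd)
    qed
    ultimately show ?thesis using fsum_approx[OF us[of _ i], of N N]
      by (metis add_diff_cancel_left' dvd_diff_trans order_refl)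
  qed
  then have 2: "q ^ N dvd (\<Sum>i<N. fsum (\<lambda>s. u (i + s) i)) - (\<Sum>i<N. \<Sum>s<N-i. u (i + s) i)"
    by (intro dvd_diff_sum) auto
  have "(\<Sum>i<N. \<Sum>s<N-i. u (i + s) i) = (\<Sum>m<N. \<Sum>i\<le>m. u m i)"
    unfolding sum.Sigma[OF finite_lessThan ballI[OF finite_lessThan]]
      sum.Sigma[OF finite_lessThan ballI[OF finite_atMost]]
    by (rule sum.reindex_bij_witness[of _ "\<lambda>(m,i). (i, m - i)" "\<lambda>(i,s). (i + s, i)"]) auto
  then show "\<exists>M\<ge>N. q ^ N dvd fsum (\<lambda>i. fsum (\<lambda>s. u (i + s) i)) - (\<Sum>m<M. \<Sum>i\<le>m. u m i)"
    using dvd_diff_trans[OF 1 2] by (intro exI[of _ N]) simp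
qed

text \<open>In the applications \<open>A\<close> belongs to \<open>i\<close> and \<open>B\<close> to
  \<open>Suc i\<close>, with a factor \<open>D\<close> evaluated at index plus \<open>s\<close>. The
  truncation of \<open>A\<close> is one summand longer so that both stop at the same argument of
  \<open>D\<close>, which is what lets their combination telescope.\<close>

lemma fsum_combine:
  assumes "\<And>k. q ^ k dvd A k" "\<And>k. q ^ k dvd B k"
    and "\<And>N. q ^ N dvd L - ((\<Sum>s<Suc N. A s) + c * (\<Sum>s<N. B s))"
  shows "fsum A + c * fsum B = L"
proof (rule X_adic_eqI)
  fix N
  have "q ^ N dvd (fsum A + c * fsum B) - ((\<Sum>s<Suc N. A s) + c * (\<Sum>s<N. B s))"
  proof -
    have "(fsum A + c * fsum B) - ((\<Sum>s<Suc N. A s) + c * (\<Sum>s<N. B s)) =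
      (fsum A - (\<Sum>s<Suc N. A s)) + c * (fsum B - (\<Sum>s<N. B s))" by (simp add: algebra_simps)
    moreover have "q ^ N dvd fsum A - (\<Sum>s<Suc N. A s)" by (rule fsum_approx[OF assms(1)]) simp
    moreover have "q ^ N dvd c * (fsum B - (\<Sum>s<N. B s))"
      by (intro dvd_mult fsum_approx[OF assms(2)] order_refl)
    ultimately show ?thesis by (metis dvd_add)
  qed
  then show "q ^ N dvd (fsum A + c * fsum B) - L"
    using assms(3) by (metis dvd_diff_sym dvd_diff_trans)
qed

definition tri :: "nat \<Rightarrow> nat" where "tri i = i * (i + 1) div 2"

lemma tri_0 [simp]: "tri 0 = 0" by (simp add: tri_def)
lemma tri_Suc: "tri (Suc i) = tri i + Suc i" by (simp add: tri_def)
lemma two_tri: "2 * tri i = i * (i + 1)" by (simp add: tri_def)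
lemma le_tri: "i \<le> tri i" by (induction i) (auto simp: tri_Suc)

text \<open>Both follow by partial summation, since the sums of $(-1)^k (2k+1)$ are $(-1)^i (i+1)$.\<close>

lemma fsum_abel:
  assumes H: "\<And>i. q ^ i dvd H i"
  shows "fsum (\<lambda>i. (-1) ^ i * of_nat (2 * i + 1) * H i) =
    fsum (\<lambda>i. (-1) ^ i * of_nat (i + 1) * (H i - H (Suc i)))" (is ?one)
  and "fsum (\<lambda>i. (-1) ^ i * of_nat (2 * i + 1) * H i) =
    fsum (\<lambda>i. (-1) ^ i * of_nat (tri (Suc i)) * (H i - H (Suc (Suc i))))" (is ?two)
proof -
  have H1: "q ^ i dvd H (Suc i)" for i using H[of "Suc i"] by (meson dvd_trans le_imp_power_dvd le_SucI order_refl)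
  have H2: "q ^ i dvd H (Suc (Suc i))" for i using H1[of "Suc i"] by (meson dvd_trans le_imp_power_dvd le_SucI order_refl)
  have a1: "(\<Sum>i<N. (-1) ^ i * of_nat (i + 1) * (H i - H (Suc i))) =
    (\<Sum>i<N. (-1) ^ i * of_nat (2 * i + 1) * H i) + (-1) ^ N * of_nat N * H N" for N
    by (induction N) (simp_all add: algebra_simps)
  have a2: "(\<Sum>i<N. (-1) ^ i * of_nat (tri (Suc i)) * (H i - H (Suc (Suc i)))) =
    (\<Sum>i<N. (-1) ^ i * of_nat (2 * i + 1) * H i) +
    (-1) ^ N * (of_nat (tri N) * H (Suc N) - of_nat (tri (N - 1)) * H N)" for N
  proof (induction N)
    case 0 then show ?case by simp
  next
    case (Suc N)
    \<comment> \<open>Truncated subtraction is harmless at \<open>N = 0\<close>: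
      \<open>tri (0 - 1) = 0\<close> is also the value of \<open>k*(k+1)/2\<close> at
      \<open>k = -1\<close>.\<close>
    have "tri (Suc N) = tri (N - 1) + (2 * N + 1)" by (cases N) (auto simp: tri_Suc)
    then have e: "of_nat (tri (Suc N)) = (of_nat (tri (N - 1)) + of_nat (2 * N + 1) :: int fps)"
      by (simp only: of_nat_add)
    show ?case unfolding sum.lessThan_Suc Suc unfolding diff_Suc_1 e
      by (simp add: algebra_simps)
  qed
  show ?one
  proof (rule sym, rule fsum_eqI)
    fix N
    have "q ^ N dvd fsum (\<lambda>i. (-1) ^ i * of_nat (2 * i + 1) * H i) - (\<Sum>i<N. (-1) ^ i * of_nat (2 * i + 1) * H i)"
      by (intro fsum_approx dvd_mult H order_refl)
    then have "q ^ N dvd fsum (\<lambda>i. (-1) ^ i * of_nat (2 * i + 1) * H i) - (\<Sum>i<N. (-1) ^ i * of_nat (2 * i + 1) * H i) -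
      (-1) ^ N * of_nat N * H N" by (rule dvd_diff[OF _ dvd_mult[OF H]])
    then show "\<exists>M\<ge>N. q ^ N dvd fsum (\<lambda>i. (-1) ^ i * of_nat (2 * i + 1) * H i) - (\<Sum>i<M. (-1) ^ i * of_nat (i + 1) * (H i - H (Suc i)))"
      unfolding a1 by (intro exI[of _ N]) (simp add: algebra_simps)
  qed (intro dvd_mult dvd_diff H H1)
  show ?two
  proof (rule sym, rule fsum_eqI)
    fix N
    have "q ^ N dvd fsum (\<lambda>i. (-1) ^ i * of_nat (2 * i + 1) * H i) - (\<Sum>i<N. (-1) ^ i * of_nat (2 * i + 1) * H i)"
      by (intro fsum_approx dvd_mult H order_refl)
    then have "q ^ N dvd fsum (\<lambda>i. (-1) ^ i * of_nat (2 * i + 1) * H i) - (\<Sum>i<N. (-1) ^ i * of_nat (2 * i + 1) * H i) -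
      (-1) ^ N * (of_nat (tri N) * H (Suc N) - of_nat (tri (N - 1)) * H N)"
      by (rule dvd_diff) (intro dvd_mult dvd_diff H H1)
    then show "\<exists>M\<ge>N. q ^ N dvd fsum (\<lambda>i. (-1) ^ i * of_nat (2 * i + 1) * H i) - (\<Sum>i<M. (-1) ^ i * of_nat (tri (Suc i)) * (H i - H (Suc (Suc i))))"
      unfolding a2 by (intro exI[of _ N]) (simp add: algebra_simps)
  qed (intro dvd_mult dvd_diff H H2)
qed

section \<open>Finite and infinite q-Pochhammer symbols\<close>

definition qpoch :: "int fps \<Rightarrow> int fps \<Rightarrow> nat \<Rightarrow> int fps" where
  "qpoch a b n = (\<Prod>j<n. 1 - a * b ^ j)"

lemma qpoch_0 [simp]: "qpoch a b 0 = 1" by (simp add: qpoch_def)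
lemma qpoch_Suc: "qpoch a b (Suc n) = qpoch a b n * (1 - a * b ^ n)" by (simp add: qpoch_def)

lemma qpoch_nth_0: "q dvd a \<Longrightarrow> fps_nth (qpoch a b n) 0 = 1"
  by (induction n) (auto simp: qpoch_Suc X_dvd_iff)

lemma qpoch_add: "qpoch a b (m + n) = qpoch a b m * qpoch (a * b ^ m) b n"
  by (induction n) (simp_all add: qpoch_Suc power_add mult.assoc)

lemma qpoch_bisect: "qpoch a b (2 * n) = qpoch a (b ^ 2) n * qpoch (a * b) (b ^ 2) n"
  by (induction n) (simp_all add: qpoch_Suc power_mult[symmetric] power_add mult_ac)

lemma qpoch_mult_minus: "qpoch a b n * qpoch (- a) b n = qpoch (a ^ 2) (b ^ 2) n"
proof (induction n)
  case (Suc n)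
  have "qpoch a b (Suc n) * qpoch (- a) b (Suc n) =
     (qpoch a b n * qpoch (- a) b n) * ((1 - a * b ^ n) * (1 + a * b ^ n))"
    by (simp add: qpoch_Suc mult_ac)
  also have "(1 - a * b ^ n) * (1 + a * b ^ n) = 1 - a ^ 2 * (b ^ 2) ^ n"
    by (simp add: algebra_simps power2_eq_square power_mult_distrib)
  finally show ?case using Suc by (simp add: qpoch_Suc)
qed simp

lemma qpoch_approx:
  assumes "q dvd b" "N \<le> M" shows "q ^ N dvd qpoch a b M - qpoch a b N"
  using assms(2)
proof (induction M rule: dec_induct)
  case (step M)
  have "q ^ N dvd b ^ M" using step assms by (intro dvd_power_mono) auto
  then have "q ^ N dvd (qpoch a b M - qpoch a b N) - qpoch a b M * (a * b ^ M)"
    by (intro dvd_diff[OF step.IH] dvd_mult)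
  then show ?case by (simp add: qpoch_Suc algebra_simps)
qed simp

abbreviation euler :: "int fps \<Rightarrow> int fps" where "euler x \<equiv> qpoch_inf x x"

text \<open>Turns the convergence of infinite products into congruences, the form used by all later
  limits of products. The finitely many coefficients below \<open>N\<close> agree with those of some
  long partial product, and the factors from index \<open>M\<close> on are 1 modulo
  \<open>q ^ N\<close>.\<close>

lemma qpoch_inf_approx:
  assumes "q dvd a" "q dvd b" "N \<le> M" shows "q ^ N dvd qpoch_inf a b - qpoch a b M"
proof -
  have "(\<lambda>j. 1 - a * b ^ j) has_prod qpoch_inf a b" "fps_nth (qpoch_inf a b) 0 = 1"
    using assms by (simp_all add: qpoch_inf_has_prod X_dvd_iff)
  then have "(\<lambda>n. \<Prod>k\<le>n. 1 - a * b ^ k) \<longlonglongrightarrow> qpoch_inf a b"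
    using has_prod_imp_tendsto by blast
  then have "\<forall>j. \<forall>\<^sub>F n in sequentially. fps_nth (\<Prod>k\<le>n. 1 - a * b ^ k) j = fps_nth (qpoch_inf a b) j"
    by (simp add: tendsto_fps_iff)
  then have "\<forall>\<^sub>F n in sequentially. \<forall>j\<in>{..<N}. fps_nth (\<Prod>k\<le>n. 1 - a * b ^ k) j = fps_nth (qpoch_inf a b) j"
    by (intro eventually_ball_finite) auto
  then obtain n0 where "\<forall>n\<ge>n0. \<forall>j\<in>{..<N}. fps_nth (\<Prod>k\<le>n. 1 - a * b ^ k) j = fps_nth (qpoch_inf a b) j"
    unfolding eventually_at_top_linorder by blast
  then have "q ^ N dvd qpoch_inf a b - qpoch a b (Suc (max n0 M))"
    unfolding X_power_dvd_iff qpoch_def lessThan_Suc_atMost by auto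
  moreover have "q ^ N dvd qpoch a b (Suc (max n0 M)) - qpoch a b M"
    using qpoch_approx[OF assms(2), of M "Suc (max n0 M)" a] assms(3)
    by (meson dvd_trans le_imp_power_dvd le_SucI max.cobounded2)
  ultimately show ?thesis by (rule dvd_diff_trans)
qed

lemma qpoch_inf_eqI:
  assumes "q dvd a" "q dvd b" "\<And>N. \<exists>M\<ge>N. q ^ N dvd F - qpoch a b M" shows "qpoch_inf a b = F"
proof (rule X_adic_eqI)
  fix N
  obtain M where "M \<ge> N" "q ^ N dvd F - qpoch a b M" using assms by blast
  then show "q ^ N dvd qpoch_inf a b - F"
    using qpoch_inf_approx[OF assms(1,2), of N M] by (metis dvd_diff_sym dvd_diff_trans)
qed

lemma qpoch_inf_nth_0: "q dvd a \<Longrightarrow> q dvd b \<Longrightarrow> fps_nth (qpoch_inf a b) 0 = 1"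
  using qpoch_inf_has_prod(2) X_dvd_iff by blast

lemma qpoch_inf_split:
  assumes "q dvd a" "q dvd b" shows "qpoch_inf a b = qpoch a b n * qpoch_inf (a * b ^ n) b"
proof (rule qpoch_inf_eqI[OF assms])
  fix N
  have "q ^ N dvd qpoch a b n * (qpoch_inf (a * b ^ n) b - qpoch (a * b ^ n) b N)"
    by (rule dvd_mult[OF qpoch_inf_approx]) (use assms in auto)
  then show "\<exists>M\<ge>N. q ^ N dvd qpoch a b n * qpoch_inf (a * b ^ n) b - qpoch a b M"
    by (intro exI[of _ "n + N"]) (simp add: qpoch_add right_diff_distrib)
qed

lemma qpoch_inf_bisect:
  assumes "q dvd a" "q dvd b" shows "qpoch_inf a b = qpoch_inf a (b ^ 2) * qpoch_inf (a * b) (b ^ 2)"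
proof (rule qpoch_inf_eqI[OF assms])
  fix N
  have "q ^ N dvd qpoch_inf a (b ^ 2) * qpoch_inf (a * b) (b ^ 2) - qpoch a b (2 * N)"
    unfolding qpoch_bisect using assms
    by (intro dvd_diff_mult qpoch_inf_approx) (auto simp: power2_eq_square)
  then show "\<exists>M\<ge>N. q ^ N dvd qpoch_inf a (b ^ 2) * qpoch_inf (a * b) (b ^ 2) - qpoch a b M"
    by (intro exI[of _ "2 * N"]) simp
qed

lemma qpoch_inf_mult_minus:
  assumes "q dvd a" "q dvd b" shows "qpoch_inf a b * qpoch_inf (- a) b = qpoch_inf (a ^ 2) (b ^ 2)"
proof (rule qpoch_inf_eqI[symmetric])
  fix N
  have "q ^ N dvd qpoch_inf a b * qpoch_inf (- a) b - qpoch (a ^ 2) (b ^ 2) N"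
    unfolding qpoch_mult_minus[symmetric] using assms by (intro dvd_diff_mult qpoch_inf_approx) auto
  then show "\<exists>M\<ge>N. q ^ N dvd qpoch_inf a b * qpoch_inf (- a) b - qpoch (a ^ 2) (b ^ 2) M" by blast
qed (use assms in \<open>auto simp: power2_eq_square\<close>)

text \<open>Together with \<open>qpoch_inf_shift\<close> this separates the summation index from the
  constants: the infinite products in the terms are tails, hence a fixed infinite product divided by
  a finite one.\<close>

lemma iv_qpoch_inf_shift:
  assumes "q dvd a" "q dvd b"
  shows "iv (qpoch_inf (a * b ^ n) b) = qpoch a b n * iv (qpoch_inf a b)"
  by (rule iv_unique[OF _ qpoch_inf_nth_0])
    (use assms iv_mult_self[OF qpoch_inf_nth_0[OF assms]] qpoch_inf_split[OF assms, of n] in \<open>auto simp: mult_ac\<close>)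

lemma qpoch_inf_shift:
  assumes "q dvd a" "q dvd b"
  shows "qpoch_inf (a * b ^ n) b = qpoch_inf a b * iv (qpoch a b n)"
  by (rule eq_mult_ivI) (use assms qpoch_inf_split[OF assms, of n] in \<open>simp_all add: qpoch_nth_0 mult.commute\<close>)

definition rq :: "int fps \<Rightarrow> nat \<Rightarrow> int fps" where "rq x n = iv (qpoch x x n)"

lemma rq_nth_0 [simp]: "fps_nth (rq x n) 0 = 1" by (simp add: rq_def)
lemma rq_0 [simp]: "rq x 0 = 1" unfolding rq_def qpoch_0 by (intro iv_unique) simp_all

lemma qpoch_rq: "q dvd x \<Longrightarrow> qpoch x x n * rq x n = 1"
  unfolding rq_def by (intro iv_mult_self qpoch_nth_0)

lemma rq_Suc: assumes "q dvd x" shows "rq x n = rq x (Suc n) * (1 - x ^ Suc n)"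
proof -
  have "fps_nth (1 - x * x ^ n) 0 = 1" using assms by (simp add: X_dvd_iff)
  then show ?thesis unfolding rq_def
    using iv_swap[of 1 "qpoch x x (Suc n)" "1 - x ^ Suc n" "qpoch x x n"] assms
    by (simp add: qpoch_nth_0 qpoch_Suc mult_ac)
qed

lemma rq_approx:
  assumes "q dvd x" "N \<le> n" shows "q ^ N dvd iv (euler x) - rq x n"
  unfolding rq_def using assms by (intro dvd_diff_iv qpoch_inf_approx qpoch_nth_0 qpoch_inf_nth_0)

lemma rq_add: assumes "q dvd x" shows "rq x (m + n) = rq x m * iv (qpoch (x ^ Suc m) x n)"
  unfolding rq_def qpoch_add using assms by (subst iv_mult) (auto simp: qpoch_nth_0)

text \<open>Version of \<open>fsum_combine\<close> for relations between the indices
  \<open>i\<close>, \<open>i+1\<close>, \<open>i+2\<close>; the lengths \<open>N+2\<close>,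
  \<open>N+1\<close>, \<open>N\<close> again make all three truncations end at the same value of
  \<open>i + s\<close>.\<close>

lemma fsum_combine3:
  assumes "\<And>k. q ^ k dvd A k" "\<And>k. q ^ k dvd B k" "\<And>k. q ^ k dvd C k"
    and "\<And>N. q ^ N dvd L - (a * (\<Sum>s<Suc (Suc N). A s) + b * (\<Sum>s<Suc N. B s) + c * (\<Sum>s<N. C s))"
  shows "a * fsum A + b * fsum B + c * fsum C = L"
proof (rule X_adic_eqI)
  fix N
  have "q ^ N dvd a * (fsum A - (\<Sum>s<Suc (Suc N). A s)) + b * (fsum B - (\<Sum>s<Suc N. B s))
      + c * (fsum C - (\<Sum>s<N. C s))"
    by (intro dvd_add dvd_mult fsum_approx[OF assms(1)] fsum_approx[OF assms(2)] fsum_approx[OF assms(3)]) auto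
  then have "q ^ N dvd (a * fsum A + b * fsum B + c * fsum C)
      - (a * (\<Sum>s<Suc (Suc N). A s) + b * (\<Sum>s<Suc N. B s) + c * (\<Sum>s<N. C s))"
    by (simp add: right_diff_distrib del: sum.lessThan_Suc) (simp only: diff_add_eq diff_diff_eq add_diff_eq add_ac)
  then show "q ^ N dvd (a * fsum A + b * fsum B + c * fsum C) - L"
    using assms(4) by (metis dvd_diff_sym dvd_diff_trans)
qed

section \<open>The finite Jacobi triple product\<close>

text \<open>The Gaussian binomial coefficient. The value 0 for \<open>j > N\<close> lets the Pascal
  recursion hold at \<open>j = N\<close> and lets a sum be extended by one index.\<close>

definition qbinom :: "int fps \<Rightarrow> nat \<Rightarrow> nat \<Rightarrow> int fps" where
  "qbinom x N j = (if j \<le> N then qpoch x x N * rq x j * rq x (N - j) else 0)"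

lemma qbinom_0: "q dvd x \<Longrightarrow> qbinom x N 0 = 1"
  by (simp add: qbinom_def qpoch_rq)

lemma qbinom_Suc_Suc:
  assumes "q dvd x" "j \<le> N"
  shows "qbinom x (Suc N) (Suc j) = qbinom x N (Suc j) + x ^ (N - j) * qbinom x N j"
proof -
  obtain s where N: "N = j + s" using assms by (auto simp: le_iff_add)
  show ?thesis
  proof (cases s)
    case 0
    then show ?thesis using assms by (simp add: N qbinom_def qpoch_rq)
  next
    case (Suc s')
    note r = rq_Suc[OF assms(1), of j] rq_Suc[OF assms(1), of s']
    show ?thesis
      unfolding N qbinom_def Suc
      by (simp add: qpoch_Suc r power_add) (simp add: algebra_simps)
  qed
qed

lemma tri_pred: "tri (j - 1) + j = tri j"
  by (cases j) (auto simp: tri_Suc)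

text \<open>Rothe's q-binomial theorem, by induction with the q-Pascal rule. It is kept homogeneous
  in \<open>y\<close> and \<open>z\<close> so that \<open>y = x ^ m\<close> can later play the role
  of a shift of \<open>z\<close> by the nonexistent power \<open>x ^ (-m)\<close>.\<close>

lemma homogeneous_qbinomial:
  assumes x: "q dvd x"
  shows "(\<Prod>k<N. y - z * x ^ k) =
    (\<Sum>j\<le>N. (-1) ^ j * x ^ tri (j - 1) * qbinom x N j * z ^ j * y ^ (N - j))"
proof (induction N)
  case 0
  then show ?case using x by (simp add: qbinom_0)
next
  case (Suc N)
  let ?c = "\<lambda>N j. (-1) ^ j * x ^ tri (j - 1) * qbinom x N j * z ^ j"
  have 1: "y * (\<Sum>j\<le>N. ?c N j * y ^ (N - j)) = (\<Sum>j\<le>Suc N. ?c N j * y ^ (Suc N - j))"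
  proof -
    have "?c N (Suc N) = 0" by (simp add: qbinom_def)
    moreover have "y * (\<Sum>j\<le>N. ?c N j * y ^ (N - j)) = (\<Sum>j\<le>N. ?c N j * y ^ (Suc N - j))"
      unfolding sum_distrib_left by (intro sum.cong) (auto simp: Suc_diff_le mult_ac)
    ultimately show ?thesis by simp
  qed
  have 2: "?c (Suc N) (Suc j) * y ^ (Suc N - Suc j) =
      ?c N (Suc j) * y ^ (Suc N - Suc j) - z * x ^ N * (?c N j * y ^ (N - j))" if "j \<le> N" for j
  proof -
    have "tri j + (N - j) = tri (j - 1) + N" using that tri_pred[of j] by simp
    then have e: "x ^ tri j * x ^ (N - j) = x ^ tri (j - 1) * x ^ N" by (simp only: power_add[symmetric])
    have "?c (Suc N) (Suc j) * y ^ (Suc N - Suc j) = ?c N (Suc j) * y ^ (Suc N - Suc j)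
       - (-1) ^ j * (x ^ tri j * x ^ (N - j)) * qbinom x N j * z * z ^ j * y ^ (N - j)"
      by (simp add: qbinom_Suc_Suc[OF x that] algebra_simps)
    then show ?thesis unfolding e by (simp add: mult_ac)
  qed
  have "(\<Prod>k<Suc N. y - z * x ^ k) = (y - z * x ^ N) * (\<Sum>j\<le>N. ?c N j * y ^ (N - j))"
    by (simp add: Suc mult.commute)
  also have "\<dots> = (\<Sum>j\<le>Suc N. ?c N j * y ^ (Suc N - j)) - z * x ^ N * (\<Sum>j\<le>N. ?c N j * y ^ (N - j))"
    by (simp only: left_diff_distrib 1)
  also have "\<dots> = ?c N 0 * y ^ Suc N + (\<Sum>j\<le>N. ?c N (Suc j) * y ^ (Suc N - Suc j)
      - z * x ^ N * (?c N j * y ^ (N - j)))"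
    by (simp only: sum.atMost_Suc_shift sum_distrib_left sum_subtractf) simp
  also have "\<dots> = ?c (Suc N) 0 * y ^ Suc N + (\<Sum>j\<le>N. ?c (Suc N) (Suc j) * y ^ (Suc N - Suc j))"
    using x by (intro arg_cong2[of _ _ _ _ "(+)"] sum.cong) (simp_all only: 2 atMost_iff qbinom_0)
  finally show ?case by (simp only: sum.atMost_Suc_shift) simp
qed

lemma sum_atMost_odd:
  fixes f :: "nat \<Rightarrow> int fps"
  shows "(\<Sum>j\<le>2*m+1. f j) = (\<Sum>i\<le>m. f (m - i) + f (m + 1 + i))"
proof -
  have "{..2*m+1} = {..m} \<union> {m+1..2*m+1}" by auto
  then have "(\<Sum>j\<le>2*m+1. f j) = (\<Sum>j\<le>m. f j) + (\<Sum>j=m+1..2*m+1. f j)"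
    by (simp only:) (subst sum.union_disjoint; auto)
  moreover have "(\<Sum>j\<le>m. f j) = (\<Sum>i\<le>m. f (m - i))"
    by (rule sum.reindex_bij_witness[of _ "\<lambda>i. m - i" "\<lambda>i. m - i"]) auto
  moreover have "(\<Sum>j=m+1..2*m+1. f j) = (\<Sum>i\<le>m. f (m + 1 + i))"
    by (rule sum.reindex_bij_witness[of _ "\<lambda>i. m + 1 + i" "\<lambda>j. j - (m + 1)"]) auto
  ultimately show ?thesis by (simp add: sum.distrib)
qed

lemma prod_power_lessThan: "(\<Prod>k<m. x ^ k) = x ^ tri (m - 1)" for x :: "int fps"
  by (induction m) (simp, simp only: prod.lessThan_Suc diff_Suc_1 tri_pred power_add[symmetric])

lemma two_tri_pred: "2 * tri (s - 1) + s = s * s"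
  using two_tri[of "s - 1"] by (cases s) auto

lemma prod_lessThan_add: "(\<Prod>k<a + b. f k) = (\<Prod>k<a. f k) * (\<Prod>k<b. f (a + k))"
  for f :: "nat \<Rightarrow> int fps"
  by (induction b) (simp_all add: mult.assoc)

text \<open>The q-binomial theorem with \<open>N = 2*m+1\<close> and \<open>y = x ^ m\<close>. The
  terms at \<open>m - i\<close> and \<open>m + 1 + i\<close> have the same Gaussian binomial
  coefficient and the same power of \<open>x\<close> but opposite signs, so they combine; the common
  power of \<open>x\<close> is cancelled at the end.\<close>

lemma finite_jacobi:
  assumes x: "q dvd x" "x \<noteq> 0"
  shows "(\<Prod>k<m. x ^ Suc k - z) * (\<Prod>k<Suc m. 1 - z * x ^ k) =
    (\<Sum>i\<le>m. (-1) ^ (m - i) * x ^ tri i * (qpoch x x (2*m+1) * rq x (m - i) * rq x (m + i + 1))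
      * (z ^ (m - i) - z ^ (m + 1 + i)))"
    (is "?L = ?R")
proof -
  \<comment> \<open>The power of \<open>x\<close> taken out of the product:
    \<open>tri (m - 1)\<close> from the factors \<open>x ^ k * (x ^ (m - k) - z)\<close> with
    \<open>k < m\<close>, and \<open>m\<close> from each of the other \<open>m + 1\<close>
    factors.\<close>
  let ?e = "tri (m - 1) + m * (m + 1)"
  let ?f = "\<lambda>j. (-1) ^ j * x ^ tri (j - 1) * qbinom x (2*m+1) j * z ^ j * (x ^ m) ^ (2*m+1 - j)"
  let ?t = "\<lambda>i. (-1) ^ (m - i) * x ^ tri i * (qpoch x x (2*m+1) * rq x (m - i) * rq x (m + i + 1))
      * (z ^ (m - i) - z ^ (m + 1 + i))"
  have 1: "(\<Prod>k<m. x ^ m - z * x ^ k) = x ^ tri (m - 1) * (\<Prod>k<m. x ^ Suc k - z)"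
  proof -
    have "(\<Prod>k<m. x ^ m - z * x ^ k) = (\<Prod>k<m. x ^ k * (x ^ Suc (m - Suc k) - z))"
      by (intro prod.cong) (auto simp: right_diff_distrib power_add[symmetric] mult.commute simp del: power_Suc)
    then show ?thesis
      by (simp add: prod.distrib prod_power_lessThan prod.nat_diff_reindex[of "\<lambda>k. x ^ Suc k - z"] del: power_Suc)
  qed
  have 2: "(\<Prod>k<Suc m. x ^ m - z * x ^ (m + k)) = x ^ (m * (m + 1)) * (\<Prod>k<Suc m. 1 - z * x ^ k)"
  proof -
    have "(\<Prod>k<Suc m. x ^ m - z * x ^ (m + k)) = (\<Prod>k<Suc m. x ^ m * (1 - z * x ^ k))"
      by (intro prod.cong) (auto simp: algebra_simps power_add)
    then show ?thesis by (simp only: prod.distrib) (simp add: power_mult power_add power_mult_distrib)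
  qed
  have "(\<Prod>k<2*m+1. x ^ m - z * x ^ k) = (\<Prod>k<m + Suc m. x ^ m - z * x ^ k)" by (simp only: mult_2) simp
  also have "\<dots> = x ^ ?e * ?L" unfolding prod_lessThan_add 1 2 by (simp only: power_add mult_ac)
  finally have "x ^ ?e * ?L = (\<Sum>i\<le>m. ?f (m - i) + ?f (m + 1 + i))"
    unfolding homogeneous_qbinomial[OF x(1)] sum_atMost_odd by simp
  also have "\<dots> = (\<Sum>i\<le>m. x ^ ?e * ?t i)"
  proof (intro sum.cong refl)
    fix i assume "i \<in> {..m}"
    then obtain s where m: "m = i + s" by (auto simp: le_iff_add)
    have e1: "tri (s - 1) + m * (2*m+1 - s) = ?e + tri i"
    proof -
      have "2*m+1 - s = 2*i+s+1" by (simp add: m)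
      then have "2 * (tri (s - 1) + m * (2*m+1 - s)) + s + m = 2 * (?e + tri i) + s + m"
        using two_tri_pred[of s] two_tri_pred[of m] two_tri[of i]
        by (simp add: m algebra_simps)
      then show ?thesis by simp
    qed
    have e2: "tri (m + i) + m * s = ?e + tri i"
    proof -
      have "2 * (tri (m + i) + m * s) + m = 2 * (?e + tri i) + m"
        using two_tri[of "m + i"] two_tri_pred[of m] two_tri[of i]
        by (simp add: m algebra_simps)
      then show ?thesis by simp
    qed
    have "?f (m - i) = (-1) ^ s * x ^ (tri (s - 1) + m * (2*m+1 - s)) * qbinom x (2*m+1) s * z ^ s"
      by (simp add: m power_add power_mult mult_ac)
    moreover have "qbinom x (2*m+1) s = qpoch x x (2*m+1) * rq x s * rq x (m + i + 1)"
    proof -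
      have "2*m+1 - s = m + i + 1" "s \<le> 2*m+1" by (simp_all add: m)
      then show ?thesis by (simp add: qbinom_def)
    qed
    moreover have "?f (m + 1 + i) = - ((-1) ^ s * x ^ (tri (m + i) + m * s) * qbinom x (2*m+1) (m + 1 + i) * z ^ (m + 1 + i))"
    proof -
      have "2*m+1 - (m + 1 + i) = s" "(-1) ^ (m + 1 + i) = (- ((-1) ^ s) :: int fps)"
        by (simp_all add: m minus_one_power_iff)
      then show ?thesis by (simp add: power_add power_mult mult_ac)
    qed
    moreover have "qbinom x (2*m+1) (m + 1 + i) = qpoch x x (2*m+1) * rq x s * rq x (m + i + 1)"
    proof -
      have "2*m+1 - (m + 1 + i) = s" "m + 1 + i \<le> 2*m+1" "m + 1 + i = m + i + 1" by (simp_all add: m)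
      then show ?thesis by (simp add: qbinom_def mult_ac)
    qed
    moreover have "m - i = s" by (simp add: m)
    ultimately show "?f (m - i) + ?f (m + 1 + i) = x ^ ?e * ?t i"
      unfolding e1 e2 by (simp only: power_add) (simp add: algebra_simps)
  qed
  also have "\<dots> = x ^ ?e * ?R" by (simp only: sum_distrib_left)
  finally show ?thesis using x(2) by simp
qed

text \<open>The limit $z \to 1$ after division by $1 - z$ is taken along $z = 1 + q^K$.\<close>

lemma finite_jacobi_cube:
  assumes x: "q dvd x" "x \<noteq> 0"
  shows "(\<Sum>i\<le>m. (-1) ^ i * of_nat (2*i+1) * x ^ tri i * (rq x (m - i) * rq x (m + i + 1))) =
    (qpoch x x m)^2 * rq x (2*m+1)"
proof -
  let ?c = "\<lambda>i. (-1) ^ (m - i) * x ^ tri i * (qpoch x x (2*m+1) * rq x (m - i) * rq x (m + i + 1))"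
  let ?L = "\<lambda>z. (\<Prod>k<m. x ^ Suc k - z) * (\<Prod>k<m. 1 - z * x ^ Suc k)"
  \<comment> \<open>The geometric sum of length \<open>2*i+1\<close> is what remains of
    \<open>z ^ (m - i) - z ^ (m + 1 + i)\<close> after division by \<open>1 - z\<close>; its value
    at \<open>z = 1\<close> is the weight \<open>2*i+1\<close>.\<close>
  let ?R = "\<lambda>z. (\<Sum>i\<le>m. ?c i * (z ^ (m - i) * (\<Sum>l<2*i+1. z ^ l)))"
  have LR: "?L z = ?R z" if "z \<noteq> 1" for z
  proof -
    have "(1 - z) * ?L z = (\<Prod>k<m. x ^ Suc k - z) * (\<Prod>k<Suc m. 1 - z * x ^ k)"
      by (simp only: prod.lessThan_Suc_shift) (simp add: mult_ac)
    also have "\<dots> = (\<Sum>i\<le>m. ?c i * (z ^ (m - i) - z ^ (m + 1 + i)))"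
      by (rule finite_jacobi[OF x])
    also have "\<dots> = (\<Sum>i\<le>m. (1 - z) * (?c i * (z ^ (m - i) * (\<Sum>l<2*i+1. z ^ l))))"
    proof (intro sum.cong refl)
      fix i assume "i \<in> {..m}"
      then have "m + 1 + i = (m - i) + (2*i+1)" by auto
      then have "z ^ (m - i) - z ^ (m + 1 + i) = z ^ (m - i) * (1 - z ^ (2*i+1))"
        by (simp only: power_add) (simp add: right_diff_distrib)
      also have "1 - z ^ (2*i+1) = (1 - z) * (\<Sum>l<2*i+1. z ^ l)" by (rule one_diff_power_eq)
      finally show "?c i * (z ^ (m - i) - z ^ (m + 1 + i)) =
          (1 - z) * (?c i * (z ^ (m - i) * (\<Sum>l<2*i+1. z ^ l)))" by (simp only: mult_ac)
    qed
    also have "\<dots> = (1 - z) * ?R z" by (simp only: sum_distrib_left)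
    finally show ?thesis using that by simp
  qed
  have "?L 1 = ?R 1"
  proof (rule X_adic_eqI)
    fix K
    define z where "z = 1 + q ^ K"
    have z: "q ^ K dvd z - 1" by (simp add: z_def)
    have prod: "q ^ K dvd (\<Prod>k<n. f k z) - (\<Prod>k<n. f k 1)"
      if "\<And>k. q ^ K dvd f k z - f k 1" for f :: "nat \<Rightarrow> int fps \<Rightarrow> int fps" and n
      using that by (induction n) (auto intro: dvd_diff_mult)
    have "q ^ K dvd ?L z - ?L 1"
    proof (intro dvd_diff_mult prod)
      fix k
      show "q ^ K dvd (x ^ Suc k - z) - (x ^ Suc k - 1)" using z by (simp add: dvd_diff_sym)
      show "q ^ K dvd (1 - z * x ^ Suc k) - (1 - 1 * x ^ Suc k)"
        using dvd_mult2[OF z, of "x ^ Suc k"] by (simp add: algebra_simps dvd_diff_sym)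
    qed
    moreover have "q ^ K dvd ?R z - ?R 1"
      by (intro dvd_diff_sum dvd_diff_mult dvd_diff_power z) simp_all
    moreover have "?L z = ?R z" by (rule LR) (simp add: z_def)
    ultimately show "q ^ K dvd ?L 1 - ?R 1"
      by (simp only:) (rule dvd_diff_trans, subst dvd_diff_sym, assumption+)
  qed
  moreover have "?L 1 = (-1) ^ m * (qpoch x x m)^2"
  proof -
    have "(\<Prod>k<m. x ^ Suc k - 1) = (\<Prod>k<m. (-1) * (1 - x * x ^ k))" by simp
    also have "\<dots> = (-1) ^ m * qpoch x x m" unfolding prod.distrib qpoch_def by simp
    finally show ?thesis by (simp add: qpoch_def power2_eq_square)
  qed
  moreover have "?R 1 = (\<Sum>i\<le>m. (-1) ^ m * qpoch x x (2*m+1) *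
    ((-1) ^ i * of_nat (2*i+1) * x ^ tri i * (rq x (m - i) * rq x (m + i + 1))))"
  proof (intro sum.cong refl)
    fix i assume "i \<in> {..m}"
    then have "(-1) ^ (m - i) = ((-1) ^ m * (-1) ^ i :: int fps)"
      by (simp add: minus_one_power_iff)
    then show "?c i * (1 ^ (m - i) * (\<Sum>l<2*i+1. 1 ^ l)) = (-1) ^ m * qpoch x x (2*m+1) *
      ((-1) ^ i * of_nat (2*i+1) * x ^ tri i * (rq x (m - i) * rq x (m + i + 1)))"
      by (simp add: mult_ac)
  qed
  ultimately have "(qpoch x x m)^2 = qpoch x x (2*m+1) *
    (\<Sum>i\<le>m. (-1) ^ i * of_nat (2*i+1) * x ^ tri i * (rq x (m - i) * rq x (m + i + 1)))"
    by (simp add: sum_distrib_left[symmetric] mult.assoc)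
  then show ?thesis using qpoch_rq[OF x(1), of "2*m+1"] by (simp add: mult_ac)
qed

text \<open>The companion with index \<open>2*m+2\<close>, needed for spt_F1. Multiplication by
  \<open>1 - x ^ (2*m+2)\<close> writes \<open>rq x (m - i) * rq x (m + i + 2)\<close> in two ways
  through \<open>V i\<close> and \<open>V (Suc i)\<close>. With one splitting for the
  \<open>tri (Suc i)\<close> part and the other for the \<open>tri i\<close> part, the sum becomes
  the odd identity plus a telescoping sum.\<close>

lemma finite_jacobi_cube_even:
  assumes x: "q dvd x" "x \<noteq> 0"
  shows "(\<Sum>i\<le>m. (-1) ^ i * (of_nat (tri (Suc i)) * x ^ tri i + of_nat (tri i) * x ^ tri (Suc i))
      * (rq x (m - i) * rq x (m + i + 2))) = (qpoch x x m)^2 * rq x (2*m+2)" (is "?S = _")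
proof -
  define V where "V = (\<lambda>i. if i \<le> m then rq x (m - i) * rq x (m + i + 1) else 0)"
  \<comment> \<open>\<open>g\<close> collects the excess over the odd identity. It vanishes at both
    ends: \<open>g 0 = 0\<close> because \<open>tri 0 = 0\<close>, and \<open>g (Suc m) = 0\<close>
    by the default value of \<open>V\<close>.\<close>
  define g where "g = (\<lambda>i. (of_nat (tri i) * x ^ (tri i + m + 1) + of_nat (tri (i - 1)) * x ^ tri i) * V i)"
  have V: "(1 - x ^ (2*m+2)) * (rq x (m - i) * rq x (m + i + 2)) = V i + x ^ (m + i + 2) * V (Suc i)"
      "(1 - x ^ (2*m+2)) * (rq x (m - i) * rq x (m + i + 2)) = V (Suc i) + x ^ (m - i) * V i" if i: "i \<le> m" for i
  proof -
    obtain s where m: "m = i + s" using i by (auto simp: le_iff_add)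
    have "(1 - x ^ (2*m+2)) * (rq x (m - i) * rq x (m + i + 2)) = V i + x ^ (m + i + 2) * V (Suc i) \<and>
      (1 - x ^ (2*m+2)) * (rq x (m - i) * rq x (m + i + 2)) = V (Suc i) + x ^ (m - i) * V i"
    proof (cases s)
      case 0
      then show ?thesis using rq_Suc[OF x(1), of "2*i+1"]
        by (simp add: V_def m mult_2[symmetric] algebra_simps)
    next
      case (Suc s')
      have e: "m - i = Suc s'" "m - Suc i = s'" "m + i + 2 = Suc (2*i+s'+2)" "m + i + 1 = 2*i+s'+2"
        "m + Suc i + 1 = Suc (2*i+s'+2)" "Suc i \<le> m" by (simp_all add: m Suc)
      have p: "x ^ (2*m+2) = x ^ 4 * (x ^ i)^2 * (x ^ s')^2" "x ^ Suc (2*i+s'+2) = x ^ 3 * (x ^ i)^2 * x ^ s'"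
        "x ^ Suc s' = x * x ^ s'"
        by (simp_all add: m Suc mult_2 power_add power2_eq_square eval_nat_numeral mult_ac)
      have r: "rq x s' = rq x (Suc s') * (1 - x * x ^ s')"
        "rq x (2*i+s'+2) = rq x (Suc (2*i+s'+2)) * (1 - x ^ 3 * (x ^ i)^2 * x ^ s')"
        using rq_Suc[OF x(1), of s'] rq_Suc[OF x(1), of "2*i+s'+2"] unfolding p by simp_all
      show ?thesis unfolding V_def e(5) using e(6) i
        by (simp only: if_True e p r) algebra
    qed
    then show "(1 - x ^ (2*m+2)) * (rq x (m - i) * rq x (m + i + 2)) = V i + x ^ (m + i + 2) * V (Suc i)"
      "(1 - x ^ (2*m+2)) * (rq x (m - i) * rq x (m + i + 2)) = V (Suc i) + x ^ (m - i) * V i" by auto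
  qed
  have tel: "(\<Sum>i\<le>n. (-1) ^ i * (g i + g (Suc i))) = g 0 + (-1) ^ n * g (Suc n)" for n
    by (induction n) (simp_all add: algebra_simps)
  have "(1 - x ^ (2*m+2)) * ?S = (\<Sum>i\<le>m. (-1) ^ i * of_nat (2*i+1) * x ^ tri i * (rq x (m - i) * rq x (m + i + 1))
     + (-1) ^ i * (g i + g (Suc i)))"
    unfolding sum_distrib_left
  proof (intro sum.cong refl)
    fix i assume "i \<in> {..m}" then have i: "i \<le> m" by simp
    have "(1 - x ^ (2*m+2)) * ((-1) ^ i * (of_nat (tri (Suc i)) * x ^ tri i + of_nat (tri i) * x ^ tri (Suc i))
      * (rq x (m - i) * rq x (m + i + 2))) =
      (-1) ^ i * (of_nat (tri (Suc i)) * x ^ tri i * ((1 - x ^ (2*m+2)) * (rq x (m - i) * rq x (m + i + 2)))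
       + of_nat (tri i) * x ^ tri (Suc i) * ((1 - x ^ (2*m+2)) * (rq x (m - i) * rq x (m + i + 2))))"
      by (simp only: mult_ac distrib_left distrib_right)
    also have "\<dots> = (-1) ^ i * (of_nat (tri (Suc i)) * x ^ tri i * (V i + x ^ (m + i + 2) * V (Suc i))
       + of_nat (tri i) * x ^ tri (Suc i) * (V (Suc i) + x ^ (m - i) * V i))"
      by (subst V(1)[OF i], subst V(2)[OF i]) (rule refl)
    also have "\<dots> = (-1) ^ i * ((of_nat (tri (Suc i)) * x ^ tri i + of_nat (tri i) * (x ^ tri (Suc i) * x ^ (m - i))) * V i
       + (of_nat (tri (Suc i)) * (x ^ tri i * x ^ (m + i + 2)) + of_nat (tri i) * x ^ tri (Suc i)) * V (Suc i))"
      by (simp add: algebra_simps)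
    also have "x ^ tri (Suc i) * x ^ (m - i) = x ^ (tri i + m + 1)"
      using i by (simp only: power_add[symmetric]) (simp add: tri_Suc)
    also have "x ^ tri i * x ^ (m + i + 2) = x ^ (tri (Suc i) + m + 1)"
      by (simp only: power_add[symmetric]) (simp add: tri_Suc add_ac)
    also have "of_nat (tri (Suc i)) * x ^ tri i + of_nat (tri i) * x ^ (tri i + m + 1) =
      of_nat (2*i+1) * x ^ tri i + (of_nat (tri i) * x ^ (tri i + m + 1) + of_nat (tri (i - 1)) * x ^ tri i)"
    proof -
      have "tri (Suc i) = tri (i - 1) + (2 * i + 1)" by (cases i) (auto simp: tri_Suc)
      then have "of_nat (tri (Suc i)) = (of_nat (tri (i - 1)) + of_nat (2 * i + 1) :: int fps)"
        by (simp only: of_nat_add)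
      then show ?thesis by (simp only: algebra_simps)
    qed
    also have "(-1) ^ i * ((of_nat (2*i+1) * x ^ tri i + (of_nat (tri i) * x ^ (tri i + m + 1) + of_nat (tri (i - 1)) * x ^ tri i)) * V i
       + (of_nat (tri (Suc i)) * x ^ (tri (Suc i) + m + 1) + of_nat (tri i) * x ^ tri (Suc i)) * V (Suc i)) =
      (-1) ^ i * of_nat (2*i+1) * x ^ tri i * V i + (-1) ^ i * (g i + g (Suc i))"
      unfolding g_def diff_Suc_1 by (simp only: algebra_simps)
    also have "V i = rq x (m - i) * rq x (m + i + 1)" using i by (simp add: V_def)
    finally show "(1 - x ^ (2*m+2)) * ((-1) ^ i * (of_nat (tri (Suc i)) * x ^ tri i + of_nat (tri i) * x ^ tri (Suc i))
      * (rq x (m - i) * rq x (m + i + 2))) =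
      (-1) ^ i * of_nat (2*i+1) * x ^ tri i * (rq x (m - i) * rq x (m + i + 1)) + (-1) ^ i * (g i + g (Suc i))"
      .
  qed
  also have "\<dots> = (qpoch x x m)^2 * rq x (2*m+1)"
    unfolding sum.distrib finite_jacobi_cube[OF x] tel by (simp add: g_def V_def)
  also have "\<dots> = (1 - x ^ (2*m+2)) * ((qpoch x x m)^2 * rq x (2*m+2))"
    using rq_Suc[OF x(1), of "2*m+1"] by (simp add: mult_ac)
  finally have "(1 - x ^ (2*m+2)) * ?S = (1 - x ^ (2*m+2)) * ((qpoch x x m)^2 * rq x (2*m+2))" .
  moreover have "fps_nth (1 - x ^ (2*m+2)) 0 = 1" using x by (simp add: X_dvd_iff)
  then have "1 - x ^ (2*m+2) \<noteq> 0" by (metis fps_zero_nth zero_neq_one)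
  ultimately show ?thesis by (simp only: mult_cancel_left) blast
qed

text \<open>Lets \<open>m\<close> tend to infinity in a finite triple product identity: both
  \<open>rq\<close> factors tend to the inverse of \<open>euler x\<close>, which accounts for the
  square.\<close>

lemma rq_kernel_limit:
  assumes x: "q dvd x" and c: "\<And>i. q ^ i dvd c i"
    and P: "\<And>m. P m = (\<Sum>i\<le>m. c i * (rq x (m - i) * rq x (m + i + 1)))"
    and lim: "\<And>N m. N \<le> m \<Longrightarrow> q ^ N dvd L - P m"
  shows "fsum c = L * (euler x)^2"
proof -
  let ?I = "iv (euler x)"
  have "L = ?I^2 * fsum c"
  proof (rule X_adic_eqI)
    fix N :: nat
    \<comment> \<open>With \<open>m = 2*N\<close>, an index \<open>i < N\<close> leaves
      \<open>2*N - i\<close> above \<open>N\<close>, where \<open>rq\<close> agrees with its limit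
      modulo \<open>q ^ N\<close>; the indices from \<open>N\<close> on vanish modulo
      \<open>q ^ N\<close> through \<open>c i\<close>.\<close>
    have "{..2*N} = {..<N} \<union> {N..2*N}" by auto
    then have "P (2*N) = (\<Sum>i<N. c i * (rq x (2*N - i) * rq x (2*N + i + 1)))
       + (\<Sum>i=N..2*N. c i * (rq x (2*N - i) * rq x (2*N + i + 1)))"
      unfolding P by (simp only:) (subst sum.union_disjoint; auto)
    moreover have "q ^ N dvd (\<Sum>i=N..2*N. c i * (rq x (2*N - i) * rq x (2*N + i + 1)))"
    proof (intro dvd_sum dvd_mult2)
      fix i assume "i \<in> {N..2*N}"
      then show "q ^ N dvd c i" using c[of i] by (meson atLeastAtMost_iff dvd_trans le_imp_power_dvd)
    qed
    ultimately have 1: "q ^ N dvd P (2*N) - (\<Sum>i<N. c i * (rq x (2*N - i) * rq x (2*N + i + 1)))" by simp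
    have 2: "q ^ N dvd (\<Sum>i<N. c i * (?I * ?I)) - (\<Sum>i<N. c i * (rq x (2*N - i) * rq x (2*N + i + 1)))"
      by (intro dvd_diff_sum dvd_diff_mult rq_approx[OF x]) auto
    have 3: "q ^ N dvd ?I^2 * fsum c - ?I^2 * (\<Sum>i<N. c i)"
      unfolding right_diff_distrib[symmetric] by (intro dvd_mult fsum_approx[OF c] order_refl)
    have 4: "q ^ N dvd L - P (2*N)" by (rule lim) simp
    have "(\<Sum>i<N. c i * (?I * ?I)) = ?I^2 * (\<Sum>i<N. c i)"
      unfolding sum_distrib_right[symmetric] by (simp add: power2_eq_square mult_ac)
    with 2 have "q ^ N dvd ?I^2 * fsum c - (\<Sum>i<N. c i * (rq x (2*N - i) * rq x (2*N + i + 1)))"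
      using dvd_diff_trans[OF 3] by simp
    then show "q ^ N dvd L - ?I^2 * fsum c"
      using dvd_diff_trans[OF 4 dvd_diff_trans[OF 1]] dvd_diff_sym by blast
  qed
  then have "L * (euler x)^2 = fsum c * (euler x * ?I)^2" by (simp add: power_mult_distrib mult_ac)
  then show ?thesis using iv_mult_self[OF qpoch_inf_nth_0[OF x x]] by simp
qed

lemma dvd_power_tri: "q dvd x \<Longrightarrow> q ^ i dvd x ^ tri i"
  by (rule dvd_power_mono[OF _ le_tri])

lemma jacobi_cube:
  assumes x: "q dvd x" "x \<noteq> 0"
  shows "fsum (\<lambda>i. (-1) ^ i * of_nat (2*i+1) * x ^ tri i) = euler x ^ 3"
proof -
  let ?E = "euler x"
  have "fsum (\<lambda>i. (-1) ^ i * of_nat (2*i+1) * x ^ tri i) = (?E^2 * iv ?E) * ?E^2"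
  proof (rule rq_kernel_limit[OF x(1) _ finite_jacobi_cube[OF x, symmetric]])
    fix N m :: nat assume "N \<le> m"
    then show "q ^ N dvd ?E^2 * iv ?E - (qpoch x x m)^2 * rq x (2*m+1)" using x
      by (intro dvd_diff_mult dvd_diff_power qpoch_inf_approx rq_approx) auto
  qed (intro dvd_mult dvd_power_tri x)
  also have "\<dots> = ?E ^ 3 * (?E * iv ?E)" by (simp add: power_numeral_reduce mult_ac)
  finally show ?thesis using iv_mult_self[OF qpoch_inf_nth_0[OF x(1) x(1)]] by simp
qed

text \<open>\<open>finite_jacobi\<close> at \<open>z = -1\<close>: all signs cancel and each pair of
  terms doubles, which balances the factor 2 at \<open>k = 0\<close> of the second product. Then
  \<open>m\<close> tends to infinity.\<close>

lemma gauss_psi: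
  assumes x: "q dvd x" "x \<noteq> 0"
  shows "fsum (\<lambda>i. x ^ tri i) = (qpoch_inf (- x) x)^2 * euler x"
proof -
  let ?E = "euler x" and ?M = "qpoch_inf (- x) x"
  have fin: "(qpoch (- x) x m)^2 * rq x (2*m+1) = (\<Sum>i\<le>m. x ^ tri i * (rq x (m - i) * rq x (m + i + 1)))" for m
  proof -
    have "(\<Prod>k<m. x ^ Suc k - (-1)) * (\<Prod>k<Suc m. 1 - (-1) * x ^ k) =
      (\<Sum>i\<le>m. 2 * qpoch x x (2*m+1) * (x ^ tri i * (rq x (m - i) * rq x (m + i + 1))))"
      unfolding finite_jacobi[OF x]
    proof (intro sum.cong refl)
      fix i assume "i \<in> {..m}"
      then have "(-1) ^ (m + 1 + i) = (- ((-1) ^ (m - i)) :: int fps)"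
        by (auto simp: minus_one_power_iff)
      then show "(-1) ^ (m - i) * x ^ tri i * (qpoch x x (2*m+1) * rq x (m - i) * rq x (m + i + 1)) *
        ((-1) ^ (m - i) - (-1) ^ (m + 1 + i)) = 2 * qpoch x x (2*m+1) * (x ^ tri i * (rq x (m - i) * rq x (m + i + 1)))"
        by (simp only:) (simp add: minus_one_power_iff)
    qed
    moreover have "(\<Prod>k<m. x ^ Suc k - (-1)) = qpoch (- x) x m" by (simp add: qpoch_def add.commute)
    moreover have "(\<Prod>k<Suc m. 1 - (-1) * x ^ k) = 2 * qpoch (- x) x m"
      by (simp only: prod.lessThan_Suc_shift) (simp add: qpoch_def)
    ultimately have "qpoch (- x) x m * (2 * qpoch (- x) x m) = 2 * qpoch x x (2*m+1) *
      (\<Sum>i\<le>m. x ^ tri i * (rq x (m - i) * rq x (m + i + 1)))"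
      by (simp only: sum_distrib_left[symmetric])
    then have "2 * (qpoch (- x) x m)^2 = 2 * (qpoch x x (2*m+1) *
      (\<Sum>i\<le>m. x ^ tri i * (rq x (m - i) * rq x (m + i + 1))))"
      by (simp only: power2_eq_square mult.assoc mult.left_commute[of _ 2])
    then have "(qpoch (- x) x m)^2 = qpoch x x (2*m+1) *
      (\<Sum>i\<le>m. x ^ tri i * (rq x (m - i) * rq x (m + i + 1)))" by simp
    then show ?thesis using qpoch_rq[OF x(1), of "2*m+1"] by (simp add: mult_ac)
  qed
  have "fsum (\<lambda>i. x ^ tri i) = (?M^2 * iv ?E) * ?E^2"
  proof (rule rq_kernel_limit[OF x(1) _ fin])
    fix N m :: nat assume "N \<le> m"
    then show "q ^ N dvd ?M^2 * iv ?E - (qpoch (- x) x m)^2 * rq x (2*m+1)" using x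
      by (intro dvd_diff_mult dvd_diff_power qpoch_inf_approx rq_approx) auto
  qed (intro dvd_power_tri x)
  also have "\<dots> = ?M^2 * ?E * (?E * iv ?E)" by (simp add: power2_eq_square mult_ac)
  finally show ?thesis using iv_mult_self[OF qpoch_inf_nth_0[OF x(1) x(1)]] by simp
qed

text \<open>\<open>finite_jacobi\<close> in base \<open>q^2\<close> at \<open>z = -q\<close>. The
  summand \<open>i\<close> holds the squares of \<open>i\<close> and of \<open>-(i+1)\<close>, so
  the series is the theta series over all integers.\<close>

lemma gauss_phi:
  "fsum (\<lambda>i. q ^ (i * i) + q ^ (Suc i * Suc i)) = (qpoch_inf (- q) (q^2))^2 * euler (q^2)"
proof -
  let ?x = "q^2"
  let ?E = "euler ?x" and ?M = "qpoch_inf (- q) ?x"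
  have x: "q dvd ?x" "?x \<noteq> 0" by (simp_all add: power2_eq_square)
  have gen: "\<sigma> * X * (Q * R * S) * (\<sigma> * a - - (\<sigma> * b)) = M * Q * ((A + B) * (R * S))"
    if "X * a = M * A" "X * b = M * B" "\<sigma> * \<sigma> = 1" for \<sigma> X Q R S a b M A B :: "int fps"
    using that by algebra
  have fin: "qpoch (- q) ?x m * qpoch (- q) ?x (Suc m) * rq ?x (2*m+1) =
    (\<Sum>i\<le>m. (q ^ (i * i) + q ^ (Suc i * Suc i)) * (rq ?x (m - i) * rq ?x (m + i + 1)))" for m
  proof -
    have "(\<Prod>k<m. ?x ^ Suc k - (-q)) * (\<Prod>k<Suc m. 1 - (-q) * ?x ^ k) =
      (\<Sum>i\<le>m. q ^ m * qpoch ?x ?x (2*m+1) * ((q ^ (i * i) + q ^ (Suc i * Suc i)) * (rq ?x (m - i) * rq ?x (m + i + 1))))"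
      unfolding finite_jacobi[OF x]
    proof (intro sum.cong refl)
      fix i assume "i \<in> {..m}"
      then obtain s where m: "m = i + s" by (auto simp: le_iff_add)
      have 1: "(-q) ^ (m - i) = (-1) ^ (m - i) * q ^ s" by (simp add: m power_minus[of q])
      have 2: "(-q) ^ (m + 1 + i) = - ((-1) ^ (m - i) * q ^ (m + 1 + i))"
        unfolding power_minus[of q "m + 1 + i"] by (simp add: m minus_one_power_iff)
      have 3: "?x ^ tri i = q ^ (i * (i + 1))" by (simp only: power_mult[symmetric] two_tri)
      have 4: "q ^ (i * (i + 1)) * q ^ s = q ^ m * q ^ (i * i)"
        by (simp only: power_add[symmetric]) (simp add: m algebra_simps)
      have 5: "q ^ (i * (i + 1)) * q ^ (m + 1 + i) = q ^ m * q ^ (Suc i * Suc i)"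
        by (simp only: power_add[symmetric]) (simp add: m algebra_simps)
      have 6: "(-1) ^ (m - i) * (-1) ^ (m - i) = (1 :: int fps)" by (simp add: minus_one_power_iff)
      show "(-1) ^ (m - i) * ?x ^ tri i * (qpoch ?x ?x (2*m+1) * rq ?x (m - i) * rq ?x (m + i + 1)) *
        ((-q) ^ (m - i) - (-q) ^ (m + 1 + i)) =
        q ^ m * qpoch ?x ?x (2*m+1) * ((q ^ (i * i) + q ^ (Suc i * Suc i)) * (rq ?x (m - i) * rq ?x (m + i + 1)))"
        unfolding 1 2 3 by (rule gen[OF 4 5 6])
    qed
    moreover have "(\<Prod>k<m. ?x ^ Suc k - (-q)) = q ^ m * qpoch (- q) ?x m"
    proof -
      have "(\<Prod>k<m. ?x ^ Suc k - (-q)) = (\<Prod>k<m. q * (1 - (-q) * ?x ^ k))"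
      proof (intro prod.cong refl)
        have "a * a * Y - (-a) = a * (1 - (-a) * Y)" for a Y :: "int fps" by (simp add: algebra_simps)
        then show "?x ^ Suc k - (-q) = q * (1 - (-q) * ?x ^ k)" for k
          by (simp only: power_Suc power2_eq_square)
      qed
      then show ?thesis by (simp add: prod.distrib qpoch_def)
    qed
    moreover have "(\<Prod>k<Suc m. 1 - (-q) * ?x ^ k) = qpoch (- q) ?x (Suc m)"
      by (simp only: qpoch_def)
    ultimately have "q ^ m * (qpoch (- q) ?x m * qpoch (- q) ?x (Suc m)) = q ^ m * (qpoch ?x ?x (2*m+1) *
      (\<Sum>i\<le>m. (q ^ (i * i) + q ^ (Suc i * Suc i)) * (rq ?x (m - i) * rq ?x (m + i + 1))))"
      by (simp only: sum_distrib_left[symmetric] mult.assoc)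
    then have "qpoch (- q) ?x m * qpoch (- q) ?x (Suc m) = qpoch ?x ?x (2*m+1) *
      (\<Sum>i\<le>m. (q ^ (i * i) + q ^ (Suc i * Suc i)) * (rq ?x (m - i) * rq ?x (m + i + 1)))"
      by (simp only: mult_cancel_left power_not_zero fps_X_neq_zero simp_thms)
    then show ?thesis using qpoch_rq[OF x(1), of "2*m+1"] by (simp add: mult_ac)
  qed
  have "fsum (\<lambda>i. q ^ (i * i) + q ^ (Suc i * Suc i)) = (?M * ?M * iv ?E) * ?E^2"
  proof (rule rq_kernel_limit[OF x(1) _ fin])
    fix N m :: nat assume "N \<le> m"
    then show "q ^ N dvd ?M * ?M * iv ?E - qpoch (- q) ?x m * qpoch (- q) ?x (Suc m) * rq ?x (2*m+1)" using x
      by (intro dvd_diff_mult qpoch_inf_approx rq_approx) auto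
  next
    fix i :: nat
    show "q ^ i dvd q ^ (i * i) + q ^ (Suc i * Suc i)" by (intro dvd_add le_imp_power_dvd) auto
  qed
  also have "\<dots> = ?M^2 * ?E * (?E * iv ?E)" by (simp add: power2_eq_square mult_ac)
  finally show ?thesis using iv_mult_self[OF qpoch_inf_nth_0[OF x(1) x(1)]] by simp
qed

section \<open>Bailey transform\<close>

lemma fsum_approx_mult:
  assumes "\<And>k. q ^ k dvd t k" "N \<le> M" shows "q ^ N dvd c * fsum t - c * (\<Sum>k<M. t k)"
  unfolding right_diff_distrib[symmetric] by (intro dvd_mult fsum_approx assms)

lemma dvd_add_mult: "\<lbrakk>\<And>k. q ^ k dvd D k\<rbrakk> \<Longrightarrow> q ^ k dvd D (i + k) * f" for D :: "nat \<Rightarrow> int fps"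
  by (meson dvd_mult2 dvd_trans le_add2 le_imp_power_dvd)

definition bailey_coeff :: "int fps \<Rightarrow> (nat \<Rightarrow> int fps) \<Rightarrow> nat \<Rightarrow> int fps" where
  "bailey_coeff x D i = x ^ tri i * fsum (\<lambda>s. D (i + s) * (rq x s * rq x (2*i+s+1)))"

lemma dvd_bailey_coeff: "q dvd x \<Longrightarrow> q ^ i dvd bailey_coeff x D i"
  unfolding bailey_coeff_def by (intro dvd_mult2 dvd_power_tri)

text \<open>Bailey's transform: \<open>a\<close> and the right-hand sides form a Bailey pair, and
  the inner sum over \<open>s\<close> is the conjugate sequence of \<open>D\<close>. The parameter
  \<open>c\<close> covers both parities, \<open>c = 1\<close> for \<open>(x;x)_(2m+1)\<close> and
  \<open>c = 2\<close> for \<open>(x;x)_(2m+2)\<close>.\<close>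

lemma bailey_sum:
  assumes D: "\<And>m. q ^ m dvd D m" and \<beta>: "\<And>m. (\<Sum>i\<le>m. a i * (rq x (m - i) * rq x (m + i + c))) = \<beta> m"
  shows "fsum (\<lambda>m. D m * \<beta> m) = fsum (\<lambda>i. a i * fsum (\<lambda>s. D (i + s) * (rq x s * rq x (2*i+s+c))))"
proof -
  have "fsum (\<lambda>m. D m * \<beta> m) = fsum (\<lambda>m. \<Sum>i\<le>m. D m * (a i * (rq x (m - i) * rq x (m + i + c))))"
    by (simp only: \<beta>[symmetric] sum_distrib_left)
  also have "\<dots> = fsum (\<lambda>i. fsum (\<lambda>s. D (i + s) * (a i * (rq x (i + s - i) * rq x (i + s + i + c)))))"
    by (intro fsum_exchange dvd_mult2 D)
  also have "\<dots> = fsum (\<lambda>i. fsum (\<lambda>s. a i * (D (i + s) * (rq x s * rq x (2*i+s+c)))))"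
  proof (intro fsum_cong)
    fix i s
    have "i + s - i = s" "i + s + i + c = 2*i+s+c" by simp_all
    then show "D (i + s) * (a i * (rq x (i + s - i) * rq x (i + s + i + c))) =
      a i * (D (i + s) * (rq x s * rq x (2*i+s+c)))" by (simp only: mult_ac)
  qed
  also have "\<dots> = fsum (\<lambda>i. a i * fsum (\<lambda>s. D (i + s) * (rq x s * rq x (2*i+s+c))))"
    by (intro fsum_cong fsum_mult_left dvd_add_mult D)
  finally show ?thesis .
qed

lemma bailey_sum_odd:
  assumes x: "q dvd x" "x \<noteq> 0" and D: "\<And>m. q ^ m dvd D m"
  shows "fsum (\<lambda>m. D m * ((qpoch x x m)^2 * rq x (2*m+1))) =
    fsum (\<lambda>i. (-1) ^ i * of_nat (2*i+1) * bailey_coeff x D i)"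
  unfolding bailey_sum[OF D finite_jacobi_cube[OF x]] bailey_coeff_def by (simp only: mult.assoc)

lemma bailey_sum_even:
  assumes x: "q dvd x" "x \<noteq> 0" and D: "\<And>m. q ^ m dvd D m"
  shows "fsum (\<lambda>m. D m * ((qpoch x x m)^2 * rq x (2*m+2))) =
    fsum (\<lambda>i. (-1) ^ i * (of_nat (tri (Suc i)) * x ^ tri i + of_nat (tri i) * x ^ tri (Suc i)) *
      fsum (\<lambda>s. D (i + s) * (rq x s * rq x (2*i+s+2))))"
  by (rule bailey_sum[OF D finite_jacobi_cube_even[OF x]])

text \<open>At \<open>m = i + s\<close> both kernels are multiples of
  \<open>rq x s * rq x (2*i+s+2)\<close>, and the difference of the multipliers is \<open>(1 -
  x^(2i+s+2)) - x^(i+1) * (1 - x^s) = (1 - x^(i+1)) * (1 + x^(m+1))\<close>. The last factor cancels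
  the denominator that \<open>D\<close> has in spt_L7, spt_G1 and spt_G3.\<close>

lemma bailey_coeff_diff1:
  assumes x: "q dvd x" and D: "\<And>m. q ^ m dvd D m"
    and F: "\<And>m. D m * (1 + x ^ (m+1)) = F m"
  shows "bailey_coeff x D i - bailey_coeff x D (Suc i) =
    x ^ tri i * (1 - x ^ (i+1)) * fsum (\<lambda>s. F (i + s) * (rq x s * rq x (2*i+s+2)))"
proof -
  let ?A = "\<lambda>s. D (i + s) * (rq x s * rq x (2*i+s+1))"
  let ?B = "\<lambda>s. D (Suc i + s) * (rq x s * rq x (2*(Suc i)+s+1))"
  let ?C = "\<lambda>s. F (i + s) * (rq x s * rq x (2*i+s+2))"
  have Fd: "q ^ m dvd F m" for m using D[of m] by (metis F dvd_mult2)
  have step: "?A (Suc s) + (- (x ^ (i+1))) * ?B s = (1 - x ^ (i+1)) * ?C (Suc s)" for s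
  proof -
    have e: "Suc i + s = i + Suc s" "2*(Suc i)+s+1 = Suc (2*i+s+2)" "2*i+Suc s+1 = 2*i+s+2" "2*i+Suc s+2 = Suc (2*i+s+2)" by simp_all
    \<comment> \<open>With all powers expressed by \<open>x\<close>, \<open>x ^ i\<close>,
      \<open>x ^ s\<close> and every \<open>rq\<close> reduced to the largest index, the claim is a
      polynomial identity. The later telescoping proofs follow the same pattern.\<close>
    have p: "x ^ Suc (2*i+s+2) = x ^ 3 * (x ^ i)^2 * x ^ s" "x ^ Suc s = x * x ^ s"
      "x ^ (i + Suc s + 1) = x^2 * x ^ i * x ^ s" "x ^ (i+1) = x * x ^ i"
      by (simp_all add: mult_2 power_add power2_eq_square eval_nat_numeral mult_ac)
    have r: "rq x s = rq x (Suc s) * (1 - x * x ^ s)"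
      "rq x (2*i+s+2) = rq x (Suc (2*i+s+2)) * (1 - x ^ 3 * (x ^ i)^2 * x ^ s)"
      using rq_Suc[OF x, of s] rq_Suc[OF x, of "2*i+s+2"] unfolding p by simp_all
    show ?thesis unfolding e F[symmetric] r p by algebra
  qed
  have base: "?A 0 = (1 - x ^ (i+1)) * ?C 0"
  proof -
    have "rq x (2*i+1) = rq x (2*i+2) * (1 - (x ^ (i+1))^2)"
    proof -
      have "Suc (2*i+1) = 2*i+2" "x ^ (2*i+2) = (x ^ (i+1))^2"
        by (simp, simp only: power_mult[symmetric] mult.commute distrib_left distrib_right mult_1_right mult_1_left mult_2 add_ac one_add_one[symmetric])
      then show ?thesis using rq_Suc[OF x, of "2*i+1"] by (simp only:)
    qed
    moreover have "d * (r * (1 - y^2)) = (1 - y) * (d * (1 + y) * r)" for d r y :: "int fps" by algebra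
    ultimately show ?thesis unfolding F[symmetric] by (simp only: add_0_right rq_0 mult_1_left) (simp only: mult_ac)
  qed
  have "(\<Sum>s<Suc N. ?A s) + (- (x ^ (i+1))) * (\<Sum>s<N. ?B s) = (1 - x ^ (i+1)) * (\<Sum>s<Suc N. ?C s)" for N
  proof (induction N)
    case 0
    then show ?case using base by simp
  next
    case (Suc N)
    have "(\<Sum>s<Suc (Suc N). ?A s) + (- (x ^ (i+1))) * (\<Sum>s<Suc N. ?B s) =
       ((\<Sum>s<Suc N. ?A s) + (- (x ^ (i+1))) * (\<Sum>s<N. ?B s)) + (?A (Suc N) + (- (x ^ (i+1))) * ?B N)"
      unfolding sum.lessThan_Suc[of _ "Suc N"] sum.lessThan_Suc[of ?B N] by (simp only: distrib_left add_ac)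
    also have "\<dots> = (1 - x ^ (i+1)) * (\<Sum>s<Suc (Suc N). ?C s)"
      unfolding Suc step sum.lessThan_Suc[of _ "Suc N"] by (simp only: distrib_left)
    finally show ?case .
  qed
  note sums = this
  have eq: "fsum ?A + (- (x ^ (i+1))) * fsum ?B = (1 - x ^ (i+1)) * fsum ?C"
  proof (rule fsum_combine)
    show "q ^ N dvd (1 - x ^ (i+1)) * fsum ?C - ((\<Sum>s<Suc N. ?A s) + (- (x ^ (i+1))) * (\<Sum>s<N. ?B s))" for N
      unfolding sums by (intro fsum_approx_mult dvd_add_mult Fd) simp
  qed (rule dvd_add_mult[OF D])+
  have tS: "x ^ tri (Suc i) = x ^ tri i * x ^ (i+1)" by (simp add: tri_Suc power_add)
  have gen: "T * a - (T * k) * b = T * (1 - k) * c" if "a + (- k) * b = (1 - k) * c" for T k a b c :: "int fps"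
    using that by algebra
  show ?thesis unfolding bailey_coeff_def tS by (rule gen[OF eq])
qed

text \<open>Two steps at once give \<open>(1 - x^(2i+s+2)) * (1 - x^(2i+s+3)) - x^(2i+3) * (1 - x^s)
  * (1 - x^(s-1)) = (1 - x^(2i+3)) * (1 - x^(2m+2))\<close> with \<open>m = i + s\<close>, which
  cancels the denominator of spt_G2.\<close>

lemma bailey_coeff_diff2:
  assumes x: "q dvd x" and D: "\<And>m. q ^ m dvd D m"
    and F: "\<And>m. D m * (1 - x ^ (2*m+2)) = F m"
  shows "bailey_coeff x D i - bailey_coeff x D (Suc (Suc i)) =
    x ^ tri i * (1 - x ^ (2*i+3)) * fsum (\<lambda>s. F (i + s) * (rq x s * rq x (2*i+s+3)))"
proof -
  let ?A = "\<lambda>s. D (i + s) * (rq x s * rq x (2*i+s+1))"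
  let ?B = "\<lambda>s. D (Suc (Suc i) + s) * (rq x s * rq x (2*(Suc (Suc i))+s+1))"
  let ?C = "\<lambda>s. F (i + s) * (rq x s * rq x (2*i+s+3))"
  let ?k = "x ^ (2*i+3)"
  have Fd: "q ^ m dvd F m" for m using D[of m] by (metis F dvd_mult2)
  have step: "?A (Suc (Suc s)) + (- ?k) * ?B s = (1 - ?k) * ?C (Suc (Suc s))" for s
  proof -
    have e: "Suc (Suc i) + s = i + Suc (Suc s)" "2*(Suc (Suc i))+s+1 = Suc (Suc (2*i+s+3))"
      "2*i+Suc (Suc s)+1 = 2*i+s+3" "2*i+Suc (Suc s)+3 = Suc (Suc (2*i+s+3))" by simp_all
    have p: "x ^ Suc (2*i+s+3) = x ^ 4 * (x ^ i)^2 * x ^ s" "x ^ Suc (Suc (2*i+s+3)) = x ^ 5 * (x ^ i)^2 * x ^ s"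
      "x ^ Suc s = x * x ^ s" "x ^ Suc (Suc s) = x^2 * x ^ s"
      "x ^ (2*(i + Suc (Suc s)) + 2) = x ^ 6 * (x ^ i)^2 * (x ^ s)^2" "?k = x ^ 3 * (x ^ i)^2"
      by (simp_all add: mult_2 power_add power2_eq_square eval_nat_numeral mult_ac)
    have r: "rq x s = rq x (Suc (Suc s)) * (1 - x^2 * x ^ s) * (1 - x * x ^ s)"
      "rq x (2*i+s+3) = rq x (Suc (Suc (2*i+s+3))) * (1 - x ^ 5 * (x ^ i)^2 * x ^ s) * (1 - x ^ 4 * (x ^ i)^2 * x ^ s)"
      using rq_Suc[OF x, of s] rq_Suc[OF x, of "2*i+s+3"] rq_Suc[OF x, of "Suc s"] rq_Suc[OF x, of "Suc (2*i+s+3)"]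
      unfolding p by simp_all
    show ?thesis unfolding e F[symmetric] r p by algebra
  qed
  have base: "(\<Sum>s<Suc (Suc 0). ?A s) = (1 - ?k) * (\<Sum>s<Suc (Suc 0). ?C s)"
  proof -
    have p: "x ^ (2*i+2) = x^2 * (x ^ i)^2" "?k = x ^ 3 * (x ^ i)^2" "x ^ (2*i+4) = x ^ 4 * (x ^ i)^2"
      by (simp_all add: mult_2 power_add power2_eq_square eval_nat_numeral mult_ac)
    have r: "rq x (2*i+1) = rq x (2*i+3) * (1 - ?k) * (1 - x ^ (2*i+2))" 
      "rq x (2*i+2) = rq x (2*i+4) * (1 - x ^ (2*i+4)) * (1 - ?k)"
      using rq_Suc[OF x, of "2*i+1"] rq_Suc[OF x, of "2*i+2"] rq_Suc[OF x, of "2*i+3"]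
      by (simp_all add: numeral_3_eq_3 eval_nat_numeral)
    have "?A 0 = (1 - ?k) * ?C 0" unfolding F[symmetric]
      by (simp only: add_0_right rq_0 mult_1_left r) (simp only: mult_ac)
    moreover have "?A 1 = (1 - ?k) * ?C 1"
    proof -
      have e: "2*i+1+1 = 2*i+2" "2*i+1+3 = 2*i+4" "2*(i+1)+2 = 2*i+4" by simp_all
      show ?thesis unfolding F[symmetric] e r by (simp only: mult_ac)
    qed
    ultimately show ?thesis by (simp add: distrib_left)
  qed
  have "(\<Sum>s<Suc (Suc N). ?A s) + (- ?k) * (\<Sum>s<N. ?B s) = (1 - ?k) * (\<Sum>s<Suc (Suc N). ?C s)" for N
  proof (induction N)
    case 0
    then show ?case using base by simp
  next
    case (Suc N)
    have "(\<Sum>s<Suc (Suc (Suc N)). ?A s) + (- ?k) * (\<Sum>s<Suc N. ?B s) =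
       ((\<Sum>s<Suc (Suc N). ?A s) + (- ?k) * (\<Sum>s<N. ?B s)) + (?A (Suc (Suc N)) + (- ?k) * ?B N)"
      unfolding sum.lessThan_Suc[of _ "Suc (Suc N)"] sum.lessThan_Suc[of ?B N] by (simp only: distrib_left add_ac)
    also have "\<dots> = (1 - ?k) * (\<Sum>s<Suc (Suc (Suc N)). ?C s)"
      unfolding Suc step sum.lessThan_Suc[of _ "Suc (Suc N)"] by (simp only: distrib_left)
    finally show ?case .
  qed
  note sums = this
  \<comment> \<open>The summand with coefficient 0 only fits the relation between \<open>i\<close>
    and \<open>i + 2\<close> into the three-term form.\<close>
  have "1 * fsum ?A + 0 * fsum ?A + (- ?k) * fsum ?B = (1 - ?k) * fsum ?C"
  proof (rule fsum_combine3)
    show "q ^ N dvd (1 - ?k) * fsum ?C - (1 * (\<Sum>s<Suc (Suc N). ?A s) + 0 * (\<Sum>s<Suc N. ?A s) + (- ?k) * (\<Sum>s<N. ?B s))" for N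
      unfolding mult_1_left mult_zero_left add_0_right sums by (intro fsum_approx_mult dvd_add_mult Fd) simp
  qed (rule dvd_add_mult[OF D])+
  then have eq: "fsum ?A + (- ?k) * fsum ?B = (1 - ?k) * fsum ?C" by simp
  have tS: "x ^ tri (Suc (Suc i)) = x ^ tri i * ?k"
  proof -
    have "tri (Suc (Suc i)) = tri i + (2*i+3)" by (simp add: tri_Suc)
    then show ?thesis by (simp only: power_add)
  qed
  have gen: "T * a - (T * k) * b = T * (1 - k) * c" if "a + (- k) * b = (1 - k) * c" for T k a b c :: "int fps"
    using that by algebra
  show ?thesis unfolding bailey_coeff_def tS by (rule gen[OF eq])
qed

section \<open>The q-Gauss sum\<close>

text \<open>Summand of the 2-phi-1 series with numerator parameters \<open>a\<close>,
  \<open>b\<close>, denominator parameter \<open>c = v\<close> and argument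
  \<open>z = c/(a*b)\<close>, in the coordinates \<open>u = z*(a+b)\<close> and
  \<open>v = z*a*b\<close>. Distributing \<open>z\<close> over the factors avoids inverses; it
  admits \<open>z = 0\<close>, the limit of infinite \<open>b\<close>, and parameters
  \<open>a\<close>, \<open>b\<close> that are not power series themselves.\<close>

definition gauss_term :: "int fps \<Rightarrow> int fps \<Rightarrow> int fps \<Rightarrow> int fps \<Rightarrow> nat \<Rightarrow> int fps" where
  "gauss_term x z u v s = (\<Prod>k<s. z - u * x ^ k + v * x ^ (2*k)) * (rq x s * iv (qpoch v x s))"

lemma dvd_prod_power: "\<lbrakk>\<And>k. d dvd f k\<rbrakk> \<Longrightarrow> d ^ s dvd (\<Prod>k<s. f k)" for d :: "int fps"
  by (induction s) (auto intro: mult_dvd_mono simp: mult.commute)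

lemma dvd_gauss_term:
  assumes "d dvd z" "d dvd u" "d dvd v" shows "d ^ s dvd gauss_term x z u v s"
  unfolding gauss_term_def using assms by (intro dvd_mult2 dvd_prod_power dvd_add dvd_diff) auto

lemma iv_qpoch_Suc:
  assumes "q dvd v" "q dvd x"
  shows "iv (qpoch v x s) = (1 - v * x ^ s) * iv (qpoch v x (Suc s))"
    and "iv (qpoch (v * x) x s) = (1 - v) * iv (qpoch v x (Suc s))"
proof -
  have "1 * iv (qpoch v x s) = (1 - v * x ^ s) * iv (qpoch v x (Suc s))"
    by (rule iv_swap) (use assms in \<open>simp_all add: qpoch_nth_0 qpoch_Suc X_dvd_iff\<close>)
  then show "iv (qpoch v x s) = (1 - v * x ^ s) * iv (qpoch v x (Suc s))" by simp
  have "1 * iv (qpoch (v * x) x s) = (1 - v) * iv (qpoch v x (Suc s))"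
  proof (rule iv_swap)
    show "1 * qpoch v x (Suc s) = (1 - v) * qpoch (v * x) x s"
      using qpoch_add[of v x 1 s] by (simp add: qpoch_def)
  qed (use assms in \<open>simp_all add: qpoch_nth_0\<close>)
  then show "iv (qpoch (v * x) x s) = (1 - v) * iv (qpoch v x (Suc s))" by simp
qed

text \<open>Contiguous relation: the shift by \<open>x\<close> fixes \<open>a\<close> and
  \<open>b\<close> and multiplies \<open>c\<close> and \<open>c/(a*b)\<close> by \<open>x\<close>.
  The certificate on the right vanishes at \<open>N = 0\<close> through \<open>1 - x ^ N\<close>,
  and it tends to 0 once \<open>q\<close> divides \<open>z\<close>, \<open>u\<close> and
  \<open>v\<close>.\<close>

lemma gauss_telescope:
  assumes x: "q dvd x" and v: "q dvd v"
  shows "(\<Sum>s<N. (1 - z) * (1 - v) * gauss_term x z u v s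
      - (1 - u + v * z) * gauss_term x (z * x) (u * x) (v * x) s) = - ((1 - v) * (1 - x ^ N) * gauss_term x z u v N)"
proof (induction N)
  case 0
  then show ?case by simp
next
  case (Suc N)
  let ?P = "\<Prod>k<N. z - u * x ^ k + v * x ^ (2*k)"
  define R where "R = rq x (Suc N)"
  define W where "W = iv (qpoch v x (Suc N))"
  define y where "y = x ^ N"
  have "(\<Prod>k<N. z * x - u * x * x ^ k + v * x * x ^ (2*k)) = (\<Prod>k<N. x * (z - u * x ^ k + v * x ^ (2*k)))"
    by (intro prod.cong refl) (simp add: algebra_simps)
  then have 1: "(\<Prod>k<N. z * x - u * x * x ^ k + v * x * x ^ (2*k)) = y * ?P"
    by (simp add: prod.distrib y_def)
  have 2: "rq x N = R * (1 - x * y)" using rq_Suc[OF x, of N] by (simp add: R_def y_def)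
  have 3: "gauss_term x z u v N = ?P * (R * (1 - x * y) * ((1 - v * y) * W))"
    unfolding gauss_term_def 2 iv_qpoch_Suc(1)[OF v x, of N] W_def y_def by (rule refl)
  have 4: "gauss_term x (z * x) (u * x) (v * x) N = y * ?P * (R * (1 - x * y) * ((1 - v) * W))"
    unfolding gauss_term_def 2 1 iv_qpoch_Suc(2)[OF v x, of N] W_def by (rule refl)
  have 5: "gauss_term x z u v (Suc N) = ?P * (z - u * y + v * y^2) * (R * W)"
    unfolding gauss_term_def by (simp add: R_def W_def y_def power2_eq_square mult_2 power_add)
  have gen: "- ((1 - v) * (1 - y) * (P * (R * (1 - x * y) * ((1 - v * y) * W)))) +
      ((1 - z) * (1 - v) * (P * (R * (1 - x * y) * ((1 - v * y) * W)))
      - (1 - u + v * z) * (y * P * (R * (1 - x * y) * ((1 - v) * W)))) =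
      - ((1 - v) * (1 - x * y) * (P * (z - u * y + v * y^2) * (R * W)))" for P
    by algebra
  show ?case
    unfolding sum.lessThan_Suc Suc 3 4 5 power_Suc y_def[symmetric] by (rule gen)
qed

lemma fsum_gauss_step:
  assumes x: "q dvd x" and "q dvd z" "q dvd u" "q dvd v"
  shows "(1 - z) * (1 - v) * fsum (gauss_term x z u v) =
    (1 - u + v * z) * fsum (gauss_term x (z * x) (u * x) (v * x))"
proof (rule X_adic_eqI)
  fix N
  let ?t = "gauss_term x z u v" and ?t' = "gauss_term x (z * x) (u * x) (v * x)"
  have t: "q ^ s dvd ?t s" "q ^ s dvd ?t' s" for s using assms by (simp_all add: dvd_gauss_term)
  have "q ^ N dvd (1 - z) * (1 - v) * (fsum ?t - (\<Sum>s<N. ?t s)) - (1 - u + v * z) * (fsum ?t' - (\<Sum>s<N. ?t' s))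
    - ((1 - v) * (1 - x ^ N) * ?t N)"
    by (intro dvd_diff[OF dvd_diff] dvd_mult fsum_approx t order_refl)
  moreover have "(1 - z) * (1 - v) * (\<Sum>s<N. ?t s) - (1 - u + v * z) * (\<Sum>s<N. ?t' s) = - ((1 - v) * (1 - x ^ N) * ?t N)"
    using gauss_telescope[OF x assms(4), of z u N] by (simp only: sum_subtractf sum_distrib_left)
  moreover have "c * (F - S) - c' * (F' - S') - E = c * F - c' * F'" if "c * S - c' * S' = - E"
    for c c' F F' S S' E :: "int fps" using that by algebra
  ultimately show "q ^ N dvd (1 - z) * (1 - v) * fsum ?t - (1 - u + v * z) * fsum ?t'" by metis
qed

text \<open>After \<open>N\<close> contiguous steps the parameters carry \<open>x ^ N\<close>, so
  the remaining series is 1 modulo \<open>q ^ N\<close> and the accumulated factors are the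
  truncated products. \<open>P\<close> stands for \<open>(c/a, c/b; x)_inf\<close>; it enters as a
  limit because each application factors the quadratic expressions in its own way.\<close>

lemma q_gauss_sum:
  assumes x: "q dvd x" and zuv: "q dvd z" "q dvd u" "q dvd v"
    and P: "\<And>N. q ^ N dvd P - (\<Prod>k<N. 1 - u * x ^ k + v * z * x ^ (2*k))"
  shows "fsum (gauss_term x z u v) * qpoch_inf v x * qpoch_inf z x = P"
proof (rule X_adic_eqI)
  fix N
  let ?f = "\<lambda>n. fsum (gauss_term x (z * x ^ n) (u * x ^ n) (v * x ^ n))"
  let ?Q = "\<lambda>n. \<Prod>k<n. 1 - u * x ^ k + v * z * x ^ (2*k)"
  have it: "qpoch z x n * qpoch v x n * fsum (gauss_term x z u v) = ?Q n * ?f n" for n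
  proof (induction n)
    case (Suc n)
    have "qpoch z x (Suc n) * qpoch v x (Suc n) * fsum (gauss_term x z u v) =
      (1 - z * x ^ n) * (1 - v * x ^ n) * (qpoch z x n * qpoch v x n * fsum (gauss_term x z u v))"
      by (simp add: qpoch_Suc mult_ac)
    also have "\<dots> = ?Q n * ((1 - z * x ^ n) * (1 - v * x ^ n) * ?f n)" unfolding Suc by (simp only: mult_ac)
    also have "(1 - z * x ^ n) * (1 - v * x ^ n) * ?f n = (1 - u * x ^ n + v * x ^ n * (z * x ^ n)) * ?f (Suc n)"
      using fsum_gauss_step[OF x, of "z * x ^ n" "u * x ^ n" "v * x ^ n"] zuv by (simp add: mult_ac)
    also have "v * x ^ n * (z * x ^ n) = v * z * x ^ (2*n)" by (simp only: mult_2 power_add) (simp only: mult_ac)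
    finally show ?case by (simp add: mult_ac)
  qed simp
  have "q ^ N dvd ?f N - 1"
  proof (cases N)
    case (Suc N')
    let ?t = "gauss_term x (z * x ^ N) (u * x ^ N) (v * x ^ N)"
    have t: "q ^ s dvd ?t s" for s using zuv by (simp add: dvd_gauss_term)
    have 1: "q ^ N dvd ?f N - (\<Sum>s<N. ?t s)" by (rule fsum_approx[OF t order_refl])
    have "(\<Sum>s<N. ?t s) = ?t 0 + (\<Sum>s<N'. ?t (Suc s))" unfolding Suc by (rule sum.lessThan_Suc_shift)
    moreover have "?t 0 = 1" using iv_unique[of 1 1] by (simp add: gauss_term_def)
    moreover have "q ^ N dvd (\<Sum>s<N'. ?t (Suc s))"
    proof (intro dvd_sum)
      fix s
      have "q ^ N dvd x ^ N" using x by (rule dvd_power_same)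
      then have "(q ^ N) ^ Suc s dvd ?t (Suc s)" by (intro dvd_gauss_term dvd_mult)
      then show "q ^ N dvd ?t (Suc s)" by (meson dvd_power dvd_trans zero_less_Suc)
    qed
    ultimately have "q ^ N dvd (\<Sum>s<N. ?t s) - 1" by simp
    with 1 show ?thesis by (rule dvd_diff_trans)
  qed simp
  then have "q ^ N dvd ?Q N * ?f N - P * 1"
    using P[of N] dvd_diff_sym by (intro dvd_diff_mult) blast+
  moreover have "q ^ N dvd qpoch_inf z x * qpoch_inf v x * fsum (gauss_term x z u v)
    - qpoch z x N * qpoch v x N * fsum (gauss_term x z u v)"
    by (intro dvd_diff_mult qpoch_inf_approx x zuv order_refl) simp
  ultimately show "q ^ N dvd fsum (gauss_term x z u v) * qpoch_inf v x * qpoch_inf z x - P"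
    unfolding it using dvd_diff_trans by (simp only: mult_ac mult_1_right mult_1_left)
qed

section \<open>Coefficients in arithmetic progressions modulo a prime\<close>

definition vanishes :: "int \<Rightarrow> nat \<Rightarrow> nat \<Rightarrow> int fps \<Rightarrow> bool" where
  "vanishes p m a f \<longleftrightarrow> (\<forall>n. n mod m = a \<longrightarrow> p dvd fps_nth f n)"

text \<open>The modulus \<open>p = 0\<close> is meaningful here and in \<open>vanishes\<close>:
  divisibility by 0 says that the coefficients are exactly 0, so \<open>lacunary 0 2\<close>
  describes even series.\<close>

definition lacunary :: "int \<Rightarrow> nat \<Rightarrow> int fps \<Rightarrow> bool" where
  "lacunary p m f \<longleftrightarrow> (\<forall>n. \<not> m dvd n \<longrightarrow> p dvd fps_nth f n)"

lemma vanishes_mult: assumes "vanishes p m a f" "lacunary p m g" shows "vanishes p m a (g * f)"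
  unfolding vanishes_def fps_mult_nth
proof (intro allI impI dvd_sum)
  fix n i assume n: "n mod m = a" and "i \<in> {0..n}"
  then have i: "i \<le> n" by simp
  show "p dvd fps_nth g i * fps_nth f (n - i)"
  proof (cases "m dvd i")
    case True
    then have "(n - i) mod m = a" using n i by (metis add_diff_cancel_right' dvd_imp_mod_0 le_add_diff_inverse2 mod_add_right_eq add.right_neutral)
    then show ?thesis using assms by (auto simp: vanishes_def)
  next
    case False
    then show ?thesis using assms by (auto simp: lacunary_def)
  qed
qed

lemma lacunary_mult: assumes "lacunary p m f" "lacunary p m g" shows "lacunary p m (f * g)"
  unfolding lacunary_def fps_mult_nth
proof (intro allI impI dvd_sum)
  fix n i assume n: "\<not> m dvd n" and "i \<in> {0..n}"
  then have "\<not> m dvd i \<or> \<not> m dvd (n - i)" using dvd_add by fastforce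
  then show "p dvd fps_nth f i * fps_nth g (n - i)" using assms by (auto simp: lacunary_def)
qed

lemma vanishes_fsum: "(\<And>k. vanishes p m a (t k)) \<Longrightarrow> vanishes p m a (fsum t)"
  unfolding vanishes_def fsum_def by (auto intro: dvd_sum)

lemma vanishes_add: "vanishes p m a f \<Longrightarrow> vanishes p m a g \<Longrightarrow> vanishes p m a (f + g)"
  by (simp add: vanishes_def)

lemma fps_nth_of_int_mult: "fps_nth (of_int c * f) n = c * fps_nth f n" for f :: "int fps"
  unfolding fps_of_int[symmetric] by simp

lemma vanishes_of_int_mult: "vanishes p m a f \<or> p dvd c \<Longrightarrow> vanishes p m a (of_int c * f)"
  by (auto simp: vanishes_def fps_nth_of_int_mult)

text \<open>The form in which summands are discarded: either the exponents miss the residue class or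
  the integer weight is a multiple of \<open>p\<close>.\<close>

lemma vanishes_coeff_mult:
  assumes "vanishes p m a f \<or> p dvd int c" shows "vanishes p m a ((-1) ^ k * of_nat c * f)"
proof -
  have "(-1) ^ k * of_nat c * f = of_int ((-1) ^ k * int c) * f" by simp
  moreover have "vanishes p m a f \<or> p dvd (-1) ^ k * int c" using assms dvd_mult by blast
  ultimately show ?thesis using vanishes_of_int_mult by metis
qed

lemma vanishes_X_power: "e mod m \<noteq> a \<Longrightarrow> vanishes p m a (q ^ e)"
  by (auto simp: vanishes_def)

lemma vanishes_X_power_mult:
  assumes "vanishes p m b f" "\<And>n. (n + e) mod m = a \<Longrightarrow> n mod m = b"
  shows "vanishes p m a (q ^ e * f)"
  unfolding vanishes_def
proof (intro allI impI)
  fix n assume n: "n mod m = a"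
  show "p dvd fps_nth (q ^ e * f) n"
    using assms(2)[of "n - e"] assms(1) n by (auto simp: fps_X_power_mult_nth vanishes_def)
qed

lemma vanishes_X_power_mult_cancel:
  assumes "vanishes p m a (q ^ e * f)" "\<And>n. n mod m = b \<Longrightarrow> (n + e) mod m = a"
  shows "vanishes p m b f"
  unfolding vanishes_def
proof (intro allI impI)
  fix n assume "n mod m = b"
  then show "p dvd fps_nth f n"
    using assms(1) assms(2)[of n] unfolding vanishes_def
    by (metis add_diff_cancel_right' fps_X_power_mult_nth not_add_less2)
qed

lemma lacunary_limit:
  assumes "\<And>N. \<exists>g. lacunary p m g \<and> q ^ N dvd f - g" shows "lacunary p m f"
  unfolding lacunary_def
proof (intro allI impI)
  fix n assume n: "\<not> m dvd n"
  obtain g where "lacunary p m g" "q ^ Suc n dvd f - g" using assms by blast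
  then show "p dvd fps_nth f n" using n unfolding lacunary_def X_power_dvd_iff by (metis eq_iff_diff_eq_0 fps_sub_nth lessI)
qed

lemma lacunary_qpoch_inf:
  assumes "0 < m" shows "lacunary p m (euler (q ^ m))"
proof (rule lacunary_limit)
  fix N
  have 1: "lacunary p m (qpoch (q ^ m) (q ^ m) n)" for n
  proof (induction n)
    case 0
    then show ?case by (auto simp: lacunary_def)
  next
    case (Suc n)
    have "lacunary p m (1 - q ^ (m * Suc n))" by (auto simp: lacunary_def)
    then have "lacunary p m (1 - q ^ m * (q ^ m) ^ n)" by (simp add: power_mult power_add)
    then show ?case unfolding qpoch_Suc by (intro lacunary_mult Suc)
  qed
  have "q dvd q ^ m" using assms by (simp add: dvd_power)
  then show "\<exists>g. lacunary p m g \<and> q ^ N dvd euler (q ^ m) - g"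
    using 1 qpoch_inf_approx by blast
qed

lemma lacunary_iv:
  assumes "lacunary p m f" "fps_nth f 0 = 1" shows "lacunary p m (iv f)"
proof -
  have "p dvd fps_nth (iv f) n" if "\<not> m dvd n" for n
    using that
  proof (induction n rule: less_induct)
    case (less n)
    have "n > 0" using less.prems by (cases n) auto
    have "0 = fps_nth (f * iv f) n" using \<open>n > 0\<close> iv_mult_self[OF assms(2)] by simp
    also have "\<dots> = fps_nth (iv f) n + (\<Sum>i=1..n. fps_nth f i * fps_nth (iv f) (n - i))"
      unfolding fps_mult_nth using assms(2) by (simp add: sum.atLeast_Suc_atMost)
    finally have "fps_nth (iv f) n = - (\<Sum>i=1..n. fps_nth f i * fps_nth (iv f) (n - i))" by simp
    moreover have "p dvd (\<Sum>i=1..n. fps_nth f i * fps_nth (iv f) (n - i))"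
    proof (intro dvd_sum)
      fix i assume i: "i \<in> {1..n}"
      then have "\<not> m dvd i \<or> \<not> m dvd (n - i)" using less.prems dvd_add[of m i "n - i"] by auto
      then show "p dvd fps_nth f i * fps_nth (iv f) (n - i)"
        using assms(1) less.IH[of "n - i"] i by (auto simp: lacunary_def)
    qed
    ultimately show ?case by simp
  qed
  then show ?thesis by (simp add: lacunary_def)
qed

text \<open>Induction on the exponent with \<open>f\<close> varying. For
  \<open>f = c + q * g\<close>, \<open>fr\<close> gives \<open>f^p = c^p + q^p * g^p\<close> modulo
  \<open>p\<close>, and coefficient \<open>n\<close> of \<open>q^p * g^p\<close> is coefficient
  \<open>n - p\<close> of \<open>g^p\<close>. The binomial congruence is a hypothesis so that 3 and
  5 can supply it by explicit polynomials.\<close>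

lemma lacunary_frobenius:
  fixes f :: "int fps"
  assumes p: "p > 0" and fr: "\<And>a b :: int fps. \<exists>h. (a + b) ^ p = a ^ p + b ^ p + of_nat p * h"
  shows "lacunary (int p) p (f ^ p)"
proof -
  have "int p dvd fps_nth (f ^ p) n" if "\<not> p dvd n" for n
    using that
  proof (induction n arbitrary: f rule: less_induct)
    case (less n)
    let ?g = "fps_shift 1 f"
    have "f = fps_const (fps_nth f 0) + q * ?g"
      by (intro fps_ext) (auto simp: fps_X_mult_nth)
    then obtain h where "f ^ p = fps_const (fps_nth f 0) ^ p + (q * ?g) ^ p + of_nat p * h"
      using fr by metis
    then have "fps_nth (f ^ p) n = fps_nth (fps_const (fps_nth f 0 ^ p)) n + fps_nth (q ^ p * ?g ^ p) n + int p * fps_nth h n"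
      using fps_nth_of_int_mult[of "int p" h n] by (simp add: power_mult_distrib fps_const_power)
    moreover have "n > 0" using less.prems by (cases n) auto
    moreover have "int p dvd fps_nth (q ^ p * ?g ^ p) n"
    proof (cases "n < p")
      case False
      then have "\<not> p dvd (n - p)" using less.prems by (metis dvd_diffD dvd_refl not_less)
      then show ?thesis using less.IH[of "n - p" ?g] p \<open>n > 0\<close> by (auto simp: fps_X_power_mult_nth)
    qed (simp add: fps_X_power_mult_nth)
    ultimately show ?case by simp
  qed
  then show ?thesis by (simp add: lacunary_def)
qed

lemma lacunary_cube: "lacunary 3 3 (f ^ 3)"
proof -
  have "\<exists>h. (a + b) ^ 3 = a ^ 3 + b ^ 3 + of_nat 3 * h" for a b :: "int fps"
    by (rule exI[of _ "a^2 * b + a * b^2"]) (simp, algebra)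
  then show ?thesis using lacunary_frobenius[of 3 f] by simp
qed

lemma lacunary_fifth: "lacunary 5 5 (f ^ 5)"
proof -
  have "\<exists>h. (a + b) ^ 5 = a ^ 5 + b ^ 5 + of_nat 5 * h" for a b :: "int fps"
    by (rule exI[of _ "a ^ 4 * b + 2 * a ^ 3 * b^2 + 2 * a^2 * b ^ 3 + a * b ^ 4"]) (simp, algebra)
  then show ?thesis using lacunary_frobenius[of 5 f] by simp
qed

lemma lacunary_combine:
  assumes "lacunary 5 5 f" "lacunary 0 2 f" shows "lacunary 5 10 f"
  unfolding lacunary_def
proof (intro allI impI)
  fix n :: nat assume "\<not> 10 dvd n"
  then have "\<not> 5 dvd n \<or> \<not> 2 dvd n" by presburger
  then show "5 dvd fps_nth f n" using assms by (auto simp: lacunary_def)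
qed

lemma lacunary_power: "lacunary p m f \<Longrightarrow> lacunary p m (f ^ k)"
proof (induction k)
  case 0
  then show ?case by (auto simp: lacunary_def)
next
  case (Suc k)
  then show ?case by (simp add: lacunary_mult)
qed

lemma spt_coeff_cong:
  assumes "\<And>k. q ^ k dvd t (Suc k)" "vanishes p m a (fsum (\<lambda>k. t (Suc k)))" "n mod m = a"
  shows "[spt_coeff t n = 0] (mod p)"
proof -
  have "(\<Sum>k. t (Suc k)) = fsum (\<lambda>k. t (Suc k))" by (rule suminf_eq_fsum[OF assms(1)])
  then show ?thesis using assms(2,3) by (simp add: spt_coeff_def vanishes_def cong_0_iff)
qed

section \<open>The functions spt_L9, spt_L7, spt_G1, spt_G2 and spt_L12 modulo 3\<close>

text \<open>The simproc would turn equations between powers of $q$ into equations between polynomials.\<close>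

declare [[simproc del: poly_fps_eq]]

lemma square_mod_3: "(a * a) mod 3 \<noteq> (2 :: nat)"
proof -
  have "(a * a) mod 3 = ((a mod 3) * (a mod 3)) mod 3" by (simp add: mod_mult_eq)
  moreover have "a mod 3 = 0 \<or> a mod 3 = 1 \<or> a mod 3 = 2" by auto
  ultimately show ?thesis by auto
qed

lemma tri_mod_3: "tri i mod 3 = (if i mod 3 = 1 then 1 else 0)"
proof -
  define k where "k = i div 3"
  have "i = 3 * k \<and> i mod 3 = 0 \<or> i = 3 * k + 1 \<and> i mod 3 = 1 \<or> i = 3 * k + 2 \<and> i mod 3 = 2"
    unfolding k_def by presburger
  then have "2 * tri i = 3 * (k * (i + 1)) \<and> i mod 3 = 0 \<or> 2 * tri i = 3 * (i * (k + 1)) \<and> i mod 3 = 2 \<or>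
    2 * tri i = 3 * (3 * (k * k) + 3 * k) + 2 \<and> i mod 3 = 1"
    unfolding two_tri by (elim disjE conjE) (simp_all add: algebra_simps)
  moreover have "t mod 3 = 0" if "2 * t = 3 * u" for t u :: nat using that by presburger
  moreover have "t mod 3 = 1" if "2 * t = 3 * u + 2" for t u :: nat using that by presburger
  ultimately have "tri i mod 3 = 0 \<and> i mod 3 = 0 \<or> tri i mod 3 = 0 \<and> i mod 3 = 2 \<or> tri i mod 3 = 1 \<and> i mod 3 = 1"
    by blast
  then show ?thesis by auto
qed

lemma X_dvd [simp]: "q dvd q^2" "q dvd - q" "q^2 \<noteq> 0"
  by (simp_all add: power2_eq_square)

lemma qpoch_odd: "qpoch a b (2 * m + 1) = qpoch a (b^2) (m + 1) * qpoch (a * b) (b^2) m"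
proof -
  have "b ^ (2 * m) = (b^2) ^ m" by (rule power_mult)
  then show ?thesis using qpoch_bisect[of a b m] by (simp add: qpoch_Suc mult_ac)
qed

lemma euler_1: "euler q = qpoch_inf q (q^2) * euler (q^2)"
  using qpoch_inf_bisect[of q q] by (simp add: power2_eq_square)

section \<open>spt_L9: a first-order recurrence for the kernel and partial theta series\<close>

lemma term_L9_eq:
  "term_L9 (Suc m) = qpoch_inf q (q^2) * (iv (euler q))^2 *
    (q ^ (m+1) * qpoch (q^2) (q^2) m * ((qpoch q q m)^2 * rq q (2*m+1)))"
proof -
  have "2 * Suc m + 1 = Suc (2 * (m+1))" by simp
  then have e: "q ^ (2 * Suc m + 1) = q * (q^2) ^ (m+1)" "q ^ Suc m = q * q ^ m"
    by (simp_all only: power_Suc power_mult)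
  have "1 * iv (qpoch q (q^2) (m+1)) = qpoch (q^2) (q^2) m * rq q (2*m+1)"
    unfolding rq_def
  proof (rule iv_swap)
    show "1 * qpoch q q (2*m+1) = qpoch (q^2) (q^2) m * qpoch q (q^2) (m+1)"
      using qpoch_odd[of q q m] by (simp only: power2_eq_square[symmetric] mult.commute mult_1_left)
  qed (simp_all add: qpoch_nth_0)
  then have 1: "qpoch_inf (q * (q^2) ^ (m+1)) (q^2) = qpoch_inf q (q^2) * (qpoch (q^2) (q^2) m * rq q (2*m+1))"
    by (simp only: qpoch_inf_shift X_dvd dvd_refl mult_1_left)
  have 2: "iv ((qpoch_inf (q * q ^ m) q)^2) = (qpoch q q m * iv (euler q))^2"
    by (simp add: iv_power qpoch_inf_nth_0 iv_qpoch_inf_shift)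
  have gen: "(qm * (W * (e * r))) * (p * I)^2 = W * I^2 * (qm * e * (p^2 * r))" for qm W e r p I :: "int fps"
    by algebra
  show ?thesis unfolding term_L9_def fps_quot_eq_iv e 1 2
    using gen[of "q * q ^ m"] by simp
qed

text \<open>The kernel satisfies \<open>g i + q^(2i+2) * g (i+1) = q^(i+1) * const\<close>.
  Iteration alternates the sign and accumulates the exponents \<open>2*(i+k)+2\<close> for
  \<open>k < r\<close>, that is \<open>r*r + r + 2*i*r\<close>; adding \<open>i + r + 1\<close>
  gives \<open>(r+1)^2 + i*(2*r+1)\<close>.\<close>

lemma L9_kernel:
  fixes i :: nat
  defines "D \<equiv> \<lambda>m. q ^ (m+1) * qpoch (q^2) (q^2) m"
  defines "g \<equiv> \<lambda>i. fsum (\<lambda>s. D (i + s) * (rq q s * rq q (2*i+s+1)))"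
  shows "g i = euler (q^2) * (iv (euler q))^2 * fsum (\<lambda>r. (-1) ^ r * q ^ ((r+1) * (r+1) + i * (2*r+1)))"
proof -
  let ?c = "euler (q^2) * (iv (euler q))^2"
  have D: "q ^ m dvd D m" for m unfolding D_def by (intro dvd_mult2 le_imp_power_dvd) simp
  have rec: "g i + q ^ (2*i+2) * g (Suc i) = q ^ (i+1) * ?c" for i
    unfolding g_def
  proof (rule fsum_combine)
    let ?A = "\<lambda>s. D (i + s) * (rq q s * rq q (2*i+s+1))"
    let ?B = "\<lambda>s. D (Suc i + s) * (rq q s * rq q (2*Suc i+s+1))"
    fix N
    have "(\<Sum>s<Suc N. ?A s) + q ^ (2*i+2) * (\<Sum>s<N. ?B s) =
      q ^ (i+1) * (qpoch (q^2) (q^2) (i+N+1) * (rq q N * rq q (2*i+N+2)))" for N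
    proof (induction N)
      case 0
      have "rq q (2*i+1) = rq q (2*i+2) * (1 - q ^ (2*i+2))" using rq_Suc[of q "2*i+1"] by simp
      moreover have "qpoch (q^2) (q^2) (i+1) = qpoch (q^2) (q^2) i * (1 - q ^ (2*i+2))"
      proof -
        have "2*i+2 = 2+2*i" by simp
        then have "q ^ (2*i+2) = q^2 * (q^2) ^ i" by (simp only: power_add power_mult)
        then show ?thesis by (simp add: qpoch_Suc)
      qed
      ultimately show ?case by (simp add: D_def mult_ac)
    next
      case (Suc N)
      have p: "q ^ Suc N = q * q ^ N" "q ^ Suc (2*i+N+2) = q ^ 3 * (q ^ i)^2 * q ^ N"
        "q ^ (i + Suc N + 1) = q^2 * q ^ i * q ^ N" "q ^ (2*i+2) = q^2 * (q ^ i)^2" "q ^ (i+1) = q * q ^ i"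
        by (simp_all add: mult_2 power_add power2_eq_square eval_nat_numeral mult_ac)
      have r: "rq q N = rq q (Suc N) * (1 - q * q ^ N)"
        "rq q (2*i+N+2) = rq q (Suc (2*i+N+2)) * (1 - q ^ 3 * (q ^ i)^2 * q ^ N)"
        using rq_Suc[of q N] rq_Suc[of q "2*i+N+2"] unfolding p by simp_all
      have ev: "qpoch (q^2) (q^2) (i+Suc N+1) = qpoch (q^2) (q^2) (i+N+1) * (1 - q ^ 4 * (q ^ i)^2 * (q ^ N)^2)"
        by (simp add: qpoch_Suc power2_eq_square eval_nat_numeral power_add power_mult_distrib mult_ac)
      have e: "2*i+Suc N+1 = 2*i+N+2" "2*Suc i+N+1 = Suc (2*i+N+2)" "2*i+Suc N+2 = Suc (2*i+N+2)" "Suc i + N = i + Suc N"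
        "qpoch (q^2) (q^2) (i + Suc N) = qpoch (q^2) (q^2) (i+N+1)" by simp_all
      have gen: "y * a * (P * (R * (1 - y * b) * (R' * (1 - y ^ 3 * a^2 * b)))) +
          (y^2 * a * b * P * (R * (R' * (1 - y ^ 3 * a^2 * b))) +
          y^2 * a^2 * (y^2 * a * b * P * (R * (1 - y * b) * R'))) =
          y * a * (P * (1 - y ^ 4 * a^2 * b^2) * (R * R'))" for y a b P R R' :: "int fps"
        by algebra
      have "(\<Sum>s<Suc (Suc N). ?A s) + q ^ (2*i+2) * (\<Sum>s<Suc N. ?B s) =
         ((\<Sum>s<Suc N. ?A s) + q ^ (2*i+2) * (\<Sum>s<N. ?B s)) + (?A (Suc N) + q ^ (2*i+2) * ?B N)"
        unfolding sum.lessThan_Suc[of _ "Suc N"] sum.lessThan_Suc[of ?B N] by (simp only: distrib_left add_ac)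
      also have "\<dots> = q ^ (i+1) * (qpoch (q^2) (q^2) (i+Suc N+1) * (rq q (Suc N) * rq q (2*i+Suc N+2)))"
        unfolding Suc unfolding D_def e ev p r by (rule gen)
      finally show ?case .
    qed
    then show "q ^ N dvd q ^ (i+1) * ?c - ((\<Sum>s<Suc N. ?A s) + q ^ (2*i+2) * (\<Sum>s<N. ?B s))"
      unfolding power2_eq_square[of "iv _"]
      by (simp only:) (intro dvd_diff_mult qpoch_inf_approx rq_approx; simp)
  qed (rule dvd_add_mult[OF D])+
  have it: "g i = ?c * (\<Sum>r<n. (-1) ^ r * q ^ ((r+1) * (r+1) + i * (2*r+1))) + (-1) ^ n * q ^ (n*n+n+2*i*n) * g (i+n)" for n
  proof (induction n)
    case (Suc n)
    have "g (i+n) = q ^ (i+n+1) * ?c - q ^ (2*(i+n)+2) * g (Suc (i+n))" using rec[of "i+n"] by (simp add: algebra_simps)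
    then have "g i = ?c * (\<Sum>r<n. (-1) ^ r * q ^ ((r+1) * (r+1) + i * (2*r+1))) +
      (-1) ^ n * ((q ^ (n*n+n+2*i*n) * q ^ (i+n+1)) * ?c - (q ^ (n*n+n+2*i*n) * q ^ (2*(i+n)+2)) * g (Suc (i+n)))"
      using Suc by (simp only: right_diff_distrib mult.assoc)
    also have "q ^ (n*n+n+2*i*n) * q ^ (i+n+1) = q ^ ((n+1) * (n+1) + i * (2*n+1))"
      unfolding power_add[symmetric] by (rule arg_cong[of _ _ "\<lambda>k. q ^ k"]) (simp add: algebra_simps)
    also have "q ^ (n*n+n+2*i*n) * q ^ (2*(i+n)+2) = q ^ (Suc n * Suc n + Suc n + 2*i*Suc n)"
      unfolding power_add[symmetric] by (rule arg_cong[of _ _ "\<lambda>k. q ^ k"]) (simp add: algebra_simps)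
    finally show ?case by (simp add: algebra_simps)
  qed simp
  show ?thesis
  proof (rule X_adic_eqI)
    fix N
    let ?h = "\<lambda>r. (-1) ^ r * q ^ ((r+1) * (r+1) + i * (2*r+1))"
    have h: "q ^ r dvd ?h r" for r by (intro dvd_mult le_imp_power_dvd) simp
    have "q ^ N dvd (-1) ^ N * q ^ (N*N+N+2*i*N) * g (i+N)"
      by (intro dvd_mult2[OF dvd_mult[OF le_imp_power_dvd]]) simp
    then have "q ^ N dvd g i - ?c * (\<Sum>r<N. ?h r)" using it[of N] by simp
    moreover have "q ^ N dvd ?c * fsum ?h - ?c * (\<Sum>r<N. ?h r)" by (rule fsum_approx_mult[OF h order_refl])
    ultimately show "q ^ N dvd g i - ?c * fsum ?h" by (meson dvd_diff_sym dvd_diff_trans)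
  qed
qed

lemma fsum_L9: "fsum (\<lambda>m. term_L9 (Suc m)) = iv (euler q) ^ 3 *
  fsum (\<lambda>i. (-1) ^ i * of_nat (2*i+1) * (q ^ tri i * fsum (\<lambda>r. (-1) ^ r * q ^ ((r+1) * (r+1) + i * (2*r+1)))))"
proof -
  let ?E = "euler q" and ?O = "qpoch_inf q (q^2)" and ?E2 = "euler (q^2)"
  let ?D = "\<lambda>m. q ^ (m+1) * qpoch (q^2) (q^2) m"
  let ?h = "\<lambda>i. fsum (\<lambda>r. (-1) ^ r * q ^ ((r+1) * (r+1) + i * (2*r+1)))"
  have D: "q ^ m dvd ?D m" for m by (intro dvd_mult2 le_imp_power_dvd) simp
  have bc: "bailey_coeff q ?D i = ?E2 * (iv ?E)^2 * (q ^ tri i * ?h i)" for i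
    unfolding bailey_coeff_def L9_kernel by (simp only: mult_ac)
  have "fsum (\<lambda>m. term_L9 (Suc m)) = ?O * (iv ?E)^2 * fsum (\<lambda>m. ?D m * ((qpoch q q m)^2 * rq q (2*m+1)))"
    unfolding term_L9_eq by (intro fsum_mult_left dvd_mult2 D)
  also have "\<dots> = ?O * (iv ?E)^2 * fsum (\<lambda>i. ?E2 * (iv ?E)^2 * ((-1) ^ i * of_nat (2*i+1) * (q ^ tri i * ?h i)))"
    using bailey_sum_odd[of q ?D, OF _ _ D] by (simp only: bc dvd_refl fps_X_neq_zero) (simp add: mult_ac)
  also have "fsum (\<lambda>i. ?E2 * (iv ?E)^2 * ((-1) ^ i * of_nat (2*i+1) * (q ^ tri i * ?h i))) =
    ?E2 * (iv ?E)^2 * fsum (\<lambda>i. (-1) ^ i * of_nat (2*i+1) * (q ^ tri i * ?h i))"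
    by (intro fsum_mult_left dvd_mult[OF dvd_mult2] dvd_power_tri) simp
  finally have "fsum (\<lambda>m. term_L9 (Suc m)) = ?O * (iv ?E)^2 * (?E2 * (iv ?E)^2 * fsum (\<lambda>i. (-1) ^ i * of_nat (2*i+1) * (q ^ tri i * ?h i)))" .
  moreover have "?O * ?E2 * iv ?E = 1" using iv_mult_self[of ?E] by (simp add: euler_1[symmetric] qpoch_inf_nth_0)
  moreover have "W * I^2 * (E2 * I^2 * S) = I ^ 3 * S" if "W * E2 * I = 1" for W I E2 S :: "int fps" using that by algebra
  ultimately show ?thesis by simp
qed

text \<open>For \<open>i\<close> congruent to 1 the weight \<open>2*i+1\<close> is a multiple of 3.
  Otherwise \<open>tri i\<close> is a multiple of 3 and the total exponent is congruent to
  \<open>(r+1)^2\<close> or \<open>r^2\<close>, while 2 is not a square modulo 3.\<close>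

lemma vanishes_L9: "vanishes 3 3 2 (fsum (\<lambda>m. term_L9 (Suc m)))"
  unfolding fsum_L9
proof (intro vanishes_mult[OF _ lacunary_cube] vanishes_fsum vanishes_coeff_mult)
  fix i
  show "vanishes 3 3 2 (q ^ tri i * fsum (\<lambda>r. (-1) ^ r * q ^ ((r+1) * (r+1) + i * (2*r+1)))) \<or> 3 dvd int (2*i+1)"
  proof (cases "i mod 3 = 1")
    case True
    then show ?thesis by (intro disjI2) presburger
  next
    case False
    then obtain t where t: "tri i = 3 * t" using tri_mod_3[of i] by auto
    have "q ^ tri i * fsum (\<lambda>r. (-1) ^ r * q ^ ((r+1) * (r+1) + i * (2*r+1))) =
      fsum (\<lambda>r. q ^ tri i * ((-1) ^ r * q ^ ((r+1) * (r+1) + i * (2*r+1))))"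
      by (rule fsum_mult_left[symmetric]) (intro dvd_mult le_imp_power_dvd, simp)
    also have "vanishes 3 3 2 \<dots>"
    proof (rule vanishes_fsum)
      fix r
      have "(tri i + ((r+1) * (r+1) + i * (2*r+1))) mod 3 \<noteq> 2"
      proof (cases "i mod 3 = 0")
        case True
        then obtain k where k: "i = 3 * k" by auto
        have "tri i + ((r+1) * (r+1) + i * (2*r+1)) = (r+1) * (r+1) + 3 * (t + k * (2*r+1))"
          unfolding t by (simp add: k algebra_simps)
        then show ?thesis using square_mod_3[of "r+1"] by (metis mod_mult_self2)
      next
        case F: False
        then have "i mod 3 = 2" using False by auto
        then obtain k where k: "i = 3 * k + 2" by (metis add.commute mod_mult_div_eq)
        have "tri i + ((r+1) * (r+1) + i * (2*r+1)) = r * r + 3 * (t + k * (2*r+1) + 2*r + 1)"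
          unfolding t by (simp add: k algebra_simps)
        then show ?thesis using square_mod_3[of r] by (metis mod_mult_self2)
      qed
      then have "vanishes 3 3 2 (q ^ (tri i + ((r+1) * (r+1) + i * (2*r+1))))" by (rule vanishes_X_power)
      then have "vanishes 3 3 2 ((-1) ^ r * of_nat 1 * q ^ (tri i + ((r+1) * (r+1) + i * (2*r+1))))"
        by (intro vanishes_coeff_mult) simp
      then show "vanishes 3 3 2 (q ^ tri i * ((-1) ^ r * q ^ ((r+1) * (r+1) + i * (2*r+1))))"
        by (simp only: power_add[of q] of_nat_1 mult_1_right mult_1_left mult_ac)
    qed
    finally show ?thesis by blast
  qed
qed

section \<open>Terms in base q^2, and spt_L7 through tails of the triangular number series\<close>

lemma X_sq_power: "q ^ (2 * n) = (q^2) ^ n" by (rule power_mult)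

lemma iv_qpoch_minus: "iv (qpoch (- q) q n) = qpoch q q n * rq (q^2) n"
proof -
  have "1 * iv (qpoch (- q) q n) = qpoch q q n * rq (q^2) n"
    unfolding rq_def by (rule iv_swap) (simp_all add: qpoch_nth_0 qpoch_mult_minus)
  then show ?thesis by simp
qed

text \<open>Source of the denominator that the first difference removes: with
  \<open>y = q^(2m+2)\<close>, lowering both indices from \<open>2*m+2\<close> to
  \<open>2*m+1\<close> leaves \<open>(1 - y)/(1 - y^2) = 1/(1 + y)\<close>.\<close>

lemma qpoch_rq_double:
  "qpoch q q (2*m+2) * rq (q^2) (2*m+2) = qpoch q q (2*m+1) * iv (1 + (q^2) ^ (m+1)) * rq (q^2) (2*m+1)"
proof -
  let ?y = "(q^2) ^ (m+1)"
  have "q * q ^ (2*m+1) = q ^ (2 * (m+1))" by (simp only: power_Suc[symmetric]) simp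
  then have 1: "qpoch q q (2*m+2) = qpoch q q (2*m+1) * (1 - ?y)"
    using qpoch_Suc[of q q "2*m+1"] by (simp only: X_sq_power) simp
  have "2*m+2 = (m+1) * 2" by simp
  then have "(q^2) ^ (2*m+2) = ?y^2" by (simp only: power_mult)
  then have 2: "rq (q^2) (2*m+1) = rq (q^2) (2*m+2) * (1 - ?y^2)"
    using rq_Suc[of "q^2" "2*m+1"] by simp
  have 3: "(1 + ?y) * iv (1 + ?y) = 1" by (rule iv_mult_self) simp
  have gen: "P * (1 - y) * R = P * J * (R * (1 - y^2))" if "(1 + y) * J = 1" for P y R J :: "int fps"
    using that by algebra
  show ?thesis unfolding 1 2 by (rule gen[OF 3])
qed

lemma iv_qpoch_inf_even: "iv ((qpoch_inf (q ^ (2 * Suc m)) (q^2))^2) = (qpoch (q^2) (q^2) m * iv (euler (q^2)))^2"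
proof -
  have "q ^ (2 * Suc m) = q^2 * (q^2) ^ m" by (simp only: X_sq_power power_Suc)
  then show ?thesis by (simp only: iv_power qpoch_inf_nth_0 X_dvd dvd_mult2 iv_qpoch_inf_shift)
qed

lemma term_L7_eq:
  "term_L7 (Suc m) = qpoch_inf (- q) q * (iv (euler (q^2)))^2 *
    (q ^ (2*m+2) * qpoch q q (2*m+1) * iv (1 + (q^2) ^ (m+1)) * ((qpoch (q^2) (q^2) m)^2 * rq (q^2) (2*m+1)))"
proof -
  have "- (q ^ (2 * Suc m + 1)) = (- q) * q ^ (2*m+2)" by simp
  then have 1: "qpoch_inf (- (q ^ (2 * Suc m + 1))) q = qpoch_inf (- q) q * (qpoch q q (2*m+1) * iv (1 + (q^2) ^ (m+1)) * rq (q^2) (2*m+1))"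
    by (simp only: qpoch_inf_shift X_dvd dvd_refl iv_qpoch_minus qpoch_rq_double)
  have e: "2 * Suc m = 2*m+2" by simp
  have gen: "(qm * (W * (P * J * R))) * (p * I)^2 = W * I^2 * (qm * P * J * (p^2 * R))" for qm W P J R p I :: "int fps"
    by algebra
  show ?thesis unfolding term_L7_def fps_quot_eq_iv 1 iv_qpoch_inf_even unfolding e by (rule gen)
qed

lemma term_G1_eq:
  "term_G1 (Suc m) = iv (euler (q^2)) * iv (euler q) *
    (q ^ (m+1) * qpoch q q (2*m+1) * iv (1 + (q^2) ^ (m+1)) * ((qpoch (q^2) (q^2) m)^2 * rq (q^2) (2*m+1)))"
proof -
  let ?E2 = "euler (q^2)"
  have "4 * Suc m + 2 = 2 * Suc (2*m+2)" by simp
  then have "q ^ (4 * Suc m + 2) = q^2 * (q^2) ^ (2*m+2)" by (simp only: X_sq_power power_Suc)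
  then have 1: "qpoch_inf (q ^ (4 * Suc m + 2)) (q^2) = ?E2 * rq (q^2) (2*m+2)"
    by (simp only: qpoch_inf_shift X_dvd rq_def)
  have e: "q ^ (2 * Suc m + 2) = q ^ (2 * Suc m + 1) * q" by (simp add: mult_ac)
  have "q dvd q ^ (2 * Suc m + 1)" by simp
  then have 3: "qpoch_inf (q ^ (2 * Suc m + 1)) (q^2) * qpoch_inf (q ^ (2 * Suc m + 2)) (q^2) = qpoch_inf (q ^ (2 * Suc m + 1)) q"
    unfolding e by (rule qpoch_inf_bisect[OF _ dvd_refl, symmetric])
  have 4: "q ^ (2 * Suc m + 1) = q * q ^ (2*m+2)" by simp
  have 2: "iv (qpoch_inf (q ^ (2 * Suc m + 1)) (q^2) * qpoch_inf (q ^ (2 * Suc m + 2)) (q^2)) =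
    qpoch q q (2*m+2) * iv (euler q)" unfolding 3 unfolding 4 by (simp only: iv_qpoch_inf_shift dvd_refl)
  have n0: "fps_nth ((qpoch_inf (q ^ (2 * Suc m)) (q^2))^2) 0 = 1"
    "fps_nth (qpoch_inf (q ^ (2 * Suc m + 1)) (q^2) * qpoch_inf (q ^ (2 * Suc m + 2)) (q^2)) 0 = 1"
    by (simp_all add: fps_power_zeroth qpoch_inf_nth_0)
  have gen: "(qm * (e * r)) * ((p * I)^2 * (P * J)) = I * J * (qm * (P * r) * p^2)" if "e * I = 1"
    for qm e r p I P J :: "int fps"
    using that by algebra
  have "term_G1 (Suc m) = iv ?E2 * iv (euler q) * (q ^ Suc m * (qpoch q q (2*m+2) * rq (q^2) (2*m+2)) * (qpoch (q^2) (q^2) m)^2)"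
    unfolding term_G1_def fps_quot_eq_iv iv_mult[OF n0] 1 2 iv_qpoch_inf_even
    by (rule gen, rule iv_mult_self) (simp add: qpoch_inf_nth_0)
  then show ?thesis unfolding qpoch_rq_double by (simp only: Suc_eq_plus1 mult_ac)
qed

text \<open>After the denominator is gone the series has argument \<open>q^2\<close>, while the
  q-Gauss sum would need \<open>c/(a*b) = q\<close>. So instead of a closed form there is an
  inhomogeneous recurrence in \<open>i\<close>, whose truncations do have a closed form, checked by
  induction.\<close>

lemma L7_recurrence:
  fixes i :: nat
  defines "F \<equiv> \<lambda>m. q ^ (2*m+2) * qpoch q q (2*m+1)"
  defines "U \<equiv> \<lambda>i. fsum (\<lambda>s. F (i + s) * (rq (q^2) s * rq (q^2) (2*i+s+2)))"
  shows "(1 - (q^2) ^ (i+1)) * U i - q ^ (4*i+5) * (1 - (q^2) ^ (i+2)) * U (Suc i) =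
    q ^ (2*i+2) * (1 + q ^ (2*i+3)) * (euler q * (iv (euler (q^2)))^2)"
proof -
  let ?x = "q^2"
  let ?A = "\<lambda>s. F (i + s) * (rq ?x s * rq ?x (2*i+s+2))"
  let ?B = "\<lambda>s. F (Suc i + s) * (rq ?x s * rq ?x (2*Suc i+s+2))"
  let ?a = "1 - ?x ^ (i+1)" and ?b = "- (q ^ (4*i+5) * (1 - ?x ^ (i+2)))"
  let ?L = "q ^ (2*i+2) * (1 + q ^ (2*i+3)) * (euler q * (iv (euler ?x))^2)"
  have Fd: "q ^ m dvd F m" for m unfolding F_def by (intro dvd_mult2 le_imp_power_dvd) simp
  have Ad: "q ^ s dvd ?A s" and Bd: "q ^ s dvd ?B s" for s by (rule dvd_add_mult[OF Fd])+
  have part: "(\<Sum>s<Suc N. ?a * ?A s) + ?b * (\<Sum>s<N. ?B s) =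
    q ^ (2*i+2) * (1 + q ^ (2*i+3)) * (qpoch q q (2*(i+N+1)+1) * (rq ?x N * rq ?x (2*i+N+3)))" for N
  proof (induction N)
    case 0
    have p: "?x ^ (i+1) = q^2 * (q ^ i)^2" "q ^ (2*i+2) = q^2 * (q ^ i)^2" "q ^ (2*i+3) = q ^ 3 * (q ^ i)^2"
      "?x ^ Suc (2*i+2) = q ^ 6 * (q ^ i) ^ 4" "q * q ^ (2*i+1) = q^2 * (q ^ i)^2" "q * q ^ Suc (2*i+1) = q ^ 3 * (q ^ i)^2"
      by (simp_all add: mult_2 power_add power2_eq_square power_mult_distrib eval_nat_numeral mult_ac)
    have r: "rq ?x (2*i+2) = rq ?x (2*i+3) * (1 - q ^ 6 * (q ^ i) ^ 4)"
      using rq_Suc[of ?x "2*i+2"] unfolding p by (simp add: eval_nat_numeral)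
    have "2*(i+1)+1 = Suc (Suc (2*i+1))" by simp
    then have P: "qpoch q q (2*(i+1)+1) = qpoch q q (2*i+1) * (1 - q^2 * (q ^ i)^2) * (1 - q ^ 3 * (q ^ i)^2)"
      by (simp only: qpoch_Suc p)
    have gen: "(1 - y^2 * a^2) * (y^2 * a^2 * P * (R * (1 - y ^ 6 * a ^ 4))) =
      y^2 * a^2 * (1 + y ^ 3 * a^2) * (P * (1 - y^2 * a^2) * (1 - y ^ 3 * a^2) * R)" for y a P R :: "int fps"
      by algebra
    have "?a * ?A 0 = q ^ (2*i+2) * (1 + q ^ (2*i+3)) * (qpoch q q (2*(i+0+1)+1) * (rq ?x 0 * rq ?x (2*i+0+3)))"
      unfolding F_def add_0_right rq_0 mult_1_left unfolding P p r by (rule gen)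
    then show ?case by simp
  next
    case (Suc N)
    have p: "?x ^ (i+1) = q^2 * (q ^ i)^2" "q ^ (2*i+2) = q^2 * (q ^ i)^2" "q ^ (2*i+3) = q ^ 3 * (q ^ i)^2"
      "?x ^ (i+2) = q ^ 4 * (q ^ i)^2" "q ^ (4*i+5) = q ^ 5 * (q ^ i) ^ 4"
      "?x ^ Suc N = q^2 * (q ^ N)^2" "?x ^ Suc (2*i+N+3) = q ^ 8 * (q ^ i) ^ 4 * (q ^ N)^2"
      "q ^ (2*(i+Suc N)+2) = q ^ 4 * (q ^ i)^2 * (q ^ N)^2"
      "q * q ^ (2*(i+N+1)+1) = q ^ 4 * (q ^ i)^2 * (q ^ N)^2" "q * q ^ Suc (2*(i+N+1)+1) = q ^ 5 * (q ^ i)^2 * (q ^ N)^2"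
      by (simp_all add: mult_2 power_add power2_eq_square power_mult_distrib eval_nat_numeral mult_ac)
    have r: "rq ?x N = rq ?x (Suc N) * (1 - q^2 * (q ^ N)^2)"
      "rq ?x (2*i+N+3) = rq ?x (Suc (2*i+N+3)) * (1 - q ^ 8 * (q ^ i) ^ 4 * (q ^ N)^2)"
      using rq_Suc[of ?x N] rq_Suc[of ?x "2*i+N+3"] unfolding p by simp_all
    have e: "2*i+Suc N+2 = 2*i+N+3" "2*Suc i+N+2 = Suc (2*i+N+3)" "2*i+Suc N+3 = Suc (2*i+N+3)" "Suc i + N = i + Suc N"
      "2*(i+Suc N)+1 = 2*(i+N+1)+1" by simp_all
    have "2*(i+Suc N+1)+1 = Suc (Suc (2*(i+N+1)+1))" by simp
    then have P: "qpoch q q (2*(i+Suc N+1)+1) = qpoch q q (2*(i+N+1)+1) * (1 - q ^ 4 * (q ^ i)^2 * (q ^ N)^2) * (1 - q ^ 5 * (q ^ i)^2 * (q ^ N)^2)"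
      by (simp only: qpoch_Suc p)
    have gen: "y^2 * a^2 * (1 + y ^ 3 * a^2) * (P * (R * (1 - y^2 * b^2) * (R' * (1 - y ^ 8 * a ^ 4 * b^2)))) +
       ((1 - y^2 * a^2) * (y ^ 4 * a^2 * b^2 * P * (R * (R' * (1 - y ^ 8 * a ^ 4 * b^2)))) +
        - (y ^ 5 * a ^ 4 * (1 - y ^ 4 * a^2)) * (y ^ 4 * a^2 * b^2 * P * (R * (1 - y^2 * b^2) * R'))) =
       y^2 * a^2 * (1 + y ^ 3 * a^2) * (P * (1 - y ^ 4 * a^2 * b^2) * (1 - y ^ 5 * a^2 * b^2) * (R * R'))"
      for y a b P R R' :: "int fps" by algebra
    have "(\<Sum>s<Suc (Suc N). ?a * ?A s) + ?b * (\<Sum>s<Suc N. ?B s) =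
       ((\<Sum>s<Suc N. ?a * ?A s) + ?b * (\<Sum>s<N. ?B s)) + (?a * ?A (Suc N) + ?b * ?B N)"
      unfolding sum.lessThan_Suc[of _ "Suc N"] sum.lessThan_Suc[of ?B N] by (simp only: distrib_left add_ac)
    also have "\<dots> = q ^ (2*i+2) * (1 + q ^ (2*i+3)) * (qpoch q q (2*(i+Suc N+1)+1) * (rq ?x (Suc N) * rq ?x (2*i+Suc N+3)))"
      unfolding Suc unfolding F_def e P p r by (rule gen)
    finally show ?case .
  qed
  have "fsum (\<lambda>s. ?a * ?A s) + ?b * fsum ?B = ?L"
  proof (rule fsum_combine)
    show "q ^ s dvd ?a * ?A s" "q ^ s dvd ?B s" for s by (intro dvd_mult Ad, rule Bd)
    fix N
    show "q ^ N dvd ?L - ((\<Sum>s<Suc N. ?a * ?A s) + ?b * (\<Sum>s<N. ?B s))"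
      unfolding part power2_eq_square[of "iv _"]
      by (intro dvd_diff_mult qpoch_inf_approx rq_approx; simp)
  qed
  then show ?thesis unfolding U_def fsum_mult_left[of ?A, OF Ad] by simp
qed

text \<open>The factor \<open>q ^ ((i+1) * (i+1))\<close> makes the recurrence exact: it raises the
  exponent to \<open>(i+1)*(2i+1)\<close>, whose increment \<open>4i+5\<close> is the coefficient's
  exponent. Then \<open>w i - w (i+1)\<close> consists of two consecutive triangular powers, and
  summation yields the tail of the triangular number series from index \<open>2*i+2\<close>
  on.\<close>

lemma L7_differences:
  fixes i :: nat
  defines "D \<equiv> \<lambda>m. q ^ (2*m+2) * qpoch q q (2*m+1) * iv (1 + (q^2) ^ (m+1))"
  shows "q ^ ((i+1) * (i+1)) * (bailey_coeff (q^2) D i - bailey_coeff (q^2) D (Suc i)) =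
    euler q * (iv (euler (q^2)))^2 * fsum (\<lambda>k. q ^ tri (2*(i+k)+2) + q ^ tri (2*(i+k)+3))"
proof -
  let ?x = "q^2" and ?c = "euler q * (iv (euler (q^2)))^2"
  define F where "F = (\<lambda>m. q ^ (2*m+2) * qpoch q q (2*m+1))"
  define U where "U = (\<lambda>i. fsum (\<lambda>s. F (i + s) * (rq ?x s * rq ?x (2*i+s+2))))"
  have D: "q ^ m dvd D m" for m unfolding D_def mult.assoc by (intro dvd_mult2 le_imp_power_dvd) simp
  have DF: "D m * (1 + ?x ^ (m+1)) = F m" for m
    unfolding D_def F_def by (rule iv_mult_cancel) simp
  define w where "w = (\<lambda>i. q ^ ((i+1) * (2*i+1)) * ((1 - ?x ^ (i+1)) * U i))"
  have w: "q ^ ((i+1) * (i+1)) * (bailey_coeff ?x D i - bailey_coeff ?x D (Suc i)) = w i" for i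
  proof -
    have "?x ^ tri i = q ^ (i * (i+1))" by (simp only: power_mult[symmetric] two_tri)
    moreover have "q ^ ((i+1) * (i+1)) * q ^ (i * (i+1)) = q ^ ((i+1) * (2*i+1))"
      unfolding power_add[symmetric] by (rule arg_cong[of _ _ "\<lambda>k. q ^ k"]) (simp add: algebra_simps)
    ultimately show ?thesis
      unfolding bailey_coeff_diff1[of ?x D F, OF X_dvd(1) D DF] w_def U_def by (simp only: mult.assoc[symmetric])
  qed
  have rec: "w i = ?c * (q ^ tri (2*i+2) + q ^ tri (2*i+3)) + w (Suc i)" for i
  proof -
    have e1: "q ^ ((Suc i+1) * (2*Suc i+1)) = q ^ ((i+1) * (2*i+1)) * q ^ (4*i+5)"
      unfolding power_add[symmetric] by (rule arg_cong[of _ _ "\<lambda>k. q ^ k"]) (simp add: algebra_simps)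
    have "2 * tri (2*i+2) = 2 * ((i+1) * (2*i+1) + (2*i+2))" unfolding two_tri by (simp add: algebra_simps)
    then have t2: "tri (2*i+2) = (i+1) * (2*i+1) + (2*i+2)" by simp
    have e2: "q ^ ((i+1) * (2*i+1)) * q ^ (2*i+2) = q ^ tri (2*i+2)" unfolding power_add[symmetric] t2 ..
    have "tri (2*i+3) = tri (2*i+2) + (2*i+3)" using tri_Suc[of "2*i+2"] by (simp add: eval_nat_numeral)
    then have e3: "q ^ tri (2*i+3) = q ^ tri (2*i+2) * q ^ (2*i+3)" by (simp only: power_add)
    have e4: "Suc i + 1 = i + 2" by simp
    have r: "(1 - ?x ^ (i+1)) * U i - q ^ (4*i+5) * (1 - ?x ^ (i+2)) * U (Suc i) =
      q ^ (2*i+2) * (1 + q ^ (2*i+3)) * ?c" unfolding U_def F_def by (rule L7_recurrence)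
    have gen: "p * (a * u) = c * (p * t + p * t * t') + p * k * (b * u')"
      if "a * u - k * b * u' = t * (1 + t') * c" for p a u c t t' k b u' :: "int fps" using that by algebra
    show ?thesis unfolding w_def e1 e3 e2[symmetric] unfolding e4
      by (rule gen[OF r])
  qed
  have it: "w i = ?c * (\<Sum>k<n. q ^ tri (2*(i+k)+2) + q ^ tri (2*(i+k)+3)) + w (i+n)" for n
  proof (induction n)
    case (Suc n)
    then show ?case using rec[of "i+n"] by (simp add: algebra_simps)
  qed simp
  have "w i = ?c * fsum (\<lambda>k. q ^ tri (2*(i+k)+2) + q ^ tri (2*(i+k)+3))"
  proof (rule X_adic_eqI)
    fix N
    let ?h = "\<lambda>k. q ^ tri (2*(i+k)+2) + q ^ tri (2*(i+k)+3)"
    have h: "q ^ k dvd ?h k" for k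
      by (intro dvd_add le_imp_power_dvd order_trans[OF _ le_tri]) simp_all
    have "q ^ N dvd w (i+N)" unfolding w_def by (intro dvd_mult2 le_imp_power_dvd) (simp add: algebra_simps)
    then have "q ^ N dvd w i - ?c * (\<Sum>r<N. ?h r)" using it[of N] by simp
    moreover have "q ^ N dvd ?c * fsum ?h - ?c * (\<Sum>r<N. ?h r)" by (rule fsum_approx_mult[OF h order_refl])
    ultimately show "q ^ N dvd w i - ?c * fsum ?h" by (meson dvd_diff_sym dvd_diff_trans)
  qed
  then show ?thesis using w[of i] by simp
qed

lemma euler_minus: "euler q * qpoch_inf (- q) q = euler (q^2)"
  by (rule qpoch_inf_mult_minus) simp_all

text \<open>Unless 3 divides the weight \<open>i+1\<close>, the square \<open>(i+1)^2\<close> is 1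
  modulo 3, so multiplication by \<open>q ^ ((i+1) * (i+1))\<close> carries class 1 to class 2,
  which triangular numbers avoid.\<close>

lemma vanishes_L7: "vanishes 3 3 1 (fsum (\<lambda>m. term_L7 (Suc m)))"
proof -
  let ?x = "q^2"
  let ?D = "\<lambda>m. q ^ (2*m+2) * qpoch q q (2*m+1) * iv (1 + ?x ^ (m+1))"
  let ?I = "iv (euler ?x)" and ?K = "qpoch_inf (- q) q * (iv (euler (q^2)))^2"
  let ?d = "\<lambda>i. bailey_coeff ?x ?D i - bailey_coeff ?x ?D (Suc i)"
  have D: "q ^ m dvd ?D m" for m unfolding mult.assoc by (intro dvd_mult2 le_imp_power_dvd) simp
  have dd: "q ^ i dvd ?d i" for i
    by (intro dvd_diff dvd_bailey_coeff dvd_trans[OF le_imp_power_dvd dvd_bailey_coeff[of ?x "Suc i"]]) simp_all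
  have "fsum (\<lambda>m. term_L7 (Suc m)) = ?K * fsum (\<lambda>m. ?D m * ((qpoch ?x ?x m)^2 * rq ?x (2*m+1)))"
    unfolding term_L7_eq by (intro fsum_mult_left dvd_mult2 D)
  also have "\<dots> = ?K * fsum (\<lambda>i. (-1) ^ i * of_nat (i+1) * ?d i)"
    unfolding bailey_sum_odd[of ?x ?D, OF X_dvd(1,3) D] fsum_abel(1)[of "bailey_coeff ?x ?D", OF dvd_bailey_coeff[OF X_dvd(1)]] ..
  also have "\<dots> = fsum (\<lambda>i. ?K * ((-1) ^ i * of_nat (i+1) * ?d i))"
    by (intro fsum_mult_left[symmetric] dvd_mult dd)
  also have "\<dots> = fsum (\<lambda>i. (-1) ^ i * of_nat (i+1) * (?K * ?d i))"
    by (rule fsum_cong) (simp only: mult_ac)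
  also have "vanishes 3 3 1 \<dots>"
  proof (intro vanishes_fsum vanishes_coeff_mult)
    fix i
    show "vanishes 3 3 1 (?K * ?d i) \<or> 3 dvd int (i+1)"
    proof (cases "i mod 3 = 2")
      case True
      then show ?thesis by (intro disjI2) presburger
    next
      case False
      have "euler q * qpoch_inf (- q) q * ?I = 1"
        unfolding euler_minus by (rule iv_mult_self) (simp add: qpoch_inf_nth_0)
      moreover have "M * (W * I^2 * d) = I ^ 3 * S" if "M * d = E * I^2 * S" "E * W * I = 1" for M W I d E S :: "int fps"
        using that by algebra
      ultimately have "q ^ ((i+1) * (i+1)) * (?K * ?d i) = ?I ^ 3 * fsum (\<lambda>k. q ^ tri (2*(i+k)+2) + q ^ tri (2*(i+k)+3))"
        using L7_differences[of i] by blast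
      moreover have "vanishes 3 3 2 (?I ^ 3 * fsum (\<lambda>k. q ^ tri (2*(i+k)+2) + q ^ tri (2*(i+k)+3)))"
        by (intro vanishes_mult[OF _ lacunary_cube] vanishes_fsum vanishes_add vanishes_X_power) (simp_all add: tri_mod_3)
      ultimately have "vanishes 3 3 2 (q ^ ((i+1) * (i+1)) * (?K * ?d i))" by simp
      moreover have "((i+1) * (i+1)) mod 3 = 1"
      proof -
        have "((i+1) * (i+1)) mod 3 = (((i+1) mod 3) * ((i+1) mod 3)) mod 3" by (simp only: mod_mult_eq)
        moreover have "(i+1) mod 3 = 1 \<or> (i+1) mod 3 = 2" using False by presburger
        ultimately show ?thesis by auto
      qed
      moreover have "(n + e) mod 3 = 2" if "n mod 3 = 1" "e mod 3 = 1" for n e :: nat using that by presburger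
      ultimately have "vanishes 3 3 1 (?K * ?d i)"
        using vanishes_X_power_mult_cancel by blast
      then show ?thesis ..
    qed
  qed
  finally show ?thesis .
qed


section \<open>spt_G1: first differences by the q-Gauss sum\<close>

lemma fsum_gauss_mult:
  assumes "\<And>s. T s = C * gauss_term x z u v s" "q dvd z" "q dvd u" "q dvd v"
  shows "fsum T = C * fsum (gauss_term x z u v)"
  unfolding fsum_mult_left[OF dvd_gauss_term[OF assms(2-4)], symmetric] using assms(1) by (rule fsum_cong)

lemma qpoch_inf_zero: "q dvd x \<Longrightarrow> qpoch_inf 0 x = 1"
proof (rule qpoch_inf_eqI)
  show "\<exists>M\<ge>N. q ^ N dvd 1 - qpoch 0 x M" for N by (intro exI[of _ N]) (simp add: qpoch_def)
qed simp_all

text \<open>\<open>F\<close> differs from its counterpart for spt_L7 only by a power of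
  \<open>q\<close>, but here the argument is exactly \<open>c/(a*b) = q\<close>. The q-Gauss sum
  applies and its infinite products cancel completely.\<close>

lemma G1_differences:
  fixes i :: nat
  defines "D \<equiv> \<lambda>m. q ^ (m+1) * qpoch q q (2*m+1) * iv (1 + (q^2) ^ (m+1))"
  shows "bailey_coeff (q^2) D i - bailey_coeff (q^2) D (Suc i) = q ^ ((i+1) * (i+1))"
proof -
  let ?x = "q^2" and ?E = "euler (q^2)" and ?O = "qpoch_inf q (q^2)"
  define F where "F = (\<lambda>m. q ^ (m+1) * qpoch q q (2*m+1))"
  have D: "q ^ m dvd D m" for m unfolding D_def mult.assoc by (intro dvd_mult2 le_imp_power_dvd) simp
  have DF: "D m * (1 + ?x ^ (m+1)) = F m" for m
    unfolding D_def F_def by (rule iv_mult_cancel) simp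
  \<comment> \<open>Coefficients of \<open>q * (1 - q^(2i+2) * Y) * (1 - q^(2i+3) * Y) = q - u*Y +
    v*Y^2\<close>, the ratio of consecutive values of \<open>F\<close> for
    \<open>Y = (q^2)^k\<close>. The coefficient \<open>v = q^(4i+6)\<close> is also the denominator
    parameter of \<open>rq (q^2) (2*i+s+2)\<close>.\<close>
  let ?u = "q ^ (2*i+3) + q ^ (2*i+4)" and ?v = "?x ^ (2*i+3)"
  let ?C = "q ^ (i+1) * qpoch q q (2*i+1) * rq ?x (2*i+2)"
  let ?G = "fsum (gauss_term ?x q ?u ?v)"
  have prod: "F (i + s) = q ^ (i+1) * qpoch q q (2*i+1) * (\<Prod>k<s. q - ?u * ?x ^ k + ?v * ?x ^ (2*k))" for s
  proof (induction s)
    case 0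
    then show ?case by (simp add: F_def)
  next
    case (Suc s)
    have "2*(i + Suc s)+1 = Suc (Suc (2*(i+s)+1))" by simp
    then have P: "qpoch q q (2*(i + Suc s)+1) = qpoch q q (2*(i+s)+1) * (1 - q * q ^ (2*(i+s)+1)) * (1 - q * q ^ Suc (2*(i+s)+1))"
      by (simp only: qpoch_Suc)
    have p: "q * q ^ (2*(i+s)+1) = q^2 * (q ^ i)^2 * (q ^ s)^2" "q * q ^ Suc (2*(i+s)+1) = q ^ 3 * (q ^ i)^2 * (q ^ s)^2"
      "q ^ (i + Suc s + 1) = q * q ^ (i + s + 1)"
      "q ^ (2*i+3) = q ^ 3 * (q ^ i)^2" "q ^ (2*i+4) = q ^ 4 * (q ^ i)^2" "?v = q ^ 6 * (q ^ i) ^ 4"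
      "?x ^ s = (q ^ s)^2" "?x ^ (2 * s) = (q ^ s) ^ 4"
      by (simp_all add: mult_2 power_add power2_eq_square power_mult_distrib eval_nat_numeral mult_ac)
    have gen: "y * Q * (P * (1 - y^2 * a^2 * b^2) * (1 - y ^ 3 * a^2 * b^2)) =
      Q * P * (y - (y ^ 3 * a^2 + y ^ 4 * a^2) * b^2 + y ^ 6 * a ^ 4 * b ^ 4)" for y Q P a b :: "int fps"
      by algebra
    have "F (i + Suc s) = F (i + s) * (q - ?u * ?x ^ s + ?v * ?x ^ (2 * s))"
      unfolding F_def P unfolding p by (rule gen)
    then show ?case unfolding Suc by simp
  qed
  have T: "F (i + s) * (rq ?x s * rq ?x (2*i+s+2)) = ?C * gauss_term ?x q ?u ?v s" for s
  proof -
    have "2*i+s+2 = (2*i+2) + s" "Suc (2*i+2) = 2*i+3" by simp_all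
    then have "rq ?x (2*i+s+2) = rq ?x (2*i+2) * iv (qpoch ?v ?x s)"
      using rq_add[of ?x "2*i+2" s] by (simp only: X_dvd)
    then show ?thesis unfolding prod gauss_term_def by (simp only: mult_ac)
  qed
  have dv: "q dvd ?u" "q dvd ?v" by (simp_all add: power_mult[symmetric])
  have S: "fsum (\<lambda>s. F (i + s) * (rq ?x s * rq ?x (2*i+s+2))) = ?C * ?G"
    by (rule fsum_gauss_mult[OF T dvd_refl dv])
  have G: "?G * qpoch_inf ?v ?x * ?O = qpoch_inf (q ^ (2*i+3)) q"
  proof (rule q_gauss_sum[OF X_dvd(1) dvd_refl dv])
    fix N
    have "(\<Prod>k<N. 1 - ?u * ?x ^ k + ?v * q * ?x ^ (2*k)) = (\<Prod>k<N. (1 - q ^ (2*i+3) * ?x ^ k) * (1 - q ^ (2*i+3) * q * ?x ^ k))"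
    proof (intro prod.cong refl)
      fix k
      have p: "q ^ (2*i+3) = q ^ 3 * (q ^ i)^2" "q ^ (2*i+4) = q ^ 4 * (q ^ i)^2" "?v = q ^ 6 * (q ^ i) ^ 4"
        "?x ^ k = (q ^ k)^2" "?x ^ (2*k) = (q ^ k) ^ 4"
        by (simp_all add: mult_2 power_add power2_eq_square power_mult_distrib eval_nat_numeral mult_ac)
      have gen: "1 - (y ^ 3 * a^2 + y ^ 4 * a^2) * b^2 + y ^ 6 * a ^ 4 * y * b ^ 4 = (1 - y ^ 3 * a^2 * b^2) * (1 - y ^ 3 * a^2 * y * b^2)"
        for y a b :: "int fps" by algebra
      show "1 - ?u * ?x ^ k + ?v * q * ?x ^ (2*k) = (1 - q ^ (2*i+3) * ?x ^ k) * (1 - q ^ (2*i+3) * q * ?x ^ k)"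
        unfolding p by (rule gen)
    qed
    also have "\<dots> = qpoch (q ^ (2*i+3)) q (2*N)" unfolding prod.distrib qpoch_bisect unfolding qpoch_def ..
    finally have e: "(\<Prod>k<N. 1 - ?u * ?x ^ k + ?v * q * ?x ^ (2*k)) = qpoch (q ^ (2*i+3)) q (2*N)" .
    show "q ^ N dvd qpoch_inf (q ^ (2*i+3)) q - (\<Prod>k<N. 1 - ?u * ?x ^ k + ?v * q * ?x ^ (2*k))"
      unfolding e by (rule qpoch_inf_approx) simp_all
  qed
  have E: "?E = qpoch ?x ?x (2*i+2) * qpoch_inf ?v ?x"
  proof -
    have "?x * ?x ^ (2*i+2) = ?v" unfolding power_Suc[symmetric] by (rule arg_cong[of _ _ "\<lambda>k. ?x ^ k"]) simp
    then show ?thesis using qpoch_inf_split[of ?x ?x "2*i+2"] by (simp only: X_dvd)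
  qed
  have E1: "euler q = qpoch q q (2*i+1) * (1 - ?x ^ (i+1)) * qpoch_inf (q ^ (2*i+3)) q"
  proof -
    have "q * q ^ (2*i+1) = q ^ (2 * (i+1))" "q * q ^ (2*i+2) = q ^ (2*i+3)"
      unfolding power_Suc[symmetric] by (rule arg_cong[of _ _ "\<lambda>k. q ^ k"], simp)+
    then show ?thesis using qpoch_inf_split[of q q "2*i+2"] qpoch_Suc[of q q "2*i+1"] by (simp only: X_sq_power) simp
  qed
  have t: "?x ^ tri i * q ^ (i+1) = q ^ ((i+1) * (i+1))"
    unfolding power_mult[symmetric] two_tri power_add[symmetric] by (rule arg_cong[of _ _ "\<lambda>k. q ^ k"]) simp
  let ?d = "?x ^ tri i * (1 - ?x ^ (i+1)) * (?C * ?G)"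
  have gen: "t * w * (y * p * r * g) * (e * W) = M * (W * e)"
    if "g * v * W = P" "e = k * v" "W * e = p * w * P" "t * y = M" "k * r = 1" for t w y p r g e W M P v k :: "int fps"
  proof -
    have "t * w * (y * p * r * g) * (e * W) = (t * y) * (k * r) * (p * w * (g * v * W))"
      unfolding that(2) by (simp only: mult_ac)
    also have "\<dots> = M * (p * w * P)" by (simp only: that(1,4,5) mult_1_right)
    finally show ?thesis unfolding that(3) .
  qed
  have "?d * (?E * ?O) = q ^ ((i+1) * (i+1)) * (?O * ?E)"
    by (rule gen[OF G E E1[unfolded euler_1] t qpoch_rq]) simp
  moreover have "?E * ?O \<noteq> 0" using qpoch_inf_nth_0[of ?x ?x] qpoch_inf_nth_0[of q ?x] by auto
  ultimately have "?d = q ^ ((i+1) * (i+1))" by (simp add: mult.commute)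
  then show ?thesis unfolding bailey_coeff_diff1[of ?x D F, OF X_dvd(1) D DF] S .
qed

text \<open>The constant \<open>1/(E(q) E(q^2))\<close> is no cube. Gauss's
  \<open>psi(q) = E(q^2)^2 / E(q)\<close> rewrites it as \<open>psi(q) / E(q^2)^3\<close>, at the
  price of a factor whose exponents are triangular.\<close>

lemma fsum_G1: "fsum (\<lambda>m. term_G1 (Suc m)) = iv (euler (q^2)) ^ 3 *
  fsum (\<lambda>i. (-1) ^ i * of_nat (i+1) * (q ^ ((i+1) * (i+1)) * fsum (\<lambda>k. q ^ tri k)))"
proof -
  let ?x = "q^2"
  let ?D = "\<lambda>m. q ^ (m+1) * qpoch q q (2*m+1) * iv (1 + ?x ^ (m+1))"
  let ?E = "euler ?x" and ?E1 = "euler q"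
  let ?S = "fsum (\<lambda>i. (-1) ^ i * of_nat (i+1) * q ^ ((i+1) * (i+1)))" and ?psi = "fsum (\<lambda>k. q ^ tri k)"
  have D: "q ^ m dvd ?D m" for m unfolding mult.assoc by (intro dvd_mult2 le_imp_power_dvd) simp
  have "fsum (\<lambda>m. term_G1 (Suc m)) = iv ?E * iv ?E1 * fsum (\<lambda>m. ?D m * ((qpoch ?x ?x m)^2 * rq ?x (2*m+1)))"
    unfolding term_G1_eq by (intro fsum_mult_left dvd_mult2 D)
  also have "\<dots> = iv ?E * iv ?E1 * ?S"
    unfolding bailey_sum_odd[of ?x ?D, OF X_dvd(1,3) D] fsum_abel(1)[of "bailey_coeff ?x ?D", OF dvd_bailey_coeff[OF X_dvd(1)]]
      G1_differences ..
  also have "\<dots> = iv ?E ^ 3 * (?psi * ?S)"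
  proof -
    have "?psi = (qpoch_inf (- q) q)^2 * ?E1" by (rule gauss_psi) simp_all
    moreover have "?E * iv ?E = 1" "?E1 * iv ?E1 = 1" by (simp_all add: iv_mult_self qpoch_inf_nth_0)
    moreover have "I * J * S = I ^ 3 * (P * S)" if "P = M^2 * e" "e * M = E" "E * I = 1" "e * J = 1" for I J S P M e E :: "int fps"
      using that by algebra
    ultimately show ?thesis using euler_minus by blast
  qed
  also have "?psi * ?S = fsum (\<lambda>i. ?psi * ((-1) ^ i * of_nat (i+1) * q ^ ((i+1) * (i+1))))"
    by (intro fsum_mult_left[symmetric] dvd_mult le_imp_power_dvd) simp
  also have "\<dots> = fsum (\<lambda>i. (-1) ^ i * of_nat (i+1) * (q ^ ((i+1) * (i+1)) * ?psi))"
    by (rule fsum_cong) (simp only: mult_ac)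
  finally show ?thesis .
qed

lemma vanishes_psi: "vanishes p 3 2 (fsum (\<lambda>k. q ^ tri k))"
  by (intro vanishes_fsum vanishes_X_power) (simp add: tri_mod_3)

text \<open>If 3 does not divide the weight \<open>i+1\<close>, then \<open>(i+1)^2\<close> is 1
  modulo 3, and total exponent 0 would require a triangular number congruent to 2.\<close>

lemma vanishes_G1: "vanishes 3 3 0 (fsum (\<lambda>m. term_G1 (Suc m)))"
  unfolding fsum_G1
proof (intro vanishes_mult[OF _ lacunary_cube] vanishes_fsum vanishes_coeff_mult)
  fix i
  show "vanishes 3 3 0 (q ^ ((i+1) * (i+1)) * fsum (\<lambda>k. q ^ tri k)) \<or> 3 dvd int (i+1)"
  proof (cases "i mod 3 = 2")
    case True
    then show ?thesis by (intro disjI2) presburger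
  next
    case False
    have "((i+1) * (i+1)) mod 3 = (((i+1) mod 3) * ((i+1) mod 3)) mod 3" by (simp only: mod_mult_eq)
    moreover have "(i+1) mod 3 = 1 \<or> (i+1) mod 3 = 2" using False by presburger
    ultimately have "((i+1) * (i+1)) mod 3 = 1" by auto
    moreover have "n mod 3 = 2" if "(n + e) mod 3 = 0" "e mod 3 = 1" for n e :: nat using that by presburger
    ultimately show ?thesis using vanishes_X_power_mult[OF vanishes_psi] by blast
  qed
qed

section \<open>spt_G2: second differences by the q-Gauss sum\<close>

lemma term_G2_eq:
  "term_G2 (Suc m) = iv (euler q) * iv (qpoch_inf (- q) (q^2)) *
    (q ^ (m+1) * qpoch (- q) (q^2) (m+1) * iv (1 - q ^ (2*m+2)) * ((qpoch q q m)^2 * rq q (2*m+1)))"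
proof -
  let ?E = "euler q"
  have e: "q ^ (2 * Suc m + 1) = q * q ^ (2*m+2)" "q ^ Suc m = q * q ^ m" by simp_all
  have "2 * Suc m + 1 = Suc (2 * (m+1))" by simp
  then have "- (q ^ (2 * Suc m + 1)) = - q * (q^2) ^ (m+1)" by (simp only: power_Suc power_mult mult_minus_left)
  then have 1: "iv (qpoch_inf (- (q ^ (2 * Suc m + 1))) (q^2)) = qpoch (- q) (q^2) (m+1) * iv (qpoch_inf (- q) (q^2))"
    by (simp only: iv_qpoch_inf_shift X_dvd)
  have 2: "qpoch_inf (q * q ^ (2*m+2)) q = ?E * rq q (2*m+2)" by (simp only: qpoch_inf_shift dvd_refl rq_def)
  have 3: "iv ((qpoch_inf (q ^ Suc m) q)^2) = (qpoch q q m * iv ?E)^2"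
    unfolding e by (simp add: iv_power qpoch_inf_nth_0 iv_qpoch_inf_shift)
  have 4: "rq q (2*m+1) = rq q (2*m+2) * (1 - q ^ (2*m+2))" using rq_Suc[of q "2*m+1"] by simp
  have n0: "fps_nth ((qpoch_inf (q ^ Suc m) q)^2) 0 = 1" "fps_nth (qpoch_inf (- (q ^ (2 * Suc m + 1))) (q^2)) 0 = 1"
    by (simp_all add: fps_power_zeroth qpoch_inf_nth_0)
  have gen: "(qm * (e * r)) * ((p * I)^2 * (P * J)) = I * J * (qm * P * k * (p^2 * (r * w)))" if "e * I = 1" "w * k = 1"
    for qm e r p I P J k w :: "int fps"
    using that by algebra
  have "?E * iv ?E = 1" "(1 - q ^ (2*m+2)) * iv (1 - q ^ (2*m+2)) = 1"
    by (simp_all add: iv_mult_self qpoch_inf_nth_0)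
  note G = gen[OF this]
  have m: "Suc m = m+1" by simp
  show ?thesis unfolding term_G2_def fps_quot_eq_iv iv_mult[OF n0] 1 3 unfolding e(1) 2 4 unfolding m by (rule G)
qed

text \<open>The denominator \<open>1 - q^(2m+2)\<close> comes from lowering
  \<open>(q;q)_(2m+2)\<close> to \<open>(q;q)_(2m+1)\<close>, and the second difference removes it.
  The remaining \<open>F\<close> has ratio \<open>q + q^(2m+4)\<close>, so the q-Gauss sum applies
  with \<open>z = q\<close>, \<open>u = 0\<close>, that is \<open>a = -b\<close> with
  \<open>a^2\<close> an odd power of \<open>q\<close> up to sign.\<close>

lemma G2_differences:
  fixes i :: nat
  defines "D \<equiv> \<lambda>m. q ^ (m+1) * qpoch (- q) (q^2) (m+1) * iv (1 - q ^ (2*m+2))"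
  shows "iv (euler q) * iv (qpoch_inf (- q) (q^2)) * (bailey_coeff q D i - bailey_coeff q D (Suc (Suc i))) =
    iv (euler q) ^ 3 * ((1 - q ^ (2*i+3)) * iv (1 + q ^ (2*i+3)) * q ^ tri (Suc i))"
proof -
  let ?x = "q^2" and ?E = "euler q" and ?N = "qpoch_inf (- q) (q^2)"
  define F where "F = (\<lambda>m. q ^ (m+1) * qpoch (- q) ?x (m+1))"
  have D: "q ^ m dvd D m" for m unfolding D_def mult.assoc by (intro dvd_mult2 le_imp_power_dvd) simp
  have DF: "D m * (1 - q ^ (2*m+2)) = F m" for m
    unfolding D_def F_def by (rule iv_mult_cancel) simp
  let ?v = "q ^ (2*i+4)"
  let ?C = "q ^ (i+1) * qpoch (- q) ?x (i+1) * rq q (2*i+3)"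
  let ?G = "fsum (gauss_term q q 0 ?v)"
  have prod: "F (i + s) = q ^ (i+1) * qpoch (- q) ?x (i+1) * (\<Prod>k<s. q - 0 * q ^ k + ?v * q ^ (2*k))" for s
  proof (induction s)
    case 0
    then show ?case by (simp add: F_def)
  next
    case (Suc s)
    have P: "qpoch (- q) ?x (i + Suc s + 1) = qpoch (- q) ?x (i + s + 1) * (1 - (- q) * ?x ^ (i + s + 1))"
      using qpoch_Suc[of "- q" ?x "i + s + 1"] by simp
    have p: "?x ^ (i + s + 1) = q^2 * (q ^ i)^2 * (q ^ s)^2" "q ^ (i + Suc s + 1) = q * q ^ (i + s + 1)"
      "?v = q ^ 4 * (q ^ i)^2" "q ^ (2 * s) = (q ^ s)^2"
      by (simp_all add: mult_2 power_add power2_eq_square power_mult_distrib eval_nat_numeral mult_ac)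
    have gen: "y * Q * (P * (1 - (- y) * (y^2 * a^2 * b^2))) =
      Q * P * (y - 0 * z + y ^ 4 * a^2 * b^2)" for y Q P a b z :: "int fps"
      by algebra
    have "F (i + Suc s) = F (i + s) * (q - 0 * q ^ s + ?v * q ^ (2 * s))"
      unfolding F_def P unfolding p by (rule gen)
    then show ?case unfolding Suc by simp
  qed
  have T: "F (i + s) * (rq q s * rq q (2*i+s+3)) = ?C * gauss_term q q 0 ?v s" for s
  proof -
    have "2*i+s+3 = (2*i+3) + s" "Suc (2*i+3) = 2*i+4" by simp_all
    then have "rq q (2*i+s+3) = rq q (2*i+3) * iv (qpoch ?v q s)"
      using rq_add[of q "2*i+3" s] by (simp only: dvd_refl)
    then show ?thesis unfolding prod gauss_term_def by (simp only: mult_ac)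
  qed
  have dv: "q dvd 0" "q dvd ?v" by simp_all
  have S: "fsum (\<lambda>s. F (i + s) * (rq q s * rq q (2*i+s+3))) = ?C * ?G"
    by (rule fsum_gauss_mult[OF T dvd_refl dv])
  have G: "?G * qpoch_inf ?v q * ?E = qpoch_inf (- (q ^ (2*i+5))) ?x"
  proof (rule q_gauss_sum[OF dvd_refl dvd_refl dv])
    fix N
    have "(\<Prod>k<N. 1 - 0 * q ^ k + ?v * q * q ^ (2*k)) = qpoch (- (q ^ (2*i+5))) ?x N"
      unfolding qpoch_def
    proof (intro prod.cong refl)
      fix k
      have "?v * q = q ^ (2*i+5)" by (simp add: eval_nat_numeral mult_ac)
      then show "1 - 0 * q ^ k + ?v * q * q ^ (2*k) = 1 - - (q ^ (2*i+5)) * ?x ^ k"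
        by (simp only: power_mult) simp
    qed
    then show "q ^ N dvd qpoch_inf (- (q ^ (2*i+5))) ?x - (\<Prod>k<N. 1 - 0 * q ^ k + ?v * q * q ^ (2*k))"
      by (simp only:) (rule qpoch_inf_approx; simp)
  qed
  have E: "?E = qpoch q q (2*i+3) * qpoch_inf ?v q"
  proof -
    have "q * q ^ (2*i+3) = ?v" unfolding power_Suc[symmetric] by (rule arg_cong[of _ _ "\<lambda>k. q ^ k"]) simp
    then show ?thesis using qpoch_inf_split[of q q "2*i+3"] by (simp only: dvd_refl)
  qed
  have N: "?N = qpoch (- q) ?x (i+1) * (1 + q ^ (2*i+3)) * qpoch_inf (- (q ^ (2*i+5))) ?x"
  proof -
    have "- q * ?x ^ (i+1) = - (q ^ (2*i+3))" "- q * ?x ^ (i+2) = - (q ^ (2*i+5))"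
      by (simp_all add: mult_2 power_add power_mult_distrib power2_eq_square eval_nat_numeral mult_ac)
    then have "qpoch (- q) ?x (i+2) = qpoch (- q) ?x (i+1) * (1 + q ^ (2*i+3))"
      "?N = qpoch (- q) ?x (i+2) * qpoch_inf (- (q ^ (2*i+5))) ?x"
      using qpoch_Suc[of "- q" ?x "i+1"] qpoch_inf_split[of "- q" ?x "i+2"] by simp_all
    then show ?thesis by simp
  qed
  have t: "q ^ tri i * q ^ (i+1) = q ^ tri (Suc i)" unfolding power_add[symmetric] by (simp add: tri_Suc)
  have inv: "?E * iv ?E = 1" "?N * iv ?N = 1" "(1 + q ^ (2*i+3)) * iv (1 + q ^ (2*i+3)) = 1"
    by (simp_all add: iv_mult_self qpoch_inf_nth_0)
  have gen: "I * J * (t * w * (y * p * r * g)) = I ^ 3 * (w * l * M)"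
    if "g * v * E = P" "E = k * v" "W = p * z * P" "t * y = M" "k * r = 1" "E * I = 1" "W * J = 1" "z * l = 1"
    for I J t w y p r g l M v E P k W z :: "int fps"
  proof -
    have "I * J * (t * w * (y * p * r * g)) = I * J * ((t * y) * w * p * r * g) * (E * I) * (E * I) * (z * l)"
      unfolding that(6,8) by (simp only: mult_1_right) (simp only: mult_ac)
    also have "\<dots> = I ^ 3 * J * M * w * l * (p * z * ((r * E) * g * E))"
      unfolding that(4) by (simp only: power3_eq_cube mult_ac)
    also have "r * E = v" using that(2,5) by (simp add: mult.commute mult.left_commute)
    also have "v * g * E = P" using that(1) by (simp only: mult_ac)
    also have "I ^ 3 * J * M * w * l * (p * z * P) = I ^ 3 * (w * l * M) * (W * J)"
      unfolding that(3) by (simp only: mult_ac)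
    finally show ?thesis unfolding that(7) by simp
  qed
  show ?thesis unfolding bailey_coeff_diff2[of q D F, OF dvd_refl D DF] S
    by (rule gen[OF G E N t qpoch_rq[OF dvd_refl] inv])
qed

text \<open>The weight \<open>tri (i+1)\<close> is a multiple of 3 unless \<open>i+1\<close> is 1
  modulo 3. In that case 3 divides \<open>2*i+3\<close>, so the rational factor is a series in
  \<open>q^3\<close>, and \<open>tri (i+1)\<close> is 1 modulo 3; only class 1 survives.\<close>

lemma vanishes_G2: assumes "a = 0 \<or> a = 2" shows "vanishes 3 3 a (fsum (\<lambda>m. term_G2 (Suc m)))"
proof -
  let ?D = "\<lambda>m. q ^ (m+1) * qpoch (- q) (q^2) (m+1) * iv (1 - q ^ (2*m+2))"
  let ?K = "iv (euler q) * iv (qpoch_inf (- q) (q^2))"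
  let ?d = "\<lambda>i. bailey_coeff q ?D i - bailey_coeff q ?D (Suc (Suc i))"
  have D: "q ^ m dvd ?D m" for m unfolding mult.assoc by (intro dvd_mult2 le_imp_power_dvd) simp
  have dd: "q ^ i dvd ?d i" for i
    by (intro dvd_diff dvd_bailey_coeff dvd_trans[OF le_imp_power_dvd dvd_bailey_coeff[of q "Suc (Suc i)"]]) simp_all
  have "fsum (\<lambda>m. term_G2 (Suc m)) = ?K * fsum (\<lambda>m. ?D m * ((qpoch q q m)^2 * rq q (2*m+1)))"
    unfolding term_G2_eq by (intro fsum_mult_left dvd_mult2 D)
  also have "\<dots> = ?K * fsum (\<lambda>i. (-1) ^ i * of_nat (tri (Suc i)) * ?d i)"
    unfolding bailey_sum_odd[of q ?D, OF dvd_refl fps_X_neq_zero D] fsum_abel(2)[of "bailey_coeff q ?D", OF dvd_bailey_coeff[OF dvd_refl]] ..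
  also have "\<dots> = fsum (\<lambda>i. ?K * ((-1) ^ i * of_nat (tri (Suc i)) * ?d i))"
    by (intro fsum_mult_left[symmetric] dvd_mult dd)
  also have "\<dots> = fsum (\<lambda>i. (-1) ^ i * of_nat (tri (Suc i)) * (?K * ?d i))"
    by (rule fsum_cong) (simp only: mult_ac)
  also have "vanishes 3 3 a \<dots>"
  proof (intro vanishes_fsum vanishes_coeff_mult)
    fix i
    show "vanishes 3 3 a (?K * ?d i) \<or> 3 dvd int (tri (Suc i))"
    proof (cases "Suc i mod 3 = 1")
      case False
      then have "tri (Suc i) mod 3 = 0" using tri_mod_3[of "Suc i"] by simp
      then show ?thesis by (intro disjI2) presburger
    next
      case True
      then have t: "tri (Suc i) mod 3 \<noteq> a" using tri_mod_3[of "Suc i"] assms by auto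
      have "3 dvd 2*i+3" using True by presburger
      then obtain j where j: "2*i+3 = 3 * j" by (rule dvdE)
      have l: "lacunary 3 3 (1 - q ^ (2*i+3))" "lacunary 3 3 (1 + q ^ (2*i+3))"
        unfolding j by (auto simp: lacunary_def)
      have "vanishes 3 3 a (iv (euler q) ^ 3 * ((1 - q ^ (2*i+3)) * iv (1 + q ^ (2*i+3)) * q ^ tri (Suc i)))"
        by (intro vanishes_mult[OF _ lacunary_cube] vanishes_mult[OF vanishes_X_power[OF t]] lacunary_mult lacunary_iv l) simp
      then show ?thesis unfolding G2_differences by blast
    qed
  qed
  finally show ?thesis .
qed


section \<open>spt_L12: a second-order recurrence and its factorization\<close>

lemma iv_qpoch_minus_sq:
  "iv (qpoch (- q) (q^2) (m+1)) = qpoch q (q^2) (m+1) * qpoch ((q^2)^2) ((q^2)^2) m * rq (q^2) (2*m+1)"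
proof -
  let ?x = "q^2"
  have "1 * iv (qpoch (- q) ?x (m+1)) = qpoch q ?x (m+1) * qpoch (?x^2) (?x^2) m * rq ?x (2*m+1)"
    unfolding rq_def
  proof (rule iv_swap)
    have "?x * ?x = ?x^2" by (simp only: power2_eq_square)
    then have "qpoch ?x ?x (2*m+1) = qpoch ?x (?x^2) (m+1) * qpoch (?x^2) (?x^2) m"
      using qpoch_odd[of ?x ?x m] by (simp only:)
    then show "1 * qpoch ?x ?x (2*m+1) = qpoch q ?x (m+1) * qpoch (?x^2) (?x^2) m * qpoch (- q) ?x (m+1)"
      unfolding qpoch_mult_minus[symmetric] by (simp only: mult_ac mult_1_left)
  qed (simp_all add: qpoch_nth_0)
  then show ?thesis by simp
qed

lemma term_L12_eq:
  "term_L12 (Suc m) = (qpoch_inf (- q) (q^2))^2 * (iv (euler (q^2)))^2 *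
    (q ^ (2*m+2) * qpoch q (q^2) (m+1) * qpoch ((q^2)^2) ((q^2)^2) m * iv (qpoch (- q) (q^2) (m+2)) *
      ((qpoch (q^2) (q^2) m)^2 * rq (q^2) (2*m+1)))"
proof -
  have "- (q ^ (2 * Suc m + 1)) = - q * (q^2) ^ (m+1)" "- (q ^ (2 * Suc m + 3)) = - q * (q^2) ^ (m+2)"
    by (simp_all add: mult_2 power_add power_mult_distrib power2_eq_square eval_nat_numeral mult_ac)
  then have 1: "qpoch_inf (- (q ^ (2 * Suc m + 1))) (q^2) = qpoch_inf (- q) (q^2) * iv (qpoch (- q) (q^2) (m+1))"
    "qpoch_inf (- (q ^ (2 * Suc m + 3))) (q^2) = qpoch_inf (- q) (q^2) * iv (qpoch (- q) (q^2) (m+2))"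
    by (simp_all only: qpoch_inf_shift X_dvd)
  have e: "2 * Suc m = 2*m+2" by simp
  have gen: "(qm * ((W * (P * J * R)) * (W * n))) * (p * I)^2 = W^2 * I^2 * (qm * P * J * n * (p^2 * R))" for qm W P J R n p I :: "int fps"
    by algebra
  show ?thesis unfolding term_L12_def fps_quot_eq_iv 1 iv_qpoch_inf_even iv_qpoch_minus_sq unfolding e by (rule gen)
qed

text \<open>The kernel is a 3-phi-2 series, outside the reach of the q-Gauss sum, but creative
  telescoping gives a recurrence of order two. The powers of \<open>q^2\<close> in its coefficients
  are the inverse ratios of the factor \<open>x ^ tri i\<close> read as growth, chosen so that
  \<open>bailey_coeff\<close> obeys it with the coefficients \<open>q\<close>,
  \<open>- (1 + q^2)\<close>, \<open>q\<close>.\<close>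

lemma L12_recurrence:
  fixes i :: nat
  defines "D \<equiv> \<lambda>m. q ^ (2*m+2) * qpoch q (q^2) (m+1) * qpoch ((q^2)^2) ((q^2)^2) m * iv (qpoch (- q) (q^2) (m+2))"
  defines "g \<equiv> \<lambda>i. fsum (\<lambda>s. D (i + s) * (rq (q^2) s * rq (q^2) (2*i+s+1)))"
  shows "q * g i + (- ((1 + q^2) * (q^2) ^ (i+1))) * g (Suc i) + q * (q^2) ^ (2*i+3) * g (Suc (Suc i)) =
    q ^ (2*i+3) * (qpoch_inf q (q^2) * euler ((q^2)^2) * iv (qpoch_inf (- q) (q^2)) *
      (iv (euler (q^2)) * iv (euler (q^2))))"
  unfolding g_def
proof (rule fsum_combine3)
  let ?x = "q^2"
  let ?P = "qpoch q ?x" and ?Q = "qpoch (?x^2) (?x^2)" and ?n = "\<lambda>m. iv (qpoch (- q) ?x m)"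
  have D: "q ^ m dvd D m" for m unfolding D_def mult.assoc by (intro dvd_mult2 le_imp_power_dvd) simp
  show "q ^ s dvd D (i + s) * (rq ?x s * rq ?x (2*i+s+1))" "q ^ s dvd D (Suc i + s) * (rq ?x s * rq ?x (2*Suc i+s+1))"
    "q ^ s dvd D (Suc (Suc i) + s) * (rq ?x s * rq ?x (2*Suc (Suc i)+s+1))" for s
    by (rule dvd_add_mult[OF D])+
  let ?A = "\<lambda>s. D (i + s) * (rq ?x s * rq ?x (2*i+s+1))"
  let ?B = "\<lambda>s. D (Suc i + s) * (rq ?x s * rq ?x (2*Suc i+s+1))"
  let ?C = "\<lambda>s. D (Suc (Suc i) + s) * (rq ?x s * rq ?x (2*Suc (Suc i)+s+1))"
  let ?b = "- ((1 + q^2) * ?x ^ (i+1))" and ?c = "q * ?x ^ (2*i+3)"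
  \<comment> \<open>\<open>?F (Suc N)\<close> is the closed form of the truncated left-hand side,
    the certificate of the telescoping; its limit is the right-hand side. Two base identities are
    needed because the three truncations start at shifted indices.\<close>
  let ?F = "\<lambda>N. q ^ (2*i+3) * (?P (i+N+2) * ?Q (i+N+1) * ?n (i+N+1) * (rq ?x N * rq ?x (2*i+N+3)))"
  have n: "?n m = (1 + q * ?x ^ m) * ?n (Suc m)" for m
    using iv_qpoch_Suc(1)[of "- q" ?x m] by simp
  have base0: "q * ?A 0 = ?F 0"
  proof -
    have p: "q ^ (2*i+2) = q^2 * (q ^ i)^2" "q ^ (2*i+3) = q ^ 3 * (q ^ i)^2" "?x ^ (i+1) = q^2 * (q ^ i)^2"
      "(?x^2) * (?x^2) ^ i = q ^ 4 * (q ^ i) ^ 4" "?x ^ Suc (2*i+1) = q ^ 4 * (q ^ i) ^ 4" "?x ^ Suc (2*i+2) = q ^ 6 * (q ^ i) ^ 4"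
      by (simp_all add: mult_2 power_add power2_eq_square power_mult_distrib eval_nat_numeral mult_ac)
    have r: "rq ?x (2*i+1) = rq ?x (2*i+3) * (1 - q ^ 6 * (q ^ i) ^ 4) * (1 - q ^ 4 * (q ^ i) ^ 4)"
      using rq_Suc[of ?x "2*i+1"] rq_Suc[of ?x "2*i+2"] unfolding p by (simp add: eval_nat_numeral)
    have s: "?P (i+2) = ?P (i+1) * (1 - q * (q^2 * (q ^ i)^2))" "?Q (i+1) = ?Q i * (1 - q ^ 4 * (q ^ i) ^ 4)"
      "?n (i+1) = (1 + q * (q^2 * (q ^ i)^2)) * ?n (i+2)"
      using qpoch_Suc[of q ?x "i+1"] qpoch_Suc[of "?x^2" "?x^2" i] n[of "i+1"] unfolding p by simp_all
    have gen: "y * (y^2 * a^2 * P * Q * n * (R * (1 - y ^ 6 * a ^ 4) * (1 - y ^ 4 * a ^ 4))) =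
      y ^ 3 * a^2 * (P * (1 - y * (y^2 * a^2)) * (Q * (1 - y ^ 4 * a ^ 4)) * ((1 + y * (y^2 * a^2)) * n) * R)"
      for y a P Q n R :: "int fps" by algebra
    show ?thesis unfolding D_def add_0_right rq_0 mult_1_left unfolding s r p by (rule gen)
  qed
  have base1: "q * ?A 1 + ?b * ?B 0 = ?F 1 - ?F 0"
  proof -
    have p: "q ^ (2*(i+1)+2) = q ^ 4 * (q ^ i)^2" "q ^ (2*i+3) = q ^ 3 * (q ^ i)^2" "?x ^ (i+1) = q^2 * (q ^ i)^2"
      "?x ^ (i+2) = q ^ 4 * (q ^ i)^2"
      "(?x^2) * (?x^2) ^ (i+1) = q ^ 8 * (q ^ i) ^ 4" "?x ^ Suc (2*i+2) = q ^ 6 * (q ^ i) ^ 4" "?x ^ Suc (2*i+3) = q ^ 8 * (q ^ i) ^ 4"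
      by (simp_all add: mult_2 power_add power2_eq_square power_mult_distrib eval_nat_numeral mult_ac)
    have r: "rq ?x (2*i+2) = rq ?x (2*i+4) * (1 - q ^ 8 * (q ^ i) ^ 4) * (1 - q ^ 6 * (q ^ i) ^ 4)"
      "rq ?x (2*i+3) = rq ?x (2*i+4) * (1 - q ^ 8 * (q ^ i) ^ 4)"
      using rq_Suc[of ?x "2*i+2"] rq_Suc[of ?x "2*i+3"] unfolding p by (simp_all add: eval_nat_numeral)
    have r1: "1 = rq ?x 1 * (1 - q^2)" using rq_Suc[of ?x 0] by simp
    have s: "?P (i+3) = ?P (i+2) * (1 - q * (q ^ 4 * (q ^ i)^2))" "?Q (i+2) = ?Q (i+1) * (1 - q ^ 8 * (q ^ i) ^ 4)"
      "?n (i+2) = (1 + q * (q ^ 4 * (q ^ i)^2)) * ?n (i+3)"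
      "?n (i+1) = (1 + q * (q^2 * (q ^ i)^2)) * ((1 + q * (q ^ 4 * (q ^ i)^2)) * ?n (i+3))"
      using qpoch_Suc[of q ?x "i+2"] qpoch_Suc[of "?x^2" "?x^2" "i+1"] n[of "i+1"] n[of "i+2"] unfolding p
      by (simp_all add: eval_nat_numeral)
    have e: "i+1+1 = i+2" "i+1+2 = i+3" "2*i+1+1 = 2*i+2" "Suc i + 0 = i+1" "2*Suc i+0+1 = 2*i+3" "2*i+1+3 = 2*i+4"
      "i+0+2 = i+2" "i+0+1 = i+1" "2*i+0+3 = 2*i+3" by simp_all
    have gen: "y * (y ^ 4 * a^2 * P * Q * n * (R1 * (R * (1 - y ^ 8 * a ^ 4) * (1 - y ^ 6 * a ^ 4)))) +
       - ((1 + y^2) * (y^2 * a^2)) * (y ^ 4 * a^2 * P * Q * n * (o' * (R * (1 - y ^ 8 * a ^ 4)))) =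
      y ^ 3 * a^2 * (P * (1 - y * (y ^ 4 * a^2)) * (Q * (1 - y ^ 8 * a ^ 4)) * ((1 + y * (y ^ 4 * a^2)) * n) * (R1 * R)) -
      y ^ 3 * a^2 * (P * Q * ((1 + y * (y^2 * a^2)) * ((1 + y * (y ^ 4 * a^2)) * n)) * (o' * (R * (1 - y ^ 8 * a ^ 4))))"
      if "o' = R1 * (1 - y^2)" for y a P Q n R R1 o' :: "int fps" unfolding that by algebra
    show ?thesis unfolding D_def e rq_0 unfolding s r p by (rule gen[OF r1])
  qed
  have step: "q * ?A (Suc (Suc N)) + ?b * ?B (Suc N) + ?c * ?C N = ?F (Suc (Suc N)) - ?F (Suc N)" for N
  proof -
    have p: "q ^ (2*(i+N+2)+2) = q ^ 6 * (q ^ i)^2 * (q ^ N)^2" "q ^ (2*i+3) = q ^ 3 * (q ^ i)^2" "?x ^ (i+1) = q^2 * (q ^ i)^2"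
      "?x ^ (2*i+3) = q ^ 6 * (q ^ i) ^ 4"
      "?x ^ (i+N+2) = q ^ 4 * (q ^ i)^2 * (q ^ N)^2" "?x ^ (i+N+3) = q ^ 6 * (q ^ i)^2 * (q ^ N)^2"
      "(?x^2) * (?x^2) ^ (i+N+2) = q ^ 12 * (q ^ i) ^ 4 * (q ^ N) ^ 4"
      "?x ^ Suc (2*i+N+3) = q ^ 8 * (q ^ i) ^ 4 * (q ^ N)^2" "?x ^ Suc (2*i+N+4) = q ^ 10 * (q ^ i) ^ 4 * (q ^ N)^2"
      "?x ^ Suc N = q^2 * (q ^ N)^2" "?x ^ Suc (Suc N) = q ^ 4 * (q ^ N)^2"
      by (simp_all add: mult_2 power_add power2_eq_square power_mult_distrib eval_nat_numeral mult_ac)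
    have r: "rq ?x (2*i+N+3) = rq ?x (2*i+N+5) * (1 - q ^ 10 * (q ^ i) ^ 4 * (q ^ N)^2) * (1 - q ^ 8 * (q ^ i) ^ 4 * (q ^ N)^2)"
      "rq ?x (2*i+N+4) = rq ?x (2*i+N+5) * (1 - q ^ 10 * (q ^ i) ^ 4 * (q ^ N)^2)"
      "rq ?x N = rq ?x (Suc (Suc N)) * (1 - q ^ 4 * (q ^ N)^2) * (1 - q^2 * (q ^ N)^2)"
      "rq ?x (Suc N) = rq ?x (Suc (Suc N)) * (1 - q ^ 4 * (q ^ N)^2)"
      using rq_Suc[of ?x "2*i+N+3"] rq_Suc[of ?x "2*i+N+4"] rq_Suc[of ?x N] rq_Suc[of ?x "Suc N"] unfolding p by (simp_all add: eval_nat_numeral)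
    have s: "?P (i+N+4) = ?P (i+N+3) * (1 - q * (q ^ 6 * (q ^ i)^2 * (q ^ N)^2))"
      "?Q (i+N+3) = ?Q (i+N+2) * (1 - q ^ 12 * (q ^ i) ^ 4 * (q ^ N) ^ 4)"
      "?n (i+N+3) = (1 + q * (q ^ 6 * (q ^ i)^2 * (q ^ N)^2)) * ?n (i+N+4)"
      "?n (i+N+2) = (1 + q * (q ^ 4 * (q ^ i)^2 * (q ^ N)^2)) * ((1 + q * (q ^ 6 * (q ^ i)^2 * (q ^ N)^2)) * ?n (i+N+4))"
      using qpoch_Suc[of q ?x "i+N+3"] qpoch_Suc[of "?x^2" "?x^2" "i+N+2"] n[of "i+N+2"] n[of "i+N+3"] unfolding p
      by (simp_all add: eval_nat_numeral)
    have e: "i + Suc (Suc N) = i+N+2" "Suc i + Suc N = i+N+2" "Suc (Suc i) + N = i+N+2" "i+N+2+1 = i+N+3" "i+N+2+2 = i+N+4"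
      "2*i+Suc (Suc N)+1 = 2*i+N+3" "2*Suc i+Suc N+1 = 2*i+N+4" "2*Suc (Suc i)+N+1 = 2*i+N+5"
      "i + Suc N+2 = i+N+3" "i + Suc N + 1 = i+N+2" "2*i+Suc (Suc N)+3 = 2*i+N+5" "2*i+Suc N+3 = 2*i+N+4" by simp_all
    have gen: "y * (y ^ 6 * a^2 * b^2 * P * Q * n * (R * (R' * (1 - y ^ 10 * a ^ 4 * b^2) * (1 - y ^ 8 * a ^ 4 * b^2)))) +
       - ((1 + y^2) * (y^2 * a^2)) * (y ^ 6 * a^2 * b^2 * P * Q * n * (R * (1 - y ^ 4 * b^2) * (R' * (1 - y ^ 10 * a ^ 4 * b^2)))) +
       y * (y ^ 6 * a ^ 4) * (y ^ 6 * a^2 * b^2 * P * Q * n * (R * (1 - y ^ 4 * b^2) * (1 - y^2 * b^2) * R')) =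
      y ^ 3 * a^2 * (P * (1 - y * (y ^ 6 * a^2 * b^2)) * (Q * (1 - y ^ 12 * a ^ 4 * b ^ 4)) * ((1 + y * (y ^ 6 * a^2 * b^2)) * n) * (R * R')) -
      y ^ 3 * a^2 * (P * Q * ((1 + y * (y ^ 4 * a^2 * b^2)) * ((1 + y * (y ^ 6 * a^2 * b^2)) * n)) * (R * (1 - y ^ 4 * b^2) * (R' * (1 - y ^ 10 * a ^ 4 * b^2))))"
      for y a b P Q n R R' :: "int fps" by algebra
    show ?thesis unfolding D_def e unfolding s r p by (rule gen)
  qed
  have part: "q * (\<Sum>s<Suc (Suc N). ?A s) + ?b * (\<Sum>s<Suc N. ?B s) + ?c * (\<Sum>s<N. ?C s) = ?F (Suc N)" for N
  proof (induction N)
    case 0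
    have "q * (\<Sum>s<Suc (Suc 0). ?A s) + ?b * (\<Sum>s<Suc 0. ?B s) + ?c * (\<Sum>s<0. ?C s) = q * ?A 0 + (q * ?A 1 + ?b * ?B 0)"
      unfolding sum.lessThan_Suc[of _ "Suc 0"] sum.lessThan_Suc[of _ 0] by (simp only: lessThan_0 sum.empty One_nat_def) (simp only: distrib_left add_ac add_0_left add_0_right mult_zero_right)
    also have "\<dots> = ?F (Suc 0)" unfolding base1 base0 by simp
    finally show ?case .
  next
    case (Suc N)
    have "q * (\<Sum>s<Suc (Suc (Suc N)). ?A s) + ?b * (\<Sum>s<Suc (Suc N). ?B s) + ?c * (\<Sum>s<Suc N. ?C s) =
      (q * (\<Sum>s<Suc (Suc N). ?A s) + ?b * (\<Sum>s<Suc N. ?B s) + ?c * (\<Sum>s<N. ?C s)) +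
      (q * ?A (Suc (Suc N)) + ?b * ?B (Suc N) + ?c * ?C N)"
      unfolding sum.lessThan_Suc[of ?A "Suc (Suc N)"] sum.lessThan_Suc[of ?B "Suc N"] sum.lessThan_Suc[of ?C N]
      by (simp only: distrib_left add_ac)
    also have "\<dots> = ?F (Suc (Suc N))" unfolding Suc step by simp
    finally show ?case .
  qed
  fix N
  show "q ^ N dvd q ^ (2*i+3) * (qpoch_inf q ?x * euler (?x^2) * iv (qpoch_inf (- q) ?x) *
      (iv (euler ?x) * iv (euler ?x))) - (q * (\<Sum>s<Suc (Suc N). ?A s) + ?b * (\<Sum>s<Suc N. ?B s) + ?c * (\<Sum>s<N. ?C s))"
    unfolding part by (intro dvd_diff_mult qpoch_inf_approx rq_approx dvd_diff_iv qpoch_nth_0 qpoch_inf_nth_0; simp add: power2_eq_square)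
qed


lemma vanishes_limit:
  assumes "\<And>N. \<exists>g. vanishes p m a g \<and> q ^ N dvd f - g" shows "vanishes p m a f"
  unfolding vanishes_def
proof (intro allI impI)
  fix n assume n: "n mod m = a"
  obtain g where g: "vanishes p m a g" "q ^ Suc n dvd f - g" using assms by blast
  then have "fps_nth f n = fps_nth g n" unfolding X_power_dvd_iff by auto
  then show "p dvd fps_nth f n" using g(1) n by (simp add: vanishes_def)
qed

text \<open>The recurrence cannot be divided by \<open>q\<close>, so it is run upwards:
  \<open>q ^ n * Z i\<close> equals \<open>Z (i+n)\<close> plus \<open>J\<close> times a polynomial
  whose forbidden class moves by one in each step. The new exponent is congruent to
  \<open>n^2\<close>, and \<open>n^2\<close> is never congruent to \<open>n + 1\<close> modulo 3.
  The quadratic order of \<open>Z\<close> makes \<open>Z (i+n)\<close> negligible.\<close>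

lemma vanishes_forward_recurrence:
  assumes rec: "\<And>i. q * Z i = Z (Suc i) + q ^ (i*i+3*i+3) * J" and dv: "\<And>i. q ^ (i * (i+1)) dvd Z i"
    and J: "lacunary 3 3 J" and i: "i mod 3 = 0"
  shows "vanishes 3 3 0 (Z i)"
proof -
  have it: "\<exists>Q. q ^ n * Z i = Z (i+n) + J * Q \<and> vanishes 3 3 (n mod 3) Q" for n
  proof (induction n)
    case 0
    show ?case by (intro exI[of _ 0]) (simp add: vanishes_def)
  next
    case (Suc n)
    then obtain Q where Q: "q ^ n * Z i = Z (i+n) + J * Q" "vanishes 3 3 (n mod 3) Q" by blast
    let ?e = "(i+n)*(i+n)+3*(i+n)+3"
    have gen: "(y * p) * z = z' + J * (y * Q + E)" if "p * z = w + J * Q" "y * w = z' + E * J" for y p z z' Q E w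
      using that by algebra
    have "q ^ Suc n * Z i = Z (i + Suc n) + J * (q * Q + q ^ ?e)"
      unfolding power_Suc add_Suc_right by (rule gen[OF Q(1) rec[of "i+n"]])
    moreover have "vanishes 3 3 (Suc n mod 3) (q * Q + q ^ ?e)"
    proof (rule vanishes_add)
      have "k mod 3 = n mod 3" if "(k + 1) mod 3 = Suc n mod 3" for k
        using that cong_add_rcancel_nat[of k 1 n 3] unfolding cong_def Suc_eq_plus1 by blast
      then have "vanishes 3 3 (Suc n mod 3) (q ^ 1 * Q)" by (rule vanishes_X_power_mult[OF Q(2)])
      then show "vanishes 3 3 (Suc n mod 3) (q * Q)" by (simp only: power_one_right)
      obtain k where k: "i = 3 * k" using i by auto
      have "?e = n * n + 3 * (3*k*k + 2*k*n + (i+n) + 1)" by (simp add: k algebra_simps)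
      then have "?e mod 3 = (n * n) mod 3" by (metis mod_mult_self2)
      also have "\<dots> = ((n mod 3) * (n mod 3)) mod 3" by (simp only: mod_mult_eq)
      also have "\<dots> \<noteq> Suc n mod 3"
      proof -
        have "n mod 3 = 0 \<and> Suc n mod 3 = 1 \<or> n mod 3 = 1 \<and> Suc n mod 3 = 2 \<or> n mod 3 = 2 \<and> Suc n mod 3 = 0" by presburger
        then show ?thesis by auto
      qed
      finally show "vanishes 3 3 (Suc n mod 3) (q ^ ?e)" by (rule vanishes_X_power)
    qed
    ultimately show ?case by blast
  qed
  show ?thesis unfolding vanishes_def
  proof (intro allI impI)
    fix j :: nat assume j: "j mod 3 = 0"
    \<comment> \<open>A multiple of 3, so that class 0 is preserved, and larger than
      \<open>j\<close>, so that the order of \<open>Z (i+n)\<close> exceeds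
      \<open>j + n\<close>.\<close>
    define n where "n = 3 * Suc j"
    obtain Q where Q: "q ^ n * Z i = Z (i+n) + J * Q" "vanishes 3 3 (n mod 3) Q" using it by blast
    have "n \<le> n * n" "j < n" by (simp_all add: n_def)
    then have "j + n < n * n + n" by linarith
    also have "\<dots> \<le> (i+n) * (i+n+1)" by (simp add: algebra_simps)
    finally have "fps_nth (Z (i+n)) (j+n) = 0" using dv[of "i+n"] unfolding X_power_dvd_iff by blast
    then have "fps_nth (Z i) j = fps_nth (J * Q) (j+n)"
      using arg_cong[OF Q(1), of "\<lambda>f. fps_nth f (j+n)"] by (simp add: fps_X_power_mult_nth)
    moreover have "vanishes 3 3 0 (J * Q)" using vanishes_mult[OF Q(2) J] by (simp add: n_def)
    moreover have "(j + n) mod 3 = 0" using j unfolding n_def by presburger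
    ultimately show "3 dvd fps_nth (Z i) j" by (simp add: vanishes_def)
  qed
qed

text \<open>Here iteration converges directly. For \<open>i\<close> congruent to 1 the exponent
  \<open>n + (i+n)^2 + 3*(i+n) + 3\<close> is congruent to \<open>n^2 + 1\<close>, never 0 modulo
  3.\<close>

lemma vanishes_backward_recurrence:
  assumes rec: "\<And>i. Z i = q * Z (Suc i) + q ^ (i*i+3*i+3) * J"
    and J: "lacunary 3 3 J" and i: "i mod 3 = 1"
  shows "vanishes 3 3 0 (Z i)"
proof -
  have it: "\<exists>Q. Z i = q ^ n * Z (i+n) + J * Q \<and> vanishes 3 3 0 Q" for n
  proof (induction n)
    case 0
    show ?case by (intro exI[of _ 0]) (simp add: vanishes_def)
  next
    case (Suc n)
    then obtain Q where Q: "Z i = q ^ n * Z (i+n) + J * Q" "vanishes 3 3 0 Q" by blast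
    let ?e = "(i+n)*(i+n)+3*(i+n)+3"
    have gen: "z = (y * p) * z' + J * (Q + p * E)" if "z = p * w + J * Q" "w = y * z' + E * J" for y p z z' Q E w
      using that by algebra
    have "Z i = q ^ Suc n * Z (i + Suc n) + J * (Q + q ^ (n + ?e))"
      unfolding power_Suc add_Suc_right power_add[of q n] by (rule gen[OF Q(1) rec])
    moreover have "vanishes 3 3 0 (Q + q ^ (n + ?e))"
    proof (rule vanishes_add[OF Q(2)])
      obtain k where k: "i = 3 * k + 1" using i by (metis add.commute mod_mult_div_eq)
      have "n + ?e = n * n + 1 + 3 * (3*k*k + 2*k*n + 2*k + n + (i+n) + 1)" by (simp add: k algebra_simps)
      then have "(n + ?e) mod 3 = (n * n + 1) mod 3" by (metis mod_mult_self2)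
      moreover have "(m + 1) mod 3 \<noteq> 0" if "m mod 3 \<noteq> 2" for m :: nat using that by presburger
      ultimately have "(n + ?e) mod 3 \<noteq> 0" using square_mod_3[of n] by metis
      then show "vanishes 3 3 0 (q ^ (n + ?e))" by (rule vanishes_X_power)
    qed
    ultimately show ?case by blast
  qed
  show ?thesis
  proof (rule vanishes_limit)
    fix N
    obtain Q where Q: "Z i = q ^ N * Z (i+N) + J * Q" "vanishes 3 3 0 Q" using it by blast
    then have "q ^ N dvd Z i - J * Q" by simp
    then show "\<exists>g. vanishes 3 3 0 g \<and> q ^ N dvd Z i - g" using vanishes_mult[OF Q(2) J] by blast
  qed
qed

lemma euler_product_sq:
  "qpoch_inf q (q^2) * qpoch_inf (- q) (q^2) * euler ((q^2)^2) = euler (q^2)"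
proof -
  have "qpoch_inf q (q^2) * qpoch_inf (- q) (q^2) = qpoch_inf (q^2) ((q^2)^2)" by (rule qpoch_inf_mult_minus) simp_all
  moreover have "q^2 * q^2 = (q^2)^2" by (simp only: power2_eq_square)
  ultimately show ?thesis using qpoch_inf_bisect[OF X_dvd(1) X_dvd(1)] by (simp only:)
qed

text \<open>The characteristic polynomial factors as
  \<open>q*t^2 - (1+q^2)*t + q = (q*t - 1) * (t - q)\<close>, so
  \<open>?h i - q * ?h (Suc i)\<close> and \<open>q * ?h i - ?h (Suc i)\<close> each obey a
  first-order recurrence. The second difference is the former at \<open>i\<close> plus the latter at
  \<open>Suc i\<close>; only \<open>i\<close> divisible by 3 matters, since otherwise
  \<open>tri (Suc i)\<close> is a multiple of 3.\<close>

lemma vanishes_L12: "vanishes 3 3 0 (fsum (\<lambda>m. term_L12 (Suc m)))"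
proof -
  let ?x = "q^2"
  let ?D = "\<lambda>m. q ^ (2*m+2) * qpoch q ?x (m+1) * qpoch (?x^2) (?x^2) m * iv (qpoch (- q) ?x (m+2))"
  let ?N = "qpoch_inf (- q) ?x" and ?E = "euler ?x" and ?O = "qpoch_inf q ?x" and ?Q = "euler (?x^2)"
  let ?K = "?N^2 * (iv ?E)^2"
  let ?H = "bailey_coeff ?x ?D"
  let ?h = "\<lambda>i. ?K * ?H i"
  have D: "q ^ m dvd ?D m" for m unfolding mult.assoc by (intro dvd_mult2 le_imp_power_dvd) simp
  have dd: "q ^ i dvd ?H i - ?H (Suc (Suc i))" for i
    by (intro dvd_diff dvd_bailey_coeff dvd_trans[OF le_imp_power_dvd dvd_bailey_coeff[of ?x "Suc (Suc i)"]]) simp_all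
  have rec: "q * ?h i - (1 + ?x) * ?h (Suc i) + q * ?h (Suc (Suc i)) = q ^ (i*i+3*i+3) * iv ?E ^ 3" for i
  proof -
    have 1: "?x ^ tri (Suc i) = ?x ^ tri i * ?x ^ (i+1)" by (simp add: tri_Suc power_add)
    have "tri (Suc (Suc i)) = tri i + (2*i+3)" by (simp add: tri_Suc)
    then have 2: "?x ^ tri (Suc (Suc i)) = ?x ^ tri i * ?x ^ (2*i+3)" by (simp only: power_add)
    have 3: "?x ^ tri i * q ^ (2*i+3) = q ^ (i*i+3*i+3)"
      unfolding power_mult[symmetric] two_tri power_add[symmetric] by (rule arg_cong[of _ _ "\<lambda>k. q ^ k"]) simp
    have 5: "?E * iv ?E = 1" "?N * iv ?N = 1" by (simp_all add: iv_mult_self qpoch_inf_nth_0)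
    have gen: "q * (N^2 * I^2 * (T * g0)) - (1 + y) * (N^2 * I^2 * (T * x1 * g1)) + q * (N^2 * I^2 * (T * x2 * g2)) = M * I ^ 3"
      if "q * g0 + (- ((1 + y) * x1)) * g1 + q * x2 * g2 = p * (W * Q * J * (I * I))" "T * p = M" "W * N * Q = E" "E * I = 1" "N * J = 1"
      for N I T g0 g1 g2 x1 x2 y p W Q J M E :: "int fps"
    proof -
      have "q * (N^2 * I^2 * (T * g0)) - (1 + y) * (N^2 * I^2 * (T * x1 * g1)) + q * (N^2 * I^2 * (T * x2 * g2)) =
        N^2 * I^2 * T * (q * g0 + (- ((1 + y) * x1)) * g1 + q * x2 * g2)" by (simp add: algebra_simps)
      also have "\<dots> = (T * p) * I ^ 3 * ((W * N * Q) * I) * (N * J)"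
        unfolding that(1) by (simp only: power2_eq_square power3_eq_cube mult_ac)
      finally show ?thesis unfolding that(2-5) by simp
    qed
    show ?thesis unfolding bailey_coeff_def 1 2 by (rule gen[OF L12_recurrence 3 euler_product_sq 5])
  qed
  have Hd: "q ^ (i * (i+1)) dvd ?h i" for i
  proof -
    have "q ^ (i * (i+1)) = ?x ^ tri i" by (simp only: power_mult[symmetric] two_tri)
    then show ?thesis unfolding bailey_coeff_def by simp
  qed
  have Hd': "q ^ (i * (i+1)) dvd ?h (Suc i)" for i
    by (rule dvd_trans[OF le_imp_power_dvd Hd]) simp
  have "fsum (\<lambda>m. term_L12 (Suc m)) = ?K * fsum (\<lambda>m. ?D m * ((qpoch ?x ?x m)^2 * rq ?x (2*m+1)))"
    unfolding term_L12_eq by (intro fsum_mult_left dvd_mult2 D)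
  also have "\<dots> = ?K * fsum (\<lambda>i. (-1) ^ i * of_nat (tri (Suc i)) * (?H i - ?H (Suc (Suc i))))"
    unfolding bailey_sum_odd[of ?x ?D, OF X_dvd(1,3) D] fsum_abel(2)[of ?H, OF dvd_bailey_coeff[OF X_dvd(1)]] ..
  also have "\<dots> = fsum (\<lambda>i. ?K * ((-1) ^ i * of_nat (tri (Suc i)) * (?H i - ?H (Suc (Suc i)))))"
    by (intro fsum_mult_left[symmetric] dvd_mult dd)
  also have "\<dots> = fsum (\<lambda>i. (-1) ^ i * of_nat (tri (Suc i)) * ((?h i - q * ?h (Suc i)) + (q * ?h (Suc i) - ?h (Suc (Suc i)))))"
    by (rule fsum_cong) (simp add: algebra_simps)
  also have "vanishes 3 3 0 \<dots>"
  proof (intro vanishes_fsum vanishes_coeff_mult)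
    fix i
    show "vanishes 3 3 0 ((?h i - q * ?h (Suc i)) + (q * ?h (Suc i) - ?h (Suc (Suc i)))) \<or> 3 dvd int (tri (Suc i))"
    proof (cases "Suc i mod 3 = 1")
      case False
      then have "tri (Suc i) mod 3 = 0" using tri_mod_3[of "Suc i"] by simp
      then show ?thesis by (intro disjI2) presburger
    next
      case True
      then have i: "i mod 3 = 0" by presburger
      have g1: "q * (h0 - q * h1) = h1 - q * h2 + M"
        if "q * h0 - (1 + q^2) * h1 + q * h2 = M" for h0 h1 h2 M
        unfolding that[symmetric] by (simp add: algebra_simps power2_eq_square)
      have g2: "q * h0 - h1 = q * (q * h1 - h2) + M"
        if "q * h0 - (1 + q^2) * h1 + q * h2 = M" for h0 h1 h2 M
        unfolding that[symmetric] by (simp add: algebra_simps power2_eq_square)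
      note Z = g1[OF rec] g2[OF rec]
      have "vanishes 3 3 0 (?h i - q * ?h (Suc i))"
        by (rule vanishes_forward_recurrence[where Z = "\<lambda>i. ?h i - q * ?h (Suc i)", OF Z(1) _ lacunary_cube i])
          (intro dvd_diff Hd dvd_mult Hd')
      moreover have "vanishes 3 3 0 (q * ?h (Suc i) - ?h (Suc (Suc i)))"
        by (rule vanishes_backward_recurrence[where Z = "\<lambda>i. q * ?h i - ?h (Suc i)", OF Z(2) lacunary_cube True])
      ultimately show ?thesis by (intro disjI1 vanishes_add)
    qed
  qed
  finally show ?thesis .
qed

section \<open>The functions spt_G3 and spt_F1 modulo 5\<close>

lemma term_G3_eq:
  "term_G3 (Suc m) = (iv (euler q))^2 *
    ((-1) ^ (m+1) * q ^ tri (m+1) * qpoch q q m * iv (1 + q ^ (m+1)) * ((qpoch q q m)^2 * rq q (2*m+1)))"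
proof -
  let ?E = "euler q"
  have e: "Suc m * (Suc m + 1) div 2 = tri (m+1)" "Suc m = m + 1" by (simp_all add: tri_def)
  have e1: "q ^ (2 * Suc m + 1) = q * q ^ (2*m+2)" "q ^ Suc m = q * q ^ m" "q ^ (Suc m + 1) = q * q ^ (m+1)" by simp_all
  have 1: "qpoch_inf (q ^ (2 * Suc m + 1)) q = ?E * rq q (2*m+2)" unfolding e1 by (simp only: qpoch_inf_shift dvd_refl rq_def)
  have 2: "iv ((qpoch_inf (q ^ Suc m) q)^2) = (qpoch q q m * iv ?E)^2"
    unfolding e1 by (simp add: iv_power qpoch_inf_nth_0 iv_qpoch_inf_shift)
  have 3: "iv (qpoch_inf (q ^ (Suc m + 1)) q) = qpoch q q m * (1 - q ^ (m+1)) * iv ?E"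
  proof -
    have "qpoch q q (m+1) = qpoch q q m * (1 - q ^ (m+1))" by (simp add: qpoch_Suc)
    then show ?thesis unfolding e1 by (simp only: iv_qpoch_inf_shift dvd_refl)
  qed
  have "2*m+2 = (m+1) * 2" by simp
  then have "q ^ (2*m+2) = (q ^ (m+1))^2" by (simp only: power_mult)
  then have 4: "rq q (2*m+1) = rq q (2*m+2) * (1 - (q ^ (m+1))^2)" using rq_Suc[of q "2*m+1"] by simp
  have n0: "fps_nth ((qpoch_inf (q ^ Suc m) q)^2) 0 = 1" "fps_nth (qpoch_inf (q ^ (Suc m + 1)) q) 0 = 1"
    by (simp_all add: fps_power_zeroth qpoch_inf_nth_0)
  have gen: "(s * t * (E * R)) * ((p * I)^2 * (p * (1 - y) * I)) = I^2 * (s * t * p * l * (p^2 * (R * (1 - y^2))))"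
    if "E * I = 1" "(1 + y) * l = 1" for s t E R p I y l :: "int fps"
    using that by algebra
  have "?E * iv ?E = 1" "(1 + q ^ (m+1)) * iv (1 + q ^ (m+1)) = 1"
    by (simp_all add: iv_mult_self qpoch_inf_nth_0)
  note G = gen[OF this]
  show ?thesis unfolding term_G3_def fps_quot_eq_iv iv_mult[OF n0] 1 2 3 4 e(1) unfolding e(2) by (rule G)
qed

text \<open>The ratio of consecutive values of \<open>F\<close> is
  \<open>- q^(m+2) + q^(2m+3)\<close>, without a constant term: this is the q-Gauss sum with
  \<open>z = 0\<close>, where the product in \<open>z\<close> becomes 1.\<close>

lemma G3_differences:
  fixes i :: nat
  defines "D \<equiv> \<lambda>m. (-1) ^ (m+1) * q ^ tri (m+1) * qpoch q q m * iv (1 + q ^ (m+1))"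
  shows "bailey_coeff q D i - bailey_coeff q D (Suc i) = (-1) ^ (i+1) * q ^ ((i+1) * (i+1))"
proof -
  let ?E = "euler q"
  define F where "F = (\<lambda>m. (-1) ^ (m+1) * q ^ tri (m+1) * qpoch q q m)"
  have D: "q ^ m dvd D m" for m unfolding D_def
    by (intro dvd_mult2[OF dvd_mult2[OF dvd_mult[OF le_imp_power_dvd]]] order_trans[OF _ le_tri]) simp
  have DF: "D m * (1 + q ^ (m+1)) = F m" for m
    unfolding D_def F_def by (rule iv_mult_cancel) simp
  let ?u = "q ^ (i+2)" and ?v = "q ^ (2*i+3)"
  let ?C = "(-1) ^ (i+1) * q ^ tri (i+1) * qpoch q q i * rq q (2*i+2)"
  let ?G = "fsum (gauss_term q 0 ?u ?v)"
  have prod: "F (i + s) = (-1) ^ (i+1) * q ^ tri (i+1) * qpoch q q i * (\<Prod>k<s. 0 - ?u * q ^ k + ?v * q ^ (2*k))" for s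
  proof (induction s)
    case 0
    then show ?case by (simp add: F_def)
  next
    case (Suc s)
    have "tri (i + Suc s + 1) = tri (i + s + 1) + (i + s + 2)" using tri_Suc[of "i + s + 1"] by simp
    then have t: "q ^ tri (i + Suc s + 1) = q ^ tri (i + s + 1) * (q^2 * q ^ i * q ^ s)" by (simp add: power_add power2_eq_square mult_ac)
    have P: "qpoch q q (i + Suc s) = qpoch q q (i + s) * (1 - q * q ^ i * q ^ s)"
      by (simp add: qpoch_Suc power_add mult_ac)
    have p: "?u = q^2 * q ^ i" "?v = q ^ 3 * (q ^ i)^2" "q ^ (2 * s) = (q ^ s)^2" "(-1) ^ (i + Suc s + 1) = - ((-1) ^ (i + s + 1) :: int fps)"
      by (simp_all add: mult_2 power_add power2_eq_square power_mult_distrib eval_nat_numeral mult_ac)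
    have gen: "- \<sigma> * (T * (y^2 * a * b)) * (P * (1 - y * a * b)) = \<sigma> * T * P * (0 - y^2 * a * b + y ^ 3 * a^2 * b^2)"
      for \<sigma> T y a b P :: "int fps" by algebra
    have "F (i + Suc s) = F (i + s) * (0 - ?u * q ^ s + ?v * q ^ (2 * s))"
      unfolding F_def t P unfolding p by (rule gen)
    then show ?case unfolding Suc by simp
  qed
  have T: "F (i + s) * (rq q s * rq q (2*i+s+2)) = ?C * gauss_term q 0 ?u ?v s" for s
  proof -
    have "2*i+s+2 = (2*i+2) + s" "Suc (2*i+2) = 2*i+3" by simp_all
    then have "rq q (2*i+s+2) = rq q (2*i+2) * iv (qpoch ?v q s)"
      using rq_add[of q "2*i+2" s] by (simp only: dvd_refl)
    then show ?thesis unfolding prod gauss_term_def by (simp only: mult_ac)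
  qed
  have dv: "q dvd 0" "q dvd ?u" "q dvd ?v" by simp_all
  have S: "fsum (\<lambda>s. F (i + s) * (rq q s * rq q (2*i+s+2))) = ?C * ?G"
    by (rule fsum_gauss_mult[OF T dv])
  have "?G * qpoch_inf ?v q * qpoch_inf 0 q = qpoch_inf ?u q"
  proof (rule q_gauss_sum[OF dvd_refl dv])
    fix N
    have "(\<Prod>k<N. 1 - ?u * q ^ k + ?v * 0 * q ^ (2*k)) = qpoch ?u q N" by (simp add: qpoch_def)
    then show "q ^ N dvd qpoch_inf ?u q - (\<Prod>k<N. 1 - ?u * q ^ k + ?v * 0 * q ^ (2*k))"
      by (simp only:) (rule qpoch_inf_approx; simp)
  qed
  then have G: "?G * qpoch_inf ?v q = qpoch_inf ?u q" by (simp add: qpoch_inf_zero)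
  have E: "?E = qpoch q q (2*i+2) * qpoch_inf ?v q"
  proof -
    have "q * q ^ (2*i+2) = ?v" unfolding power_Suc[symmetric] by (rule arg_cong[of _ _ "\<lambda>k. q ^ k"]) simp
    then show ?thesis using qpoch_inf_split[of q q "2*i+2"] by (simp only: dvd_refl)
  qed
  have E': "?E = qpoch q q i * (1 - q ^ (i+1)) * qpoch_inf ?u q"
  proof -
    have "q * q ^ (i+1) = ?u" "q * q ^ i = q ^ (i+1)" by simp_all
    then have "?E = qpoch q q (Suc i) * qpoch_inf ?u q" "qpoch q q (Suc i) = qpoch q q i * (1 - q ^ (i+1))"
      using qpoch_inf_split[of q q "i+1"] by (simp_all only: qpoch_Suc dvd_refl Suc_eq_plus1[symmetric])
    then show ?thesis by simp
  qed
  have t: "q ^ tri i * q ^ tri (i+1) = q ^ ((i+1) * (i+1))"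
  proof -
    have "tri i + tri (i+1) = (i+1) * (i+1)" using two_tri[of i] tri_Suc[of i] by simp
    then show ?thesis by (simp only: power_add[symmetric])
  qed
  have gen: "t * w * (\<sigma> * y * p * r * g) * E = \<sigma> * M * E"
    if "g * v = P" "E = k * v" "E = p * w * P" "t * y = M" "k * r = 1" for t w \<sigma> y p r g E M P v k :: "int fps"
  proof -
    have "t * w * (\<sigma> * y * p * r * g) * E = \<sigma> * (t * y) * (k * r) * (p * w * (g * v))"
      unfolding that(2) by (simp only: mult_ac)
    then show ?thesis unfolding that(1,4,5) that(3)[symmetric] by simp
  qed
  have "q ^ tri i * (1 - q ^ (i+1)) * (?C * ?G) * ?E = (-1) ^ (i+1) * q ^ ((i+1) * (i+1)) * ?E"
    by (rule gen[OF G E E' t qpoch_rq]) simp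
  moreover have "?E \<noteq> 0" using qpoch_inf_nth_0[of q q] by auto
  ultimately have "q ^ tri i * (1 - q ^ (i+1)) * (?C * ?G) = (-1) ^ (i+1) * q ^ ((i+1) * (i+1))"
    by (simp only: mult_cancel_right) simp
  then show ?thesis unfolding bailey_coeff_diff1[of q D F, OF dvd_refl D DF] S .
qed

lemma fsum_G3: "fsum (\<lambda>m. term_G3 (Suc m)) =
  (iv (euler q))^2 * fsum (\<lambda>i. (-1) ^ i * of_nat (i+1) * ((-1) ^ (i+1) * q ^ ((i+1) * (i+1))))"
proof -
  let ?D = "\<lambda>m. (-1) ^ (m+1) * q ^ tri (m+1) * qpoch q q m * iv (1 + q ^ (m+1))"
  have D: "q ^ m dvd ?D m" for m
    by (intro dvd_mult2[OF dvd_mult2[OF dvd_mult[OF le_imp_power_dvd]]] order_trans[OF _ le_tri]) simp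
  have "fsum (\<lambda>m. term_G3 (Suc m)) = (iv (euler q))^2 * fsum (\<lambda>m. ?D m * ((qpoch q q m)^2 * rq q (2*m+1)))"
    unfolding term_G3_eq by (intro fsum_mult_left dvd_mult2 D)
  also have "\<dots> = (iv (euler q))^2 * fsum (\<lambda>i. (-1) ^ i * of_nat (i+1) * ((-1) ^ (i+1) * q ^ ((i+1) * (i+1))))"
    unfolding bailey_sum_odd[of q ?D, OF dvd_refl fps_X_neq_zero D] fsum_abel(1)[of "bailey_coeff q ?D", OF dvd_bailey_coeff[OF dvd_refl]]
      G3_differences ..
  finally show ?thesis .
qed

lemma mult_mod_5: "(a * b) mod 5 = ((a mod 5) * (b mod 5)) mod (5 :: nat)"
  by (simp only: mod_mult_eq)

text \<open>The index class 2 is singled out because Jacobi's weight \<open>2*k+1\<close> is a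
  multiple of 5 there.\<close>

lemma tri_mod_5: "k mod 5 \<noteq> 2 \<Longrightarrow> tri k mod 5 = 0 \<or> tri k mod 5 = 1" "k mod 5 = 2 \<Longrightarrow> tri k mod 5 = 3"
proof -
  have "k mod 5 = 0 \<and> (k+1) mod 5 = 1 \<or> k mod 5 = 1 \<and> (k+1) mod 5 = 2 \<or> k mod 5 = 2 \<and> (k+1) mod 5 = 3 \<or>
    k mod 5 = 3 \<and> (k+1) mod 5 = 4 \<or> k mod 5 = 4 \<and> (k+1) mod 5 = 0" by presburger
  then have "k mod 5 \<noteq> 2 \<and> (2 * tri k) mod 5 = 0 \<or> k mod 5 \<noteq> 2 \<and> (2 * tri k) mod 5 = 2 \<or> k mod 5 = 2 \<and> (2 * tri k) mod 5 = 1"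
    unfolding two_tri mult_mod_5[of k "k+1"] by auto
  moreover have "(2 * t) mod 5 = 0 \<longrightarrow> t mod 5 = 0" "(2 * t) mod 5 = 2 \<longrightarrow> t mod 5 = 1"
    "(2 * t) mod 5 = 1 \<longrightarrow> t mod 5 = 3" for t :: nat by presburger+
  note this[of "tri k"]
  ultimately have "k mod 5 \<noteq> 2 \<and> tri k mod 5 = 0 \<or> k mod 5 \<noteq> 2 \<and> tri k mod 5 = 1 \<or> k mod 5 = 2 \<and> tri k mod 5 = 3" by argo
  then show "k mod 5 \<noteq> 2 \<Longrightarrow> tri k mod 5 = 0 \<or> tri k mod 5 = 1" "k mod 5 = 2 \<Longrightarrow> tri k mod 5 = 3" by auto
qed

lemma vanishes_X_power_euler_cube:
  assumes "\<And>k. k mod 5 \<noteq> 2 \<Longrightarrow> (e + tri k) mod 5 \<noteq> a"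
  shows "vanishes 5 5 a (q ^ e * euler q ^ 3)"
proof -
  have "q ^ e * euler q ^ 3 = q ^ e * fsum (\<lambda>i. (-1) ^ i * of_nat (2*i+1) * q ^ tri i)"
    by (simp only: jacobi_cube[OF dvd_refl fps_X_neq_zero])
  also have "\<dots> = fsum (\<lambda>i. q ^ e * ((-1) ^ i * of_nat (2*i+1) * q ^ tri i))"
    by (intro fsum_mult_left[symmetric] dvd_mult dvd_power_tri dvd_refl)
  also have "\<dots> = fsum (\<lambda>i. (-1) ^ i * of_nat (2*i+1) * q ^ (e + tri i))"
    by (rule fsum_cong) (simp only: power_add mult_ac)
  also have "vanishes 5 5 a \<dots>"
  proof (intro vanishes_fsum vanishes_coeff_mult)
    fix i
    show "vanishes 5 5 a (q ^ (e + tri i)) \<or> 5 dvd int (2*i+1)"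
    proof (cases "i mod 5 = 2")
      case True
      then show ?thesis by (intro disjI2) presburger
    next
      case False
      then show ?thesis using assms vanishes_X_power by blast
    qed
  qed
  finally show ?thesis .
qed

text \<open>With \<open>I\<close> the inverse of \<open>E\<close>, \<open>I^2 = I^5 * E^3\<close>:
  the fifth power only has exponents divisible by 5 modulo 5, and the cube is tested against each
  \<open>t i\<close> separately.\<close>

lemma vanishes_iv_square_mult:
  assumes "\<And>i. q ^ i dvd t i" "\<And>i. vanishes 5 5 a (t i * euler q ^ 3)"
  shows "vanishes 5 5 a ((iv (euler q))^2 * fsum t)"
proof -
  let ?E = "euler q"
  have "?E * iv ?E = 1" by (simp add: iv_mult_self qpoch_inf_nth_0)
  moreover have "I^2 * S = I ^ 5 * (E ^ 3 * S)" if "E * I = 1" for I E S :: "int fps" using that by algebra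
  ultimately have "(iv ?E)^2 * fsum t = iv ?E ^ 5 * (?E ^ 3 * fsum t)" by blast
  also have "?E ^ 3 * fsum t = fsum (\<lambda>i. ?E ^ 3 * t i)" by (intro fsum_mult_left[symmetric] assms)
  also have "vanishes 5 5 a (iv ?E ^ 5 * fsum (\<lambda>i. ?E ^ 3 * t i))"
    by (intro vanishes_mult[OF _ lacunary_fifth] vanishes_fsum) (use assms(2) in \<open>simp only: mult.commute\<close>)
  finally show ?thesis .
qed

text \<open>The weight removes \<open>i+1\<close> divisible by 5; otherwise the square is 1 or 4
  modulo 5. Adding a triangular residue 0 or 1 gives 1, 2, 4 or 0, never 3.\<close>

lemma vanishes_G3: "vanishes 5 5 3 (fsum (\<lambda>m. term_G3 (Suc m)))"
  unfolding fsum_G3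
proof (rule vanishes_iv_square_mult)
  fix i
  show "q ^ i dvd (-1) ^ i * of_nat (i+1) * ((-1) ^ (i+1) * q ^ ((i+1) * (i+1)))"
    by (intro dvd_mult le_imp_power_dvd) simp
  let ?e = "(i+1) * (i+1)"
  have "vanishes 5 5 3 ((-1) ^ (2*i+1) * of_nat (i+1) * (q ^ ?e * euler q ^ 3))"
  proof (rule vanishes_coeff_mult)
    show "vanishes 5 5 3 (q ^ ?e * euler q ^ 3) \<or> 5 dvd int (i+1)"
    proof (cases "(i+1) mod 5 = 0")
      case True
      then show ?thesis by (intro disjI2) presburger
    next
      case False
      then have "(i+1) mod 5 = 1 \<or> (i+1) mod 5 = 2 \<or> (i+1) mod 5 = 3 \<or> (i+1) mod 5 = 4" by presburger
      then have e: "?e mod 5 = 1 \<or> ?e mod 5 = 4" unfolding mult_mod_5[of "i+1"] by auto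
      have c: "(m + t) mod 5 \<noteq> 3" if "m mod 5 = 1 \<or> m mod 5 = 4" "t mod 5 = 0 \<or> t mod 5 = 1" for m t :: nat
        using that by presburger
      show ?thesis by (intro disjI1 vanishes_X_power_euler_cube c[OF e] tri_mod_5)
    qed
  qed
  moreover have "(-1) ^ (2*i+1) = (-1) ^ i * ((-1) ^ (i+1) :: int fps)" unfolding power_add[symmetric] by (simp add: mult_2)
  ultimately show "vanishes 5 5 3 ((-1) ^ i * of_nat (i+1) * ((-1) ^ (i+1) * q ^ ?e) * euler q ^ 3)"
    by (simp only: mult_ac)
qed

section \<open>spt_F1: closed kernel and splitting into a cube series and a square series\<close>

lemma term_F1_eq:
  "term_F1 (Suc m) = iv (euler q) * iv (qpoch_inf (- q) q) *
    (q ^ tri m * qpoch (- q) q (m+1) * ((qpoch q q m)^2 * rq q (2*m+2)))"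
proof -
  let ?E = "euler q"
  have e: "Suc m * (Suc m - 1) div 2 = tri m" by (simp add: tri_def mult.commute)
  have e1: "q ^ (2 * Suc m + 1) = q * q ^ (2*m+2)" "q ^ Suc m = q * q ^ m" "- (q ^ (Suc m + 1)) = - q * q ^ (m+1)" by simp_all
  have 1: "qpoch_inf (q ^ (2 * Suc m + 1)) q = ?E * rq q (2*m+2)" unfolding e1 by (simp only: qpoch_inf_shift dvd_refl rq_def)
  have 2: "iv ((qpoch_inf (q ^ Suc m) q)^2) = (qpoch q q m * iv ?E)^2"
    unfolding e1 by (simp add: iv_power qpoch_inf_nth_0 iv_qpoch_inf_shift)
  have 3: "iv (qpoch_inf (- (q ^ (Suc m + 1))) q) = qpoch (- q) q (m+1) * iv (qpoch_inf (- q) q)"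
    unfolding e1 by (simp only: iv_qpoch_inf_shift dvd_refl X_dvd)
  have n0: "fps_nth ((qpoch_inf (q ^ Suc m) q)^2) 0 = 1" "fps_nth (qpoch_inf (- (q ^ (Suc m + 1))) q) 0 = 1"
    by (simp_all add: fps_power_zeroth qpoch_inf_nth_0)
  have gen: "(t * (E * R)) * ((p * I)^2 * (P * J)) = I * J * (t * P * (p^2 * R))"
    if "E * I = 1" for t E R p I P J :: "int fps"
    using that by algebra
  show ?thesis unfolding term_F1_def fps_quot_eq_iv iv_mult[OF n0] 1 2 3 e
    by (rule gen, rule iv_mult_self) (simp add: qpoch_inf_nth_0)
qed

text \<open>With \<open>(q;q)_(2m+2)\<close> kept in the term, no denominator enters
  \<open>D\<close>, so the kernel itself rather than a difference is summable. The ratio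
  \<open>D (m+1) / D m\<close> is \<open>q^(m+1) + q^(2m+3)\<close>, again the q-Gauss sum with
  \<open>z = 0\<close>.\<close>

lemma F1_kernel:
  fixes i :: nat
  defines "D \<equiv> \<lambda>m. q ^ tri m * qpoch (- q) q (m+1)"
  shows "iv (euler q) * iv (qpoch_inf (- q) q) * fsum (\<lambda>s. D (i + s) * (rq q s * rq q (2*i+s+2))) =
    (iv (euler q))^2 * (q ^ tri i * (1 + q ^ (i+1)))"
proof -
  let ?E = "euler q" and ?N = "qpoch_inf (- q) q"
  let ?u = "- (q ^ (i+1))" and ?v = "q ^ (2*i+3)"
  let ?C = "q ^ tri i * qpoch (- q) q (i+1) * rq q (2*i+2)"
  let ?G = "fsum (gauss_term q 0 ?u ?v)"
  have prod: "D (i + s) = q ^ tri i * qpoch (- q) q (i+1) * (\<Prod>k<s. 0 - ?u * q ^ k + ?v * q ^ (2*k))" for s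
  proof (induction s)
    case 0
    then show ?case by (simp add: D_def)
  next
    case (Suc s)
    have t: "q ^ tri (i + Suc s) = q ^ tri (i + s) * (q * q ^ i * q ^ s)"
      using tri_Suc[of "i + s"] by (simp add: power_add mult_ac)
    have P: "qpoch (- q) q (i + Suc s + 1) = qpoch (- q) q (i + s + 1) * (1 + q^2 * q ^ i * q ^ s)"
      by (simp add: qpoch_Suc power_add power2_eq_square mult_ac)
    have p: "q ^ (i+1) = q * q ^ i" "?v = q ^ 3 * (q ^ i)^2" "q ^ (2 * s) = (q ^ s)^2"
      by (simp_all add: mult_2 power_add power2_eq_square power_mult_distrib eval_nat_numeral mult_ac)
    have gen: "T * (y * a * b) * (P * (1 + y^2 * a * b)) = T * P * (0 - - (y * a) * b + y ^ 3 * a^2 * b^2)"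
      for T y a b P :: "int fps" by algebra
    have "D (i + Suc s) = D (i + s) * (0 - ?u * q ^ s + ?v * q ^ (2 * s))"
      unfolding D_def t P unfolding p by (rule gen)
    then show ?case unfolding Suc by simp
  qed
  have T: "D (i + s) * (rq q s * rq q (2*i+s+2)) = ?C * gauss_term q 0 ?u ?v s" for s
  proof -
    have "2*i+s+2 = (2*i+2) + s" "Suc (2*i+2) = 2*i+3" by simp_all
    then have "rq q (2*i+s+2) = rq q (2*i+2) * iv (qpoch ?v q s)"
      using rq_add[of q "2*i+2" s] by (simp only: dvd_refl)
    then show ?thesis unfolding prod gauss_term_def by (simp only: mult_ac)
  qed
  have dv: "q dvd 0" "q dvd ?u" "q dvd ?v" by simp_all
  have S: "fsum (\<lambda>s. D (i + s) * (rq q s * rq q (2*i+s+2))) = ?C * ?G"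
    by (rule fsum_gauss_mult[OF T dv])
  have "?G * qpoch_inf ?v q * qpoch_inf 0 q = qpoch_inf ?u q"
  proof (rule q_gauss_sum[OF dvd_refl dv])
    fix N
    have "(\<Prod>k<N. 1 - ?u * q ^ k + ?v * 0 * q ^ (2*k)) = qpoch ?u q N" by (simp add: qpoch_def)
    then show "q ^ N dvd qpoch_inf ?u q - (\<Prod>k<N. 1 - ?u * q ^ k + ?v * 0 * q ^ (2*k))"
      by (simp only:) (rule qpoch_inf_approx; simp)
  qed
  then have G: "?G * qpoch_inf ?v q = qpoch_inf ?u q" by (simp add: qpoch_inf_zero)
  have E: "?E = qpoch q q (2*i+2) * qpoch_inf ?v q"
  proof -
    have "q * q ^ (2*i+2) = ?v" unfolding power_Suc[symmetric] by (rule arg_cong[of _ _ "\<lambda>k. q ^ k"]) simp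
    then show ?thesis using qpoch_inf_split[of q q "2*i+2"] by (simp only: dvd_refl)
  qed
  have N: "?N = qpoch (- q) q i * qpoch_inf ?u q"
    using qpoch_inf_split[of "- q" q i] by simp
  have n: "qpoch (- q) q (i+1) = qpoch (- q) q i * (1 + q ^ (i+1))" by (simp add: qpoch_Suc)
  have inv: "?E * iv ?E = 1" "?N * iv ?N = 1" by (simp_all add: iv_mult_self qpoch_inf_nth_0)
  have gen: "I * J * (t * (n * z) * r * g) = I^2 * (t * z)"
    if "g * v = P" "E = k * v" "W = n * P" "k * r = 1" "E * I = 1" "W * J = 1" for I J t n z r g v P E k W :: "int fps"
  proof -
    have "I * J * (t * (n * z) * r * g) = I * J * (t * (n * z) * r * g) * (E * I)" unfolding that(5) by simp
    also have "\<dots> = I^2 * (t * z) * (n * (g * v) * J) * (k * r)"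
      unfolding that(2) by (simp only: power2_eq_square mult_ac)
    finally show ?thesis unfolding that(1,4) that(3)[symmetric] that(6) by simp
  qed
  show ?thesis unfolding S n by (rule gen[OF G E N qpoch_rq[OF dvd_refl] inv])
qed

text \<open>In the weight times the closed kernel, the cross terms have exponent
  \<open>2 * tri i + (i+1) = (i+1)^2\<close> and coefficient
  \<open>tri (i+1) + tri i = (i+1)^2\<close>. The others have exponents \<open>2 * tri i\<close> and
  \<open>2 * tri (i+1)\<close>; collecting neighbours gives
  \<open>tri (i+1) - tri (i-1) = 2*i+1\<close>, Jacobi's weights in base \<open>q^2\<close>.\<close>

lemma fsum_F1: "fsum (\<lambda>m. term_F1 (Suc m)) = (iv (euler q))^2 *
  (fsum (\<lambda>i. (-1) ^ i * of_nat (2*i+1) * q ^ (2 * tri i)) + fsum (\<lambda>i. (-1) ^ i * of_nat ((i+1) * (i+1)) * q ^ ((i+1) * (i+1))))"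
proof -
  let ?D = "\<lambda>m. q ^ tri m * qpoch (- q) q (m+1)"
  let ?K = "iv (euler q) * iv (qpoch_inf (- q) q)" and ?I = "iv (euler q)"
  let ?a = "\<lambda>i. (-1) ^ i * (of_nat (tri (Suc i)) * q ^ tri i + of_nat (tri i) * q ^ tri (Suc i))"
  let ?f = "\<lambda>i. fsum (\<lambda>s. ?D (i + s) * (rq q s * rq q (2*i+s+2)))"
  let ?y = "\<lambda>i. q ^ (2 * tri i)" and ?z = "\<lambda>i. q ^ ((i+1) * (i+1))"
  have D: "q ^ m dvd ?D m" for m by (intro dvd_mult2 dvd_power_tri dvd_refl)
  have ad: "q ^ i dvd ?a i" for i
    by (intro dvd_mult dvd_add le_imp_power_dvd) (auto intro: order_trans[OF _ le_tri])
  have "fsum (\<lambda>m. term_F1 (Suc m)) = ?K * fsum (\<lambda>m. ?D m * ((qpoch q q m)^2 * rq q (2*m+2)))"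
    unfolding term_F1_eq by (intro fsum_mult_left dvd_mult2[OF D])
  also have "\<dots> = ?K * fsum (\<lambda>i. ?a i * ?f i)"
    unfolding bailey_sum_even[of q ?D, OF dvd_refl fps_X_neq_zero D] ..
  also have "\<dots> = fsum (\<lambda>i. ?K * (?a i * ?f i))" by (intro fsum_mult_left[symmetric] dvd_mult2[OF ad])
  also have "\<dots> = fsum (\<lambda>i. ?I^2 * (?a i * (q ^ tri i * (1 + q ^ (i+1)))))"
  proof (rule fsum_cong)
    fix i
    have "?K * (?a i * ?f i) = ?a i * (?K * ?f i)" by (simp only: mult_ac)
    then show "?K * (?a i * ?f i) = ?I^2 * (?a i * (q ^ tri i * (1 + q ^ (i+1))))"
      unfolding F1_kernel by (simp only: mult_ac)
  qed
  also have "\<dots> = ?I^2 * fsum (\<lambda>i. ?a i * (q ^ tri i * (1 + q ^ (i+1))))"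
    by (intro fsum_mult_left dvd_mult2[OF ad])
  also have "fsum (\<lambda>i. ?a i * (q ^ tri i * (1 + q ^ (i+1)))) =
    fsum (\<lambda>i. (-1) ^ i * of_nat (2*i+1) * ?y i) + fsum (\<lambda>i. (-1) ^ i * of_nat ((i+1) * (i+1)) * ?z i)"
  proof (rule fsum_eqI)
    fix i show "q ^ i dvd ?a i * (q ^ tri i * (1 + q ^ (i+1)))" by (rule dvd_mult2[OF ad])
  next
    fix N
    have y: "q ^ k dvd ?y k" for k using le_tri[of k] by (intro le_imp_power_dvd) simp
    have z: "q ^ k dvd ?z k" for k by (intro le_imp_power_dvd) simp
    have tm: "?a i * (q ^ tri i * (1 + q ^ (i+1))) =
      (-1) ^ i * (of_nat (tri (Suc i)) * ?y i + of_nat (tri i) * ?y (Suc i)) + (-1) ^ i * of_nat ((i+1) * (i+1)) * ?z i" for i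
    proof -
      have t: "q ^ tri (Suc i) = q ^ tri i * q ^ (i+1)" by (simp add: tri_Suc power_add)
      have 1: "?y i = q ^ tri i * q ^ tri i" by (simp only: mult_2 power_add)
      have 2: "?y (Suc i) = q ^ tri i * q ^ (i+1) * (q ^ tri i * q ^ (i+1))" unfolding t[symmetric] by (simp only: mult_2 power_add)
      have "(i+1) * (i+1) = tri i + tri i + (i+1)" using two_tri[of i] by simp
      then have 3: "?z i = q ^ tri i * q ^ tri i * q ^ (i+1)" by (simp only: power_add)
      have "(i+1) * (i+1) = tri (Suc i) + tri i" using two_tri[of i] by (simp add: tri_Suc)
      then have 4: "of_nat ((i+1) * (i+1)) = (of_nat (tri (Suc i)) + of_nat (tri i) :: int fps)" by (simp only: of_nat_add)
      have gen: "\<sigma> * (a * T + b * (T * w)) * (T * (1 + w)) =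
        \<sigma> * (a * (T * T) + b * (T * w * (T * w))) + \<sigma> * (a + b) * (T * T * w)" for \<sigma> a b T w :: "int fps" by algebra
      show ?thesis unfolding 1 2 3 4 t by (rule gen)
    qed
    \<comment> \<open>The last pair of neighbours is incomplete; its leftover is divisible by
      \<open>?y M\<close> and disappears in the limit.\<close>
    have part: "(\<Sum>i<M. ?a i * (q ^ tri i * (1 + q ^ (i+1)))) =
      (\<Sum>i<M. (-1) ^ i * of_nat (2*i+1) * ?y i) + (\<Sum>i<M. (-1) ^ i * of_nat ((i+1) * (i+1)) * ?z i)
      - (-1) ^ M * of_nat (tri (M - 1)) * ?y M" for M
    proof (induction M)
      case 0
      then show ?case by simp
    next
      case (Suc M)
      have "tri (Suc M) = tri (M - 1) + (2 * M + 1)" by (cases M) (auto simp: tri_Suc)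
      then have e: "of_nat (tri (Suc M)) = (of_nat (tri (M - 1)) + of_nat (2 * M + 1) :: int fps)"
        by (simp only: of_nat_add)
      have gen: "Y + Z - \<sigma> * c * y + (\<sigma> * ((c + d) * y + b * y') + \<sigma> * k * z) = Y + \<sigma> * d * y + (Z + \<sigma> * k * z) - - \<sigma> * b * y'"
        for Y Z \<sigma> c d y b y' k z :: "int fps" by algebra
      have s: "(-1) ^ Suc M = (- ((-1) ^ M) :: int fps)" by simp
      show ?case unfolding sum.lessThan_Suc unfolding Suc unfolding tm[of M] unfolding diff_Suc_1 e s by (rule gen)
    qed
    let ?Y = "\<lambda>i. (-1) ^ i * of_nat (2*i+1) * ?y i" and ?Z = "\<lambda>i. (-1) ^ i * of_nat ((i+1) * (i+1)) * ?z i"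
    have "q ^ N dvd (fsum ?Y - (\<Sum>i<N. ?Y i)) + (fsum ?Z - (\<Sum>i<N. ?Z i)) + (-1) ^ N * of_nat (tri (N - 1)) * ?y N"
      by (intro dvd_add fsum_approx dvd_mult y z order_refl)
    moreover have "(a - b) + (c - d) + e = a + c - (b + d - e)" for a b c d e :: "int fps" by simp
    ultimately have "q ^ N dvd fsum ?Y + fsum ?Z - (\<Sum>i<N. ?a i * (q ^ tri i * (1 + q ^ (i+1))))" unfolding part by simp
    then show "\<exists>M\<ge>N. q ^ N dvd fsum ?Y + fsum ?Z - (\<Sum>i<M. ?a i * (q ^ tri i * (1 + q ^ (i+1))))" by blast
  qed
  finally show ?thesis .
qed


section \<open>Coefficients as sums over lattice points, and the odd part of a theta product\<close>

lemma fps_nth_fsum_X_power: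
  assumes "\<And>i. i \<le> d i" shows "fps_nth (fsum (\<lambda>i. of_int (c i) * q ^ d i)) n = (\<Sum>i | d i = n. c i)"
proof -
  have "fps_nth (fsum (\<lambda>i. of_int (c i) * q ^ d i)) n = (\<Sum>i\<le>n. if d i = n then c i else 0)"
    unfolding fsum_def fps_nth_Abs_fps fps_nth_of_int_mult by (intro sum.cong) auto
  also have "\<dots> = (\<Sum>i \<in> {i \<in> {..n}. d i = n}. c i)" by (rule sum.inter_filter[symmetric]) simp
  also have "{i \<in> {..n}. d i = n} = {i. d i = n}" using assms by auto
  finally show ?thesis .
qed

text \<open>The slack 1 in the bound admits the exponent \<open>2*j*(j+1)\<close>, which vanishes at
  \<open>j = -1\<close>.\<close>

lemma finite_fibre_int:
  fixes e :: "int \<Rightarrow> nat"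
  assumes "\<And>u. \<bar>u\<bar> \<le> int (e u) + 1" shows "finite {u. e u = n}"
proof (rule finite_subset)
  show "{u. e u = n} \<subseteq> {- int n - 1..int n + 1}"
  proof
    fix u assume "u \<in> {u. e u = n}"
    then show "u \<in> {- int n - 1..int n + 1}" using assms[of u] by (auto simp: abs_le_iff)
  qed
qed simp

lemma sum_fibre_int:
  fixes e :: "int \<Rightarrow> nat" and w :: "int \<Rightarrow> int"
  assumes "\<And>u. \<bar>u\<bar> \<le> int (e u) + 1"
  shows "(\<Sum>u | e u = n. w u) = (\<Sum>i | e (int i) = n. w (int i)) + (\<Sum>i | e (- int (Suc i)) = n. w (- int (Suc i)))"
proof -
  have fin: "finite {u. e u = n}" by (rule finite_fibre_int[OF assms])
  have "(\<Sum>u\<in>{u. e u = n \<and> u \<ge> 0} \<union> {u. e u = n \<and> u < 0}. w u) =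
      (\<Sum>u | e u = n \<and> u \<ge> 0. w u) + (\<Sum>u | e u = n \<and> u < 0. w u)"
    by (intro sum.union_disjoint finite_subset[OF _ fin]) auto
  also have "{u. e u = n \<and> u \<ge> 0} \<union> {u. e u = n \<and> u < 0} = {u. e u = n}" by auto
  finally have "(\<Sum>u | e u = n. w u) = (\<Sum>u | e u = n \<and> u \<ge> 0. w u) + (\<Sum>u | e u = n \<and> u < 0. w u)" .
  moreover have "(\<Sum>u | e u = n \<and> u \<ge> 0. w u) = (\<Sum>i | e (int i) = n. w (int i))"
    by (rule sum.reindex_bij_witness[of _ int nat]) auto
  moreover have "(\<Sum>u | e u = n \<and> u < 0. w u) = (\<Sum>i | e (- int (Suc i)) = n. w (- int (Suc i)))"
    by (rule sum.reindex_bij_witness[of _ "\<lambda>i. - int (Suc i)" "\<lambda>u. nat (- u - 1)"]) auto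
  ultimately show ?thesis by simp
qed

lemma fps_nth_mult_fibres:
  fixes e :: "int \<Rightarrow> nat" and w w' :: "int \<Rightarrow> int"
  assumes e: "\<And>u. \<bar>u\<bar> \<le> int (e u) + 1"
    and f: "\<And>n. fps_nth f n = (\<Sum>u | e u = n. w u)" and g: "\<And>n. fps_nth g n = (\<Sum>u | e u = n. w' u)"
  shows "fps_nth (f * g) n = (\<Sum>(u,v) | e u + e v = n. w u * w' v)"
proof -
  have fin: "finite {u. e u = n}" for n by (rule finite_fibre_int[OF e])
  have "fps_nth (f * g) n = (\<Sum>i=0..n. \<Sum>(u,v)\<in>{u. e u = i} \<times> {v. e v = n - i}. w u * w' v)"
    unfolding fps_mult_nth f g sum_product sum.cartesian_product ..
  also have "\<dots> = (\<Sum>(i,u,v)\<in>(SIGMA i:{0..n}. {u. e u = i} \<times> {v. e v = n - i}). w u * w' v)"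
    by (rule sum.Sigma) (auto intro: fin)
  also have "\<dots> = (\<Sum>(u,v) | e u + e v = n. w u * w' v)"
    by (rule sum.reindex_bij_witness[of _ "\<lambda>(u,v). (e u, u, v)" "\<lambda>(i,u,v). (u,v)"]) auto
  finally show ?thesis .
qed

text \<open>
  Over all integers, the left-hand side is indexed by pairs $(u,v)$ and the sixth power by pairs
  $(j,k)$; the substitution $u = j + k + 1$, $v = j - k$ matches them when the exponent is odd.
\<close>

lemma odd_part_squares:
  assumes n: "odd n"
  shows "fps_nth (fsum (\<lambda>i. q ^ (i * i) + q ^ (Suc i * Suc i)) *
      fsum (\<lambda>i. (-1) ^ i * of_nat ((i+1) * (i+1)) * q ^ ((i+1) * (i+1)))) n =
    fps_nth (q * euler ((q^2)^2) ^ 6) n"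
proof -
  let ?phi = "fsum (\<lambda>i. q ^ (i * i) + q ^ (Suc i * Suc i))"
  let ?B = "fsum (\<lambda>i. (-1) ^ i * of_nat ((i+1) * (i+1)) * q ^ ((i+1) * (i+1)))"
  let ?C = "euler ((q^2)^2) ^ 3"
  define e where "e = (\<lambda>u :: int. nat (u * u))"
  define d where "d = (\<lambda>j :: int. nat (2 * j * (j + 1)))"
  \<comment> \<open>\<open>W u\<close> is \<open>(-1)^(u+1) * u^2\<close> and \<open>X j\<close> is
    \<open>(-1)^j * (2*j+1)\<close>. Under the substitution \<open>u\<close> and \<open>v\<close>
    have opposite parity and \<open>(2*j+1) * (2*k+1) = u^2 - v^2\<close>, hence
    \<open>X j * X k = W u + W v\<close>.\<close>
  define W where "W = (\<lambda>u :: int. if even u then - (u * u) else u * u)"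
  define X where "X = (\<lambda>j :: int. if even j then 2 * j + 1 else - (2 * j + 1))"
  have sq: "\<bar>u\<bar> \<le> u * u" for u :: int
    by (cases "u = 0") (auto simp: abs_mult_self_eq[symmetric, of u] simp del: abs_mult_self_eq intro: mult_left_le[of 1])
  have e_int: "int (e u) = u * u" for u by (simp add: e_def)
  have e_le: "\<bar>u\<bar> \<le> int (e u) + 1" for u using sq[of u] by (simp add: e_int)
  have prod_nonneg: "0 \<le> j * (j + 1)" for j :: int
    by (cases "j \<ge> 0") (auto intro: mult_nonpos_nonpos)
  have d_int: "int (d j) = 2 * j * (j + 1)" for j using prod_nonneg[of j] by (simp add: d_def mult.assoc)
  have d_le: "\<bar>j\<bar> \<le> int (d j) + 1" for j
    using sq[of j] zero_le_square[of "j + 1"] unfolding d_int by (simp add: algebra_simps)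
  have ei: "e (int i) = i * i" "e (- int (Suc i)) = Suc i * Suc i" for i
    by (simp_all only: e_def minus_mult_minus of_nat_mult[symmetric] nat_int)
  have di: "d (int i) = 4 * tri i" "d (- int (Suc i)) = 4 * tri i" for i
  proof -
    have "4 * tri i = 2 * i * (i + 1)" using two_tri[of i] by simp
    then have t: "int (4 * tri i) = 2 * int i * (int i + 1)" by (simp only: of_nat_mult of_nat_add) simp
    have "int (d (int i)) = int (4 * tri i)" unfolding d_int t by simp
    then show "d (int i) = 4 * tri i" by simp
    have "int (d (- int (Suc i))) = int (4 * tri i)" unfolding d_int t by (simp add: algebra_simps)
    then show "d (- int (Suc i)) = 4 * tri i" by simp
  qed
  have phi: "fps_nth ?phi n = (\<Sum>u | e u = n. 1)" for n
  proof -
    have "?phi = fsum (\<lambda>i. of_int 1 * q ^ (i * i)) + fsum (\<lambda>i. of_int 1 * q ^ (Suc i * Suc i))"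
      unfolding of_int_1 mult_1_left by (intro fsum_add le_imp_power_dvd) simp_all
    then show ?thesis unfolding sum_fibre_int[OF e_le] ei
      by (simp only: fps_add_nth) (intro arg_cong2[of _ _ _ _ "(+)"] fps_nth_fsum_X_power; simp)
  qed
  have W_Suc: "W (- int (Suc i)) = (-1) ^ i * int ((i+1) * (i+1))" "W (int (Suc i)) = (-1) ^ i * int ((i+1) * (i+1))" for i
    by (simp_all add: W_def algebra_simps)
  have B: "fps_nth (2 * ?B) n = (\<Sum>u | e u = n. W u)" for n
  proof -
    have "?B = fsum (\<lambda>i. of_int (W (- int (Suc i))) * q ^ (Suc i * Suc i))"
      unfolding W_Suc by (rule fsum_cong) (simp only: of_int_mult of_int_power of_int_minus of_int_1 of_int_of_nat_eq Suc_eq_plus1)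
    then have b: "fps_nth ?B n = (\<Sum>i | Suc i * Suc i = n. W (- int (Suc i)))"
      by (simp only:) (rule fps_nth_fsum_X_power, simp)
    have "(\<Sum>i | i * i = n. W (int i)) = (\<Sum>i | Suc i * Suc i = n. W (int (Suc i)))"
    proof -
      have "finite {i. i * i = n}" by (rule finite_subset[of _ "{..n}"]) (auto intro: le_square)
      then have "(\<Sum>i | i * i = n. W (int i)) = (\<Sum>i | i * i = n \<and> i \<noteq> 0. W (int i))"
        by (intro sum.mono_neutral_right) (auto simp: W_def)
      also have "\<dots> = (\<Sum>i | Suc i * Suc i = n. W (int (Suc i)))"
        by (rule sum.reindex_bij_witness[of _ Suc "\<lambda>i. i - 1"]) (auto simp del: mult_Suc mult_Suc_right)
      finally show ?thesis .
    qed
    then have "(\<Sum>u | e u = n. W u) = fps_nth ?B n + fps_nth ?B n"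
      unfolding sum_fibre_int[OF e_le] ei b W_Suc by simp
    then show ?thesis by (simp only: mult_2 fps_add_nth)
  qed
  have C: "fps_nth (2 * ?C) n = (\<Sum>u | d u = n. X u)" for n
  proof -
    have X: "X (int i) = (-1) ^ i * int (2*i+1)" "X (- int (Suc i)) = (-1) ^ i * int (2*i+1)" for i
      by (simp_all add: X_def)
    have x: "((q^2)^2) ^ tri i = q ^ (4 * tri i)" for i unfolding power_mult[symmetric] by simp
    have "?C = fsum (\<lambda>i. (-1) ^ i * of_nat (2*i+1) * ((q^2)^2) ^ tri i)"
      by (rule jacobi_cube[symmetric]) (simp_all add: power2_eq_square)
    also have "\<dots> = fsum (\<lambda>i. of_int (X (int i)) * q ^ (4 * tri i))"
      unfolding x by (rule fsum_cong) (simp only: X of_int_mult of_int_power of_int_minus of_int_1 of_int_of_nat_eq)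
    finally have C: "?C = fsum (\<lambda>i. of_int (X (int i)) * q ^ (4 * tri i))" .
    have le: "i \<le> 4 * tri i" for i using le_tri[of i] by simp
    have "fps_nth ?C n = (\<Sum>i | 4 * tri i = n. X (int i))"
      unfolding C by (rule fps_nth_fsum_X_power[OF le])
    then have "(\<Sum>u | d u = n. X u) = fps_nth ?C n + fps_nth ?C n"
      unfolding sum_fibre_int[OF d_le] di X by simp
    then show ?thesis by (simp only: mult_2 fps_add_nth)
  qed
  \<comment> \<open>Sums over all integers count \<open>?B\<close> and Jacobi's series twice. The
    factor 4 from the two cubes is matched by 2 from \<open>?B\<close> and 2 from the symmetry
    between \<open>u\<close> and \<open>v\<close>.\<close>
  have "4 * fps_nth (q * euler ((q^2)^2) ^ 6) n = fps_nth (q * ((2 * ?C) * (2 * ?C))) n"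
  proof -
    have "q * ((2 * y ^ 3) * (2 * y ^ 3)) = of_int 4 * (q * y ^ 6)" for y :: "int fps" unfolding of_int_numeral by algebra
    then show ?thesis by (simp only: fps_nth_of_int_mult)
  qed
  also have "\<dots> = fps_nth ((2 * ?C) * (2 * ?C)) (n - 1)" using n by (simp add: fps_X_mult_nth) (auto elim: oddE)
  also have "\<dots> = (\<Sum>(j,k) | d j + d k = n - 1. X j * X k)" by (rule fps_nth_mult_fibres[OF d_le C C])
  also have "\<dots> = (\<Sum>(u,v) | e u + e v = n. W u + W v)"
  proof (rule sum.reindex_bij_witness[of _ "\<lambda>(u,v). ((u + v - 1) div 2, (u - v - 1) div 2)" "\<lambda>(j,k). (j + k + 1, j - k)"])
    have ed: "e (j + k + 1) + e (j - k) = d j + d k + 1" for j k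
    proof -
      have "int (e (j + k + 1) + e (j - k)) = int (d j + d k + 1)"
        by (simp only: of_nat_add of_nat_1 d_int e_int) (simp add: algebra_simps)
      then show ?thesis by (simp only: of_nat_eq_iff)
    qed
    show "(case case p of (j,k) \<Rightarrow> (j + k + 1, j - k) of (u,v) \<Rightarrow> ((u + v - 1) div 2, (u - v - 1) div 2)) = p" for p :: "int \<times> int"
      by (auto split: prod.splits)
    show "(case p of (j,k) \<Rightarrow> (j + k + 1, j - k)) \<in> {(u,v). e u + e v = n}" if "p \<in> {(j,k). d j + d k = n - 1}" for p
      using that n ed by (auto elim!: oddE)
    show "(case case p of (j,k) \<Rightarrow> (j + k + 1, j - k) of (u,v) \<Rightarrow> W u + W v) = (case p of (j,k) \<Rightarrow> X j * X k)" for p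
      by (cases p) (auto simp: X_def W_def algebra_simps)
    fix p assume p: "p \<in> {(u,v). e u + e v = n}"
    obtain u v where uv: "p = (u,v)" by (cases p)
    have "int n = u * u + v * v" using p by (auto simp: uv e_def)
    then have "odd (u * u + v * v)" using n by (metis even_of_nat)
    then have odd: "odd (u + v)" by simp
    define j k where "j = (u + v - 1) div 2" and "k = (u - v - 1) div 2"
    have u: "u = j + k + 1" and v: "v = j - k" using odd unfolding j_def k_def by presburger+
    show "(case case p of (u,v) \<Rightarrow> ((u + v - 1) div 2, (u - v - 1) div 2) of (j,k) \<Rightarrow> (j + k + 1, j - k)) = p"
      using u v by (simp add: uv flip: j_def k_def)
    have "e u + e v = n" using p by (simp add: uv)
    then have "d j + d k = n - 1" using ed[of j k] by (simp only: u[symmetric] v[symmetric])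
    then show "(case p of (u,v) \<Rightarrow> ((u + v - 1) div 2, (u - v - 1) div 2)) \<in> {(j,k). d j + d k = n - 1}"
      by (simp add: uv flip: j_def k_def)
  qed
  also have "\<dots> = (\<Sum>(u,v) | e u + e v = n. W u) + (\<Sum>(u,v) | e u + e v = n. W v)"
    by (simp add: sum.distrib case_prod_unfold)
  also have "(\<Sum>(u,v) | e u + e v = n. W u) = (\<Sum>(u,v) | e u + e v = n. W v)"
    by (rule sum.reindex_bij_witness[of _ prod.swap prod.swap]) auto
  also have "(\<Sum>(u,v) | e u + e v = n. W v) = fps_nth (?phi * (2 * ?B)) n"
    using fps_nth_mult_fibres[OF e_le phi B, of n] by (simp only: mult_1_left)
  also have "?phi * (2 * ?B) = of_int 2 * (?phi * ?B)" by (simp add: mult_ac)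
  finally show ?thesis unfolding fps_nth_of_int_mult by simp
qed


lemma lacunary_even_products:
  "lacunary 0 2 (euler (q^2))" "lacunary 0 2 (euler ((q^2)^2))"
proof -
  show "lacunary 0 2 (euler (q^2))" by (rule lacunary_qpoch_inf) simp
  have "lacunary 0 4 (euler (q ^ 4))" by (rule lacunary_qpoch_inf) simp
  moreover have "4 dvd n \<Longrightarrow> 2 dvd n" for n :: nat by presburger
  ultimately have "lacunary 0 2 (euler (q ^ 4))" unfolding lacunary_def by blast
  then show "lacunary 0 2 (euler ((q^2)^2))" by simp
qed

text \<open>Once the weights divisible by 5 are discarded on both sides, the exponent is twice a
  residue 0 or 1 plus a residue 0 or 1, hence at most 3 modulo 5.\<close>

lemma vanishes_F1_cubes:
  "vanishes 5 5 4 ((iv (euler q))^2 * fsum (\<lambda>i. (-1) ^ i * of_nat (2*i+1) * q ^ (2 * tri i)))"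
proof (rule vanishes_iv_square_mult)
  fix i
  show "q ^ i dvd (-1) ^ i * of_nat (2*i+1) * q ^ (2 * tri i)"
    using le_tri[of i] by (intro dvd_mult le_imp_power_dvd) simp
  have "vanishes 5 5 4 ((-1) ^ i * of_nat (2*i+1) * (q ^ (2 * tri i) * euler q ^ 3))"
  proof (rule vanishes_coeff_mult)
    show "vanishes 5 5 4 (q ^ (2 * tri i) * euler q ^ 3) \<or> 5 dvd int (2*i+1)"
    proof (cases "i mod 5 = 2")
      case True
      then show ?thesis by (intro disjI2) presburger
    next
      case False
      have c: "(2 * m + t) mod 5 \<noteq> 4" if "m mod 5 = 0 \<or> m mod 5 = 1" "t mod 5 = 0 \<or> t mod 5 = 1" for m t :: nat
        using that by presburger
      show ?thesis by (intro disjI1 vanishes_X_power_euler_cube c tri_mod_5 False)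
    qed
  qed
  then show "vanishes 5 5 4 ((-1) ^ i * of_nat (2*i+1) * q ^ (2 * tri i) * euler q ^ 3)"
    by (simp only: mult.assoc)
qed

text \<open>From \<open>phi(q) = E(q^2)^5 / (E(q)^2 E(q^4)^2)\<close> the constant
  \<open>1/E(q)^2\<close> becomes \<open>phi(q) E(q^4)^2 / E(q^2)^5\<close>. Up to a series in even
  powers, \<open>phi\<close> times the square series is \<open>q * E(q^4)^6\<close>, so only
  \<open>E(q^4)^5 * (q * E(q^4)^3)\<close> is left for odd exponents; by Jacobi, an exponent
  \<open>4 * tri i + 1\<close> in class 9 would require \<open>tri i\<close> congruent to 2 modulo
  5. The need for odd exponents explains the modulus 10.\<close>

lemma vanishes_F1_squares:
  "vanishes 5 10 9 ((iv (euler q))^2 * fsum (\<lambda>i. (-1) ^ i * of_nat ((i+1) * (i+1)) * q ^ ((i+1) * (i+1))))"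
proof -
  let ?E1 = "euler q" and ?E2 = "euler (q^2)" and ?E4 = "euler ((q^2)^2)"
  let ?B = "fsum (\<lambda>i. (-1) ^ i * of_nat ((i+1) * (i+1)) * q ^ ((i+1) * (i+1)))"
  let ?phi = "fsum (\<lambda>i. q ^ (i * i) + q ^ (Suc i * Suc i))"
  let ?R = "?phi * ?B - q * ?E4 ^ 6"
  have inv: "?E1 * iv ?E1 = 1" "?E2 * iv ?E2 = 1" by (simp_all add: iv_mult_self qpoch_inf_nth_0)
  have gen: "I^2 * S = J ^ 5 * (Q^2 * (P * S - y * Q ^ 6) + Q ^ 5 * (y * Q ^ 3))"
    if "E1 * I = 1" "E2 * J = 1" "E1 = W * E2" "W * N * Q = E2" "P = N^2 * E2" for I J Q P S y E1 E2 W N :: "int fps"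
  proof -
    have "J ^ 5 * (Q^2 * (P * S - y * Q ^ 6) + Q ^ 5 * (y * Q ^ 3)) = J ^ 5 * Q^2 * P * S * (E1 * I)^2"
      unfolding that(1) by (simp add: algebra_simps power_numeral_reduce)
    also have "\<dots> = I^2 * S * ((W * N * Q)^2 * J^2) * (E2 * J) ^ 3"
      unfolding that(3,5) by algebra
    also have "\<dots> = I^2 * S * (E2 * J)^2 * (E2 * J) ^ 3" unfolding that(4) by (simp only: power_mult_distrib)
    finally show ?thesis unfolding that(2) by simp
  qed
  have eq: "(iv ?E1)^2 * ?B = iv ?E2 ^ 5 * (?E4^2 * ?R + ?E4 ^ 5 * (q * ?E4 ^ 3))"
    by (rule gen[OF inv euler_1 euler_product_sq gauss_phi])
  \<comment> \<open>Modulus 0: the coefficients of \<open>?R\<close> at odd exponents are exactly 0,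
    hence also divisible by 5.\<close>
  have R: "vanishes 0 2 1 ?R"
    using odd_part_squares unfolding vanishes_def by (auto simp: odd_iff_mod_2_eq_one)
  have "vanishes 0 2 1 (?E4^2 * ?R)" by (intro vanishes_mult R lacunary_power lacunary_even_products)
  moreover have "n mod 2 = 1" if "n mod 10 = 9" for n :: nat using that by presburger
  ultimately have 1: "vanishes 5 10 9 (?E4^2 * ?R)" unfolding vanishes_def by simp
  have x: "q * ((-1) ^ i * of_nat (2*i+1) * ((q^2)^2) ^ tri i) = (-1) ^ i * of_nat (2*i+1) * q ^ (4 * tri i + 1)" for i
  proof -
    have "((q^2)^2) ^ tri i = q ^ (4 * tri i)" unfolding power_mult[symmetric] by simp
    then show ?thesis by (simp only: power_add power_one_right mult_ac)
  qed
  have J: "?E4 ^ 3 = fsum (\<lambda>i. (-1) ^ i * of_nat (2*i+1) * ((q^2)^2) ^ tri i)"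
    by (rule jacobi_cube[symmetric]) (simp_all add: power2_eq_square)
  have "q * ?E4 ^ 3 = fsum (\<lambda>i. q * ((-1) ^ i * of_nat (2*i+1) * ((q^2)^2) ^ tri i))"
    unfolding J by (intro fsum_mult_left[symmetric] dvd_mult dvd_power_tri) (simp add: power2_eq_square)
  then have "q * ?E4 ^ 3 = fsum (\<lambda>i. (-1) ^ i * of_nat (2*i+1) * q ^ (4 * tri i + 1))"
    unfolding x .
  moreover have "vanishes 5 10 9 (fsum (\<lambda>i. (-1) ^ i * of_nat (2*i+1) * q ^ (4 * tri i + 1)))"
  proof (intro vanishes_fsum vanishes_coeff_mult disjI1 vanishes_X_power)
    fix i
    have "tri i mod 5 \<noteq> 2" using tri_mod_5[of i] by fastforce
    moreover have "t mod 5 = 2" if "(4 * t + 1) mod 10 = 9" for t :: nat using that by presburger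
    ultimately show "(4 * tri i + 1) mod 10 \<noteq> 9" by blast
  qed
  ultimately have 2: "vanishes 5 10 9 (q * ?E4 ^ 3)" by simp
  have l: "lacunary 5 10 (?E4 ^ 5)" "lacunary 5 10 (iv ?E2 ^ 5)"
    by (intro lacunary_combine lacunary_fifth lacunary_power lacunary_iv lacunary_even_products; simp add: qpoch_inf_nth_0)+
  show ?thesis unfolding eq by (intro vanishes_mult[OF _ l(2)] vanishes_add 1 vanishes_mult[OF 2 l(1)])
qed

lemma vanishes_F1: "vanishes 5 10 9 (fsum (\<lambda>m. term_F1 (Suc m)))"
proof -
  have "n mod 5 = 4" if "n mod 10 = 9" for n :: nat using that by presburger
  then have "vanishes 5 10 9 ((iv (euler q))^2 * fsum (\<lambda>i. (-1) ^ i * of_nat (2*i+1) * q ^ (2 * tri i)))"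
    using vanishes_F1_cubes unfolding vanishes_def by blast
  then show ?thesis unfolding fsum_F1 distrib_left[of "(iv (euler q))^2"] by (intro vanishes_add vanishes_F1_squares)
qed

lemma X_power_dvd_terms:
  "q ^ k dvd term_G1 (Suc k)" "q ^ k dvd term_G2 (Suc k)" "q ^ k dvd term_L7 (Suc k)"
  "q ^ k dvd term_L9 (Suc k)" "q ^ k dvd term_L12 (Suc k)"
  "q ^ k dvd term_F1 (Suc k)" "q ^ k dvd term_G3 (Suc k)"
proof -
  show "q ^ k dvd term_G1 (Suc k)" "q ^ k dvd term_G2 (Suc k)" "q ^ k dvd term_L7 (Suc k)"
    "q ^ k dvd term_L9 (Suc k)" "q ^ k dvd term_L12 (Suc k)"
    unfolding term_G1_def term_G2_def term_L7_def term_L9_def term_L12_def fps_quot_def mult.assoc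
    by (intro dvd_mult2 le_imp_power_dvd; simp)+
  have "Suc k * (Suc k - 1) div 2 = tri k" by (simp add: tri_def mult.commute)
  then show "q ^ k dvd term_F1 (Suc k)" unfolding term_F1_def fps_quot_def mult.assoc
    by (simp only:) (intro dvd_mult2 dvd_power_tri dvd_refl)
  have "Suc k * (Suc k + 1) div 2 = tri (Suc k)" by (simp add: tri_def)
  then show "q ^ k dvd term_G3 (Suc k)" unfolding term_G3_def fps_quot_def mult.assoc
    using le_tri[of "Suc k"] by (simp only:) (intro dvd_mult[OF dvd_mult2] le_imp_power_dvd, simp)
qed

theorem theorem2p1:
  fixes n :: nat
  shows "[spt_G1 (3 * n) = 0] (mod 3)
    \<and> [spt_G2 (3 * n) = 0] (mod 3)
    \<and> [spt_G2 (3 * n + 2) = 0] (mod 3)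
    \<and> [spt_L7 (3 * n + 1) = 0] (mod 3)
    \<and> [spt_L9 (3 * n + 2) = 0] (mod 3)
    \<and> [spt_L12 (3 * n) = 0] (mod 3)
    \<and> [spt_F1 (10 * n + 9) = 0] (mod 5)
    \<and> [spt_G3 (5 * n + 3) = 0] (mod 5)"
proof -
  have m: "(3 * n) mod 3 = 0" "(3 * n + 1) mod 3 = 1" "(3 * n + 2) mod 3 = 2"
    "(10 * n + 9) mod 10 = 9" "(5 * n + 3) mod 5 = 3" by presburger+
  show ?thesis
    unfolding spt_G1_def spt_G2_def spt_L7_def spt_L9_def spt_L12_def spt_F1_def spt_G3_def
    using spt_coeff_cong[of term_G1, OF X_power_dvd_terms(1) vanishes_G1 m(1)]
      spt_coeff_cong[of term_G2, OF X_power_dvd_terms(2) vanishes_G2 m(1)]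
      spt_coeff_cong[of term_G2, OF X_power_dvd_terms(2) vanishes_G2 m(3)]
      spt_coeff_cong[of term_L7, OF X_power_dvd_terms(3) vanishes_L7 m(2)]
      spt_coeff_cong[of term_L9, OF X_power_dvd_terms(4) vanishes_L9 m(3)]
      spt_coeff_cong[of term_L12, OF X_power_dvd_terms(5) vanishes_L12 m(1)]
      spt_coeff_cong[of term_F1, OF X_power_dvd_terms(6) vanishes_F1 m(4)]
      spt_coeff_cong[of term_G3, OF X_power_dvd_terms(7) vanishes_G3 m(5)]
    by simp
qed

end
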